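(* Let $r\geq 2$ and $n\geq 2r+1$ be integers, set $\alpha:=\left\lfloor\frac{n+1}{r+1}\right\rfloor$, and let $h_\alpha$ be the function defined in the context. If either - $n\geq r^2+3r+1$ and $h\leq\alpha\, h_\alpha(r-1)$, or - $n<r^2+3r+1$, $r$ is even, and $h\leq(\alpha-1)h_\alpha(r-1)+h_\alpha(n-2-\alpha r)$, or - $n<r^2+3r+1$, $r$ is odd, and $h\leq(\alpha-1)h_\alpha(r-2)+h_\alpha(\min\{n-3-\alpha(r-1),\,r-2\})$, then the Grassmannian $\mathbb{G}(r,n)$ is not $(h+1)$-defective.
   Context: The base field is $\mathbb{C}$. $\mathbb{G}(r,n)$ is the Grassmannian of $r$-dimensional linear subspaces of $\mathbb{P}^n$, embedded in $\mathbb{P}^N$, $N=\binom{n+1}{r+1}-1$, by the Plücker embedding. For a non-degenerate variety $X\subset\mathbb{P}^N$, $\mathbb{S}ec_h(X)$ is the Zariski closure of the union of the linear spaces spanned by collections of $h$ points of $X$, and $X$ is $h$-defective if $\dim\mathbb{S}ec_h(X)<\min\{h\dim X+h-1,N\}$. For an integer $m\geq 2$ the function $h_m:\mathbb{N}_{\geq 0}\to\mathbb{N}_{\geq 0}$ is defined by $h_m(0)=0$ and, for $k\geq 1$, writing $k+1=2^{\lambda_1}+2^{\lambda_2}+\dots+2^{\lambda_l}+\varepsilon$ with $\lambda_1>\lambda_2>\dots>\lambda_l\geq 1$ and $\varepsilon\in\{0,1\}$, by $h_m(k)=m^{\lambda_1-1}+m^{\lambda_2-1}+\dots+m^{\lambda_l-1}$.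 *)

theory Defs
  imports
    "HOL-Analysis.Abstract_Topology"
    "HOL-Library.Function_Algebras"
    "HOL-Library.Extended_Nat"
    "HOL-Library.Nat_Bijection"
    "Jordan_Normal_Form.Determinant"
begin

definition cscale :: "complex \<Rightarrow> ('i \<Rightarrow> complex) \<Rightarrow> 'i \<Rightarrow> complex" where
  "cscale c v = (\<lambda>i. c * v i)"

global_interpretation cvec: vector_space "cscale :: complex \<Rightarrow> ('i \<Rightarrow> complex) \<Rightarrow> 'i \<Rightarrow> complex"
  by unfold_locales (auto simp: cscale_def algebra_simps fun_eq_iff)

text \<open>
  The coordinate space with coordinates indexed by a finite set \<open>I\<close> consists of the functions that
  vanish outside \<open>I\<close>. A point of the projective space of dimension \<open>card I - 1\<close> is a
  one-dimensional linear subspace of it.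
\<close>

definition coord_space :: "'i set \<Rightarrow> ('i \<Rightarrow> complex) set" where
  "coord_space I = {v. \<forall>i. i \<notin> I \<longrightarrow> v i = 0}"

definition linear_subspaces :: "'i set \<Rightarrow> nat \<Rightarrow> ('i \<Rightarrow> complex) set set" where
  "linear_subspaces I k = {W. W \<subseteq> coord_space I \<and> cvec.subspace W \<and> cvec.dim W = k}"

definition proj_space :: "'i set \<Rightarrow> ('i \<Rightarrow> complex) set set" where
  "proj_space I = linear_subspaces I 1"

definition proj_span :: "'i set \<Rightarrow> ('i \<Rightarrow> complex) set set \<Rightarrow> ('i \<Rightarrow> complex) set set" where
  "proj_span I Q = {p \<in> proj_space I. p \<subseteq> cvec.span (\<Union>Q)}"

text \<open>
  Homogeneous polynomials of degree \<open>d\<close> in the coordinates indexed by \<open>I\<close>, as functions;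
  the zero polynomial is homogeneous of every degree.
\<close>

inductive homogeneous_poly :: "'i set \<Rightarrow> nat \<Rightarrow> (('i \<Rightarrow> complex) \<Rightarrow> complex) \<Rightarrow> bool" for I where
  const: "homogeneous_poly I 0 (\<lambda>v. c)"
| coord: "i \<in> I \<Longrightarrow> homogeneous_poly I 1 (\<lambda>v. v i)"
| zero: "homogeneous_poly I d (\<lambda>v. 0)"
| add: "homogeneous_poly I d f \<Longrightarrow> homogeneous_poly I d g \<Longrightarrow> homogeneous_poly I d (\<lambda>v. f v + g v)"
| mult: "homogeneous_poly I d f \<Longrightarrow> homogeneous_poly I e g \<Longrightarrow>
    homogeneous_poly I (d + e) (\<lambda>v. f v * g v)"

definition zero_locus :: "'i set \<Rightarrow> (('i \<Rightarrow> complex) \<Rightarrow> complex) set \<Rightarrow> ('i \<Rightarrow> complex) set set" where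
  "zero_locus I F = {p \<in> proj_space I. \<forall>f\<in>F. \<forall>v\<in>p. f v = 0}"

definition zariski :: "'i set \<Rightarrow> ('i \<Rightarrow> complex) set topology" where
  "zariski I = topology (\<lambda>U. \<exists>F. (\<forall>f\<in>F. \<exists>d. homogeneous_poly I d f) \<and>
     U = proj_space I - zero_locus I F)"

lemma homogeneous_poly_cscale:
  "homogeneous_poly I d f \<Longrightarrow> f (cscale c v) = c ^ d * f v"
  by (induction rule: homogeneous_poly.induct) (auto simp: cscale_def algebra_simps power_add)

lemma proj_space_span:
  assumes "p \<in> proj_space I"
  obtains b where "p = cvec.span {b}"
proof -
  have p: "cvec.subspace p" "cvec.dim p = 1"
    using assms by (auto simp: proj_space_def linear_subspaces_def)
  obtain B where B: "B \<subseteq> p" "cvec.independent B" "p \<subseteq> cvec.span B" "card B = cvec.dim p"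
    using cvec.basis_exists by blast
  obtain b where "B = {b}" using B(4) p(2) card_1_singletonE by metis
  moreover have "cvec.span B \<subseteq> p" using B(1) p(1) by (rule cvec.span_minimal)
  ultimately show ?thesis using that B(3) by blast
qed

lemma zero_locus_mult:
  assumes "homogeneous_poly I d f" "homogeneous_poly I e g" "p \<in> proj_space I"
  shows "(\<forall>v\<in>p. f v * g v = 0) \<longleftrightarrow> (\<forall>v\<in>p. f v = 0) \<or> (\<forall>v\<in>p. g v = 0)"
proof -
  obtain b where p: "p = cvec.span {b}" using proj_space_span[OF assms(3)] .
  have *: "p = range (\<lambda>c. cscale c b)" unfolding p by (rule cvec.span_singleton)
  have b: "b \<in> p" unfolding p by (simp add: cvec.span_base)
  have f: "(\<forall>v\<in>p. f v = 0) \<longleftrightarrow> f b = 0" and g: "(\<forall>v\<in>p. g v = 0) \<longleftrightarrow> g b = 0"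
    using b assms(1,2) by (auto simp: * homogeneous_poly_cscale)
  show ?thesis
  proof
    assume "\<forall>v\<in>p. f v * g v = 0"
    then have "f b * g b = 0" using b by (rule bspec)
    then show "(\<forall>v\<in>p. f v = 0) \<or> (\<forall>v\<in>p. g v = 0)" unfolding f g by simp
  qed auto
qed

lemma istopology_zariski:
  fixes I :: "'a set"
  shows "istopology (\<lambda>U. \<exists>F. (\<forall>f\<in>F. \<exists>d. homogeneous_poly I d f) \<and> U = proj_space I - zero_locus I F)"
  (is "istopology ?O")
  unfolding istopology_def
proof (intro conjI allI impI)
  fix U W assume "?O U" "?O W"
  obtain F where F: "\<forall>f\<in>F. \<exists>d. homogeneous_poly I d f" "U = proj_space I - zero_locus I F"
    using \<open>?O U\<close> by (elim exE conjE)
  obtain G where G: "\<forall>g\<in>G. \<exists>d. homogeneous_poly I d g" "W = proj_space I - zero_locus I G"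
    using \<open>?O W\<close> by (elim exE conjE)
  define m where "m = (\<lambda>(f :: ('a \<Rightarrow> complex) \<Rightarrow> complex, g) v. f v * g v)"
  define H where "H = m ` (F \<times> G)"
  have iff: "p \<in> zero_locus I H \<longleftrightarrow> p \<in> zero_locus I F \<or> p \<in> zero_locus I G"
    if p: "p \<in> proj_space I" for p
  proof -
    have "p \<in> zero_locus I H \<longleftrightarrow> (\<forall>f\<in>F. \<forall>g\<in>G. \<forall>v\<in>p. f v * g v = 0)"
      using p by (simp add: zero_locus_def H_def m_def)
    also have "\<dots> \<longleftrightarrow> (\<forall>f\<in>F. \<forall>g\<in>G. (\<forall>v\<in>p. f v = 0) \<or> (\<forall>v\<in>p. g v = 0))"
    proof (intro ball_cong refl)
      fix f g assume "f \<in> F" "g \<in> G"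
      obtain d where d: "homogeneous_poly I d f" using F(1) \<open>f \<in> F\<close> by (elim ballE exE) auto
      obtain e where e: "homogeneous_poly I e g" using G(1) \<open>g \<in> G\<close> by (elim ballE exE) auto
      show "(\<forall>v\<in>p. f v * g v = 0) \<longleftrightarrow> (\<forall>v\<in>p. f v = 0) \<or> (\<forall>v\<in>p. g v = 0)"
        using d e p by (rule zero_locus_mult)
    qed
    also have "\<dots> \<longleftrightarrow> (\<forall>f\<in>F. \<forall>v\<in>p. f v = 0) \<or> (\<forall>g\<in>G. \<forall>v\<in>p. g v = 0)"
      by blast
    finally show ?thesis using p by (simp add: zero_locus_def)
  qed
  have "U \<inter> W = proj_space I - zero_locus I H"
    unfolding F(2) G(2) set_eq_iff Int_iff Diff_iff using iff by blast
  moreover have "\<forall>f\<in>H. \<exists>d. homogeneous_poly I d f"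
  proof
    fix k assume "k \<in> H"
    then obtain f g where k: "f \<in> F" "g \<in> G" "k = (\<lambda>v. f v * g v)"
      by (auto simp: H_def m_def)
    obtain d where d: "homogeneous_poly I d f" using F(1) k(1) by (elim ballE exE) auto
    obtain e where e: "homogeneous_poly I e g" using G(1) k(2) by (elim ballE exE) auto
    show "\<exists>d. homogeneous_poly I d k"
      unfolding k(3) using homogeneous_poly.mult[OF d e] by (rule exI)
  qed
  ultimately show "?O (U \<inter> W)" by (intro exI[of _ H] conjI)
next
  fix \<U> assume U: "\<forall>U\<in>\<U>. ?O U"
  obtain F where F: "\<forall>U\<in>\<U>. (\<forall>f\<in>F U. \<exists>d. homogeneous_poly I d f) \<and> U = proj_space I - zero_locus I (F U)"
    using bchoice[OF U] by (elim exE)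
  have "p \<in> \<Union>\<U> \<longleftrightarrow> p \<in> proj_space I - zero_locus I (\<Union>(F ` \<U>))" for p
  proof -
    have "p \<in> \<Union>\<U> \<longleftrightarrow> (\<exists>U\<in>\<U>. p \<in> U)" by (rule Union_iff)
    also have "\<dots> \<longleftrightarrow> (\<exists>U\<in>\<U>. p \<in> proj_space I - zero_locus I (F U))"
      using F by (intro bex_cong refl) (metis (no_types))
    also have "\<dots> \<longleftrightarrow> p \<in> proj_space I - zero_locus I (\<Union>(F ` \<U>))"
      by (auto simp: zero_locus_def)
    finally show ?thesis .
  qed
  then have "\<Union>\<U> = proj_space I - zero_locus I (\<Union>(F ` \<U>))" by (rule Set.set_eqI)
  moreover have "\<forall>f\<in>\<Union>(F ` \<U>). \<exists>d. homogeneous_poly I d f"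
  proof (rule ballI)
    fix f assume "f \<in> \<Union>(F ` \<U>)"
    then obtain U where "U \<in> \<U>" "f \<in> F U" by (rule UN_E)
    have "\<forall>f\<in>F U. \<exists>d. homogeneous_poly I d f"
      using bspec[OF F \<open>U \<in> \<U>\<close>] by (rule conjunct1)
    then show "\<exists>d. homogeneous_poly I d f" using \<open>f \<in> F U\<close> by (rule bspec)
  qed
  ultimately show "?O (\<Union>\<U>)" by (intro exI[of _ "\<Union>(F ` \<U>)"] conjI)
qed

lemma openin_zariski:
  "openin (zariski I) U \<longleftrightarrow>
     (\<exists>F. (\<forall>f\<in>F. \<exists>d. homogeneous_poly I d f) \<and> U = proj_space I - zero_locus I F)"
  unfolding zariski_def topology_inverse'[OF istopology_zariski] by (rule refl)

lemma zero_locus_subset: "zero_locus I F \<subseteq> proj_space I"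
  by (simp add: zero_locus_def)

lemma topspace_zariski: "topspace (zariski I) = proj_space I"
proof (rule equalityI)
  show "topspace (zariski I) \<subseteq> proj_space I"
    using openin_topspace[of "zariski I"] unfolding openin_zariski by (elim exE conjE) simp
  have "0 \<in> p" if "p \<in> proj_space I" for p
    using that cvec.subspace_0[of p] by (simp add: proj_space_def linear_subspaces_def)
  then have "zero_locus I {\<lambda>v. 1} = {}"
    unfolding zero_locus_def by fastforce
  then have "proj_space I = proj_space I - zero_locus I {\<lambda>v. 1}" by simp
  moreover have "\<forall>f\<in>{\<lambda>v. 1}. \<exists>d. homogeneous_poly I d f"
    using homogeneous_poly.const[of I 1] by (intro ballI exI[of _ 0]) simp
  ultimately have "openin (zariski I) (proj_space I)"
    unfolding openin_zariski by (intro exI[of _ "{\<lambda>v. 1}"] conjI)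
  then show "proj_space I \<subseteq> topspace (zariski I)" by (rule openin_subset)
qed

lemma closedin_zariski:
  "closedin (zariski I) Z \<longleftrightarrow> (\<exists>F. (\<forall>f\<in>F. \<exists>d. homogeneous_poly I d f) \<and> Z = zero_locus I F)"
    (is "_ \<longleftrightarrow> (\<exists>F. ?H F \<and> _ F)")
proof
  assume "closedin (zariski I) Z"
  then have Z: "Z \<subseteq> proj_space I" "openin (zariski I) (proj_space I - Z)"
    by (simp_all add: closedin_def topspace_zariski)
  obtain F where F: "?H F" "proj_space I - Z = proj_space I - zero_locus I F"
    using Z(2) unfolding openin_zariski by (elim exE conjE)
  have "Z = zero_locus I F"
    using Z(1) F(2) zero_locus_subset[of I F] by (metis double_diff order_refl)
  with F(1) show "\<exists>F. ?H F \<and> Z = zero_locus I F" by (intro exI[of _ F] conjI)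
next
  assume "\<exists>F. ?H F \<and> Z = zero_locus I F"
  then obtain F where F: "?H F" "Z = zero_locus I F" by (elim exE conjE)
  have "openin (zariski I) (proj_space I - Z)"
    unfolding openin_zariski using F by (intro exI[of _ F] conjI) simp_all
  then show "closedin (zariski I) Z"
    using zero_locus_subset[of I F] by (simp add: closedin_def topspace_zariski F(2))
qed

definition irreducible_in :: "'a topology \<Rightarrow> 'a set \<Rightarrow> bool" where
  "irreducible_in T Z \<longleftrightarrow> Z \<subseteq> topspace T \<and> Z \<noteq> {} \<and>
     (\<forall>A B. closedin T A \<longrightarrow> closedin T B \<longrightarrow> Z \<subseteq> A \<union> B \<longrightarrow> Z \<subseteq> A \<or> Z \<subseteq> B)"

text \<open>
  The supremum of the lengths of chains of irreducible closed sets. The empty space gets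
  dimension 0.
\<close>

definition krull_dim :: "'a topology \<Rightarrow> enat" where
  "krull_dim T = Sup {enat k | k. \<exists>Z :: nat \<Rightarrow> 'a set.
     (\<forall>i\<le>k. closedin T (Z i) \<and> irreducible_in T (Z i)) \<and> (\<forall>i<k. Z i \<subset> Z (Suc i))}"

definition proj_dim :: "'i set \<Rightarrow> ('i \<Rightarrow> complex) set set \<Rightarrow> enat" where
  "proj_dim I X = krull_dim (subtopology (zariski I) X)"

text \<open>
  Collections of \<open>h\<close> points are families indexed by \<open>{..<h}\<close>; repetitions only contribute spans
  contained in spans of \<open>h\<close> distinct points as soon as \<open>X\<close> has at least \<open>h\<close> points.
\<close>

definition secant_variety :: "'i set \<Rightarrow> ('i \<Rightarrow> complex) set set \<Rightarrow> nat \<Rightarrow> ('i \<Rightarrow> complex) set set" where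
  "secant_variety I X h =
     zariski I closure_of (\<Union>x \<in> {x. \<forall>i<h. x i \<in> X}. proj_span I (x ` {..<h}))"

text \<open>Only meaningful for \<open>h \<ge> 1\<close> (subtraction on \<^typ>\<open>enat\<close> is truncated).\<close>

definition defective :: "'i set \<Rightarrow> ('i \<Rightarrow> complex) set set \<Rightarrow> nat \<Rightarrow> bool" where
  "defective I X h \<longleftrightarrow>
     proj_dim I (secant_variety I X h) < min (enat h * proj_dim I X + enat h - 1) (enat (card I - 1))"

text \<open>
  The \<open>r\<close>-dimensional linear subspaces of projective \<open>n\<close>-space are the \<open>(r+1)\<close>-dimensional
  linear subspaces of the coordinate space on \<open>{..n}\<close>. The Pluecker coordinates of the span of
  \<open>u 0, \<dots>, u r\<close> are the maximal minors of the matrix with rows \<open>u i\<close>, indexed by the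
  \<open>(r+1)\<close>-element subsets of \<open>{..n}\<close>.
\<close>

definition pluecker_index :: "nat \<Rightarrow> nat \<Rightarrow> nat set set" where
  "pluecker_index r n = {S. S \<subseteq> {..n} \<and> card S = r + 1}"

definition pluecker_coords :: "nat \<Rightarrow> nat \<Rightarrow> (nat \<Rightarrow> nat \<Rightarrow> complex) \<Rightarrow> nat set \<Rightarrow> complex" where
  "pluecker_coords r n u = (\<lambda>S. if S \<in> pluecker_index r n
     then Determinant.det (mat (r + 1) (r + 1) (\<lambda>(i, j). u i (sorted_list_of_set S ! j))) else 0)"

definition is_basis :: "nat \<Rightarrow> (nat \<Rightarrow> 'i \<Rightarrow> complex) \<Rightarrow> ('i \<Rightarrow> complex) set \<Rightarrow> bool" where
  "is_basis r u W \<longleftrightarrow> inj_on u {..r} \<and> cvec.independent (u ` {..r}) \<and> cvec.span (u ` {..r}) = W"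

definition grassmannian :: "nat \<Rightarrow> nat \<Rightarrow> (nat set \<Rightarrow> complex) set set" where
  "grassmannian r n = {cvec.span {pluecker_coords r n u} | u W.
     W \<in> linear_subspaces {..n} (r + 1) \<and> is_basis r u W}"

lemma card_pluecker_index: "card (pluecker_index r n) = (n + 1) choose (r + 1)"
  using n_subsets[of "{..n}" "r + 1"] by (simp add: pluecker_index_def)

text \<open>
  \<^term>\<open>set_decode (k + 1)\<close> is the set of exponents in the binary expansion of \<open>k + 1\<close>;
  removing 0 discards the summand \<open>\<epsilon>\<close>.
\<close>

definition h_fun :: "nat \<Rightarrow> nat \<Rightarrow> nat" where
  "h_fun m k = (if k = 0 then 0 else (\<Sum>i \<in> set_decode (k + 1) - {0}. m ^ (i - 1)))"

lemma binary_expansion_exists: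
  "\<exists>L \<epsilon>. finite L \<and> (\<forall>i\<in>L. 1 \<le> i) \<and> \<epsilon> \<in> {0, 1} \<and> k + 1 = (\<Sum>i\<in>L. 2 ^ i) + (\<epsilon>::nat)"
proof -
  let ?D = "set_decode (k + 1)"
  have D: "finite ?D" "(\<Sum>i\<in>?D. 2 ^ i) = k + 1"
    using set_decode_inverse[of "k + 1"] by (simp_all add: set_encode_def)
  have "(\<Sum>i\<in>?D. (2::nat) ^ i) = (\<Sum>i\<in>?D - {0}. 2 ^ i) + (if 0 \<in> ?D then 1 else 0)"
    using sum.remove[OF D(1), of 0 "\<lambda>i. (2::nat) ^ i"] by (cases "0 \<in> ?D") (simp_all del: set_decode_0)
  then show ?thesis using D
    by (intro exI[of _ "?D - {0}"] exI[of _ "if 0 \<in> ?D then 1 else 0"]) auto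
qed

lemma h_fun_eq:
  assumes "1 \<le> k" "finite L" "\<forall>i\<in>L. 1 \<le> i" "\<epsilon> \<in> {0, 1}" "k + 1 = (\<Sum>i\<in>L. 2 ^ i) + (\<epsilon>::nat)"
  shows "h_fun m k = (\<Sum>i\<in>L. m ^ (i - 1))"
proof -
  let ?E = "L \<union> (if \<epsilon> = 1 then {0} else {})"
  have "0 \<notin> L" using assms(3) by auto
  then have "k + 1 = set_encode ?E" "finite ?E" "?E - {0} = L"
    using assms by (auto simp: set_encode_def)
  then have "set_decode (k + 1) - {0} = L" by (simp only: set_encode_inverse)
  then show ?thesis using assms(1) by (simp only: h_fun_def) simp
qed

end

theory Submission
  imports Defs
begin

text \<open>
  The dimension of the secant variety is bounded from below with Terracini's lemma: if \<open>s\<close>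
  points of the Grassmannian have linearly independent tangent spaces (of the affine cone), then
  the sum of \<open>s\<close> points of the cone depends on \<open>s * (d + 1)\<close> independent
  parameters, where \<open>d = (r + 1) * (n - r)\<close>, so the secant variety has dimension at least
  \<open>s * (d + 1) - 1\<close>; since the Grassmannian has dimension at most \<open>d\<close>, it is not
  \<open>s\<close>-defective. It remains to exhibit \<open>h + 1\<close> such points.

  The tangent space at the coordinate point of an \<open>(r + 1)\<close>-element set \<open>S\<close> is spanned by the
  coordinate vectors of all sets that arise from \<open>S\<close> by exchange of at most one element. Hence
  coordinate points have independent tangent spaces as soon as any two of the sets have at most
  \<open>r - 2\<close> common elements (\<open>not_defective_if_code\<close>), and this is a question about codes with
  minimal distance three. For \<open>r \<ge> 5\<close> the bound on \<open>h\<close> grows so slowly, like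
  \<open>\<alpha>\<close> to the power of the binary logarithm of \<open>r\<close>, that a Hamming code over an alphabet of \<open>\<alpha>\<close>
  letters is large enough (\<open>hamming_words\<close>). For \<open>r = 3\<close> and \<open>r = 4\<close> such a
  code is completed by one or two further sets. For \<open>r = 2\<close> the sets must be disjoint, so there
  are only \<open>\<alpha>\<close> of them, while \<open>\<alpha> + 1\<close> points are required for most \<open>n\<close>; the missing point is the
  subspace spanned by the sums of the coordinate vectors over the residue classes modulo 3
  (\<open>residue_tangent_trivial\<close>).

  The dimension is the supremum of the lengths of chains of irreducible closed sets, so both
  dimension bounds are about chains. They rest on one counting argument: more than \<open>k\<close> polynomials
  in \<open>k\<close> variables are algebraically dependent (\<open>poly_funs_dependent\<close>). For the upper bound,
  functions that cut out the successive steps of a chain are algebraically independent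
  (\<open>chain_functions_independent\<close>), so there are no more of them than parameters in a chart. For the
  lower bound, one lets the parameters vary one after another; by dependence some form
  vanishes on what the first \<open>k\<close> parameters sweep out, and by independence of the derivatives
  its term of lowest order shows that it does not vanish on what \<open>k + 1\<close> parameters sweep out
  (\<open>separating_form\<close>).
\<close>

section \<open>Polynomial functions and algebraic dependence by counting\<close>

lemma sum_apply: "(\<Sum>a\<in>A. F a) x = (\<Sum>a\<in>A. F a x)"
  for F :: "'a \<Rightarrow> 'b \<Rightarrow> complex"
  by (induction A rule: infinite_finite_induct) auto

inductive poly_fun :: "(('q \<Rightarrow> complex) \<Rightarrow> complex) \<Rightarrow> bool" where
  const: "poly_fun (\<lambda>y. c)"
| var: "poly_fun (\<lambda>y. y q)"
| add: "poly_fun f \<Longrightarrow> poly_fun g \<Longrightarrow> poly_fun (\<lambda>y. f y + g y)"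
| mult: "poly_fun f \<Longrightarrow> poly_fun g \<Longrightarrow> poly_fun (\<lambda>y. f y * g y)"

lemma poly_fun_sum: "(\<And>a. a \<in> A \<Longrightarrow> poly_fun (F a)) \<Longrightarrow> poly_fun (\<lambda>y. \<Sum>a\<in>A. F a y)"
  by (induction A rule: infinite_finite_induct) (auto intro: poly_fun.intros)

lemma poly_fun_prod: "(\<And>a. a \<in> A \<Longrightarrow> poly_fun (F a)) \<Longrightarrow> poly_fun (\<lambda>y. \<Prod>a\<in>A. F a y)"
  by (induction A rule: infinite_finite_induct) (auto intro: poly_fun.intros)

lemma poly_fun_if: "poly_fun f \<Longrightarrow> poly_fun g \<Longrightarrow> poly_fun (\<lambda>y. if P then f y else g y)"
  by (cases P) simp_all

lemma poly_fun_line: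
  assumes "poly_fun f"
  shows "\<exists>p. \<forall>t. f (\<lambda>q. a q + t * b q) = poly p t"
  using assms
proof induction
  case (const c)
  show ?case by (rule exI[of _ "[:c:]"]) simp
next
  case (var q)
  show ?case by (rule exI[of _ "[:a q, b q:]"]) simp
next
  case (add f g)
  then obtain p p' where "\<forall>t. f (\<lambda>q. a q + t * b q) = poly p t" "\<forall>t. g (\<lambda>q. a q + t * b q) = poly p' t"
    by blast
  then show ?case by (intro exI[of _ "p + p'"]) simp
next
  case (mult f g)
  then obtain p p' where "\<forall>t. f (\<lambda>q. a q + t * b q) = poly p t" "\<forall>t. g (\<lambda>q. a q + t * b q) = poly p' t"
    by blast
  then show ?case by (intro exI[of _ "p * p'"]) simp
qed

text \<open>
  A nonzero polynomial in one variable has finitely many zeros, so on the line through \<open>y1\<close> and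
  \<open>y2\<close> two polynomial functions, neither of which vanishes on that line, have a common point of
  non-vanishing. This is the only source of irreducibility in what follows.
\<close>

lemma poly_fun_common_nonzero:
  assumes f: "poly_fun f" "f y1 \<noteq> 0" and g: "poly_fun g" "g y2 \<noteq> 0"
  obtains t where "f (\<lambda>q. y1 q + t * (y2 q - y1 q)) \<noteq> 0" "g (\<lambda>q. y1 q + t * (y2 q - y1 q)) \<noteq> 0"
proof -
  obtain p where p: "\<And>t. f (\<lambda>q. y1 q + t * (y2 q - y1 q)) = poly p t"
    using poly_fun_line[OF f(1), of y1 "\<lambda>q. y2 q - y1 q"] by blast
  obtain p' where p': "\<And>t. g (\<lambda>q. y1 q + t * (y2 q - y1 q)) = poly p' t"
    using poly_fun_line[OF g(1), of y1 "\<lambda>q. y2 q - y1 q"] by blast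
  have "poly p 0 \<noteq> 0" "poly p' 1 \<noteq> 0" using p[of 0] p'[of 1] f(2) g(2) by auto
  then have "p * p' \<noteq> 0" by auto
  then have "finite {t. poly (p * p') t = 0}" by (rule poly_roots_finite)
  then obtain t where "poly (p * p') t \<noteq> 0"
    using infinite_UNIV_char_0[where 'a = complex] by (metis (mono_tags) UNIV_eq_I mem_Collect_eq)
  then show thesis using that[of t] p p' by auto
qed

definition restrict0 :: "'q set \<Rightarrow> ('q \<Rightarrow> complex) \<Rightarrow> 'q \<Rightarrow> complex" where
  "restrict0 J y = (\<lambda>q. if q \<in> J then y q else 0)"

definition monoms :: "'q set \<Rightarrow> nat \<Rightarrow> (('q \<Rightarrow> complex) \<Rightarrow> complex) set" where
  "monoms J D = (\<lambda>a y. \<Prod>q\<in>J. y q ^ a q) ` (J \<rightarrow>\<^sub>E {..D})"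

text \<open>
  Boxes of exponents are used instead of total degrees, because boxes are counted by a power.
\<close>

definition deg_le :: "'q set \<Rightarrow> nat \<Rightarrow> (('q \<Rightarrow> complex) \<Rightarrow> complex) \<Rightarrow> bool" where
  "deg_le J D f \<longleftrightarrow> (\<lambda>y. f (restrict0 J y)) \<in> cvec.span (monoms J D)"

lemma monoms_mono: "D \<le> E \<Longrightarrow> monoms J D \<subseteq> monoms J E"
  unfolding monoms_def by (intro image_mono PiE_mono) auto

lemma deg_le_mono: "deg_le J D f \<Longrightarrow> D \<le> E \<Longrightarrow> deg_le J E f"
  unfolding deg_le_def using cvec.span_mono[OF monoms_mono] by blast

lemma monoms_mult:
  assumes "f \<in> monoms J D" "g \<in> monoms J E"
  shows "(\<lambda>y. f y * g y) \<in> monoms J (D + E)"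
proof -
  obtain a b where ab: "a \<in> J \<rightarrow>\<^sub>E {..D}" "f = (\<lambda>y. \<Prod>q\<in>J. y q ^ a q)"
    "b \<in> J \<rightarrow>\<^sub>E {..E}" "g = (\<lambda>y. \<Prod>q\<in>J. y q ^ b q)"
    using assms by (auto simp: monoms_def)
  have "(\<lambda>y. f y * g y) = (\<lambda>y. \<Prod>q\<in>J. y q ^ (\<lambda>q\<in>J. a q + b q) q)"
    using ab by (auto simp: power_add prod.distrib[symmetric] intro!: prod.cong)
  moreover have "(\<lambda>q\<in>J. a q + b q) \<in> J \<rightarrow>\<^sub>E {..D + E}"
    using ab(1,3) by (auto simp: PiE_iff add_mono)
  ultimately show ?thesis unfolding monoms_def by (rule image_eqI)
qed

lemma span_monoms_mult:
  assumes "f \<in> cvec.span (monoms J D)" "g \<in> cvec.span (monoms J E)"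
  shows "(\<lambda>y. f y * g y) \<in> cvec.span (monoms J (D + E))"
  using assms(1)
proof (induction rule: cvec.span_induct_alt)
  case base
  show ?case using cvec.span_zero[of "monoms J (D + E)"] by (simp add: zero_fun_def)
next
  case (step c m f)
  have m: "(\<lambda>y. m y * g y) \<in> cvec.span (monoms J (D + E))"
    using assms(2)
  proof (induction rule: cvec.span_induct_alt)
    case base
    show ?case using cvec.span_zero[of "monoms J (D + E)"] by (simp add: zero_fun_def)
  next
    case (step c' m' g)
    have "(\<lambda>y. m y * (cscale c' m' + g) y) = cscale c' (\<lambda>y. m y * m' y) + (\<lambda>y. m y * g y)"
      by (auto simp: fun_eq_iff cscale_def algebra_simps)
    then show ?case
      using step monoms_mult[OF \<open>m \<in> _\<close> step(1)]
      by (auto intro!: cvec.span_add cvec.span_scale intro: cvec.span_base)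
  qed
  have "(\<lambda>y. (cscale c m + f) y * g y) = cscale c (\<lambda>y. m y * g y) + (\<lambda>y. f y * g y)"
    by (auto simp: fun_eq_iff cscale_def algebra_simps)
  then show ?case using m step by (auto intro!: cvec.span_add cvec.span_scale)
qed

lemma deg_le_mult: "deg_le J D f \<Longrightarrow> deg_le J E g \<Longrightarrow> deg_le J (D + E) (\<lambda>y. f y * g y)"
  unfolding deg_le_def by (rule span_monoms_mult)

lemma deg_le_add: "deg_le J D f \<Longrightarrow> deg_le J D g \<Longrightarrow> deg_le J D (\<lambda>y. f y + g y)"
  unfolding deg_le_def using cvec.span_add by (fastforce simp: plus_fun_def)

lemma deg_le_const:
  fixes J :: "'q set"
  assumes "finite J" shows "deg_le J 0 (\<lambda>y. c)"
proof -
  have "(\<lambda>y::'q \<Rightarrow> complex. 1) = (\<lambda>y. \<Prod>q\<in>J. y q ^ (\<lambda>q\<in>J. 0) q)" by (auto simp: fun_eq_iff)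
  then have "(\<lambda>y::'q \<Rightarrow> complex. 1) \<in> monoms J 0"
    unfolding monoms_def by (intro image_eqI[of _ _ "\<lambda>q\<in>J. 0"]) auto
  then have "cscale c (\<lambda>y. 1) \<in> cvec.span (monoms J 0)"
    by (intro cvec.span_scale cvec.span_base)
  then show ?thesis by (simp add: deg_le_def cscale_def)
qed

lemma deg_le_var:
  fixes J :: "'q set"
  assumes "finite J" shows "deg_le J 1 (\<lambda>y. y q)"
proof (cases "q \<in> J")
  case True
  let ?a = "\<lambda>q'\<in>J. if q' = q then 1 else 0::nat"
  have "(\<lambda>y::'q \<Rightarrow> complex. y q) = (\<lambda>y. \<Prod>q'\<in>J. y q' ^ ?a q')"
  proof
    fix y :: "'q \<Rightarrow> complex"
    have "(\<Prod>q'\<in>J. y q' ^ ?a q') = (\<Prod>q'\<in>J. if q' = q then y q' else 1)"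
      by (intro prod.cong) auto
    then show "y q = (\<Prod>q'\<in>J. y q' ^ ?a q')" using True assms by simp
  qed
  moreover have "?a \<in> J \<rightarrow>\<^sub>E {..1}" by auto
  ultimately have "(\<lambda>y::'q \<Rightarrow> complex. y q) \<in> monoms J 1" unfolding monoms_def by (rule image_eqI)
  then show ?thesis using True by (simp add: deg_le_def restrict0_def cvec.span_base)
next
  case False
  then show ?thesis using deg_le_mono[OF deg_le_const[OF assms, of 0], of 1]
    by (simp add: deg_le_def restrict0_def)
qed

lemma poly_fun_deg_le:
  assumes J: "finite J" and "poly_fun f"
  shows "\<exists>D. deg_le J D f"
  using assms(2)
proof induction
  case (const c)
  show ?case using deg_le_const[OF J] by blast
next
  case (var q)
  show ?case using deg_le_var[OF J] by blast
next
  case (add f g)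
  then obtain D E where "deg_le J D f" "deg_le J E g" by blast
  then have "deg_le J (max D E) f" "deg_le J (max D E) g" by (auto elim: deg_le_mono)
  then show ?case using deg_le_add by blast
next
  case (mult f g)
  then show ?case using deg_le_mult by blast
qed

lemma deg_le_power:
  assumes "finite J" "deg_le J D f" shows "deg_le J (n * D) (\<lambda>y. f y ^ n)"
proof (induction n)
  case 0
  show ?case using deg_le_const[OF assms(1), of 1] by simp
next
  case (Suc n)
  show ?case using deg_le_mult[OF assms(2) Suc] by simp
qed

lemma deg_le_prod:
  assumes "finite J" "finite B" "\<And>b. b \<in> B \<Longrightarrow> deg_le J (d b) (F b)"
  shows "deg_le J (\<Sum>b\<in>B. d b) (\<lambda>y. \<Prod>b\<in>B. F b y)"
  using assms(2,3)
proof (induction B rule: finite_induct)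
  case empty
  show ?case using deg_le_const[OF assms(1), of 1] by simp
next
  case (insert b B)
  then show ?case using deg_le_mult[of J "d b" "F b" "\<Sum>b\<in>B. d b"] by simp
qed

lemma family_dependent:
  fixes F :: "'a \<Rightarrow> 'b \<Rightarrow> complex"
  assumes A: "finite A" and G: "finite G" "F ` A \<subseteq> cvec.span G" "card G < card A"
  obtains c where "\<exists>a\<in>A. c a \<noteq> 0" "\<And>x. (\<Sum>a\<in>A. c a * F a x) = 0"
proof (cases "inj_on F A")
  case True
  have "cvec.dependent (F ` A)"
    using cvec.independent_span_bound[OF G(1) _ G(2)] G(3) card_image[OF True] by fastforce
  then obtain u where u: "(\<Sum>v\<in>F ` A. cscale (u v) v) = 0" "\<exists>v\<in>F ` A. u v \<noteq> 0"
    using A cvec.dependent_finite[of "F ` A"] by auto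
  have "(\<Sum>a\<in>A. cscale (u (F a)) (F a)) = 0"
    using u(1) by (simp add: sum.reindex[OF True])
  then have "(\<Sum>a\<in>A. u (F a) * F a x) = 0" for x
    using sum_apply[of "\<lambda>a. cscale (u (F a)) (F a)" A x] by (simp add: cscale_def)
  then show thesis using that[of "\<lambda>a. u (F a)"] u(2) by auto
next
  case False
  then obtain a b where ab: "a \<in> A" "b \<in> A" "a \<noteq> b" "F a = F b" by (auto simp: inj_on_def)
  let ?c = "\<lambda>x. if x = a then 1 else if x = b then - 1 else (0::complex)"
  have "(\<Sum>x\<in>A. ?c x * F x y) = 0" for y
  proof -
    have "(\<Sum>x\<in>A. ?c x * F x y) = (\<Sum>x\<in>A. (if x = a then F x y else 0) - (if x = b then F x y else 0))"
      using ab(3) by (intro sum.cong) auto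
    also have "\<dots> = F a y - F b y" using A ab by (simp add: sum_subtractf)
    finally show ?thesis using ab(4) by simp
  qed
  then show thesis using ab(1) by (intro that[of ?c] bexI[of _ a]) auto
qed

text \<open>Since \<open>C * E + 1 \<le> (C + 1) * (E + 1)\<close>, it suffices that \<open>E + 1\<close> exceeds \<open>(C + 1) ^ k\<close>.\<close>

lemma exists_box_exceeding: "\<exists>E\<ge>1. (C * E + 1) ^ k < (E + 1) ^ Suc k" for C k :: nat
proof -
  let ?E = "(C + 1) ^ k"
  have "(C * ?E + 1) ^ k \<le> ((C + 1) * (?E + 1)) ^ k"
    by (intro power_mono) (auto simp: algebra_simps)
  also have "\<dots> = ?E * (?E + 1) ^ k" by (simp only: power_mult_distrib)
  also have "\<dots> < (?E + 1) ^ Suc k" by simp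
  finally show ?thesis by (intro exI[of _ ?E]) simp
qed

text \<open>
  More than \<open>k\<close> polynomial functions of \<open>k\<close> variables are algebraically dependent: there are about
  \<open>E ^ card B\<close> monomials with exponents at most \<open>E\<close> in the functions \<open>g b\<close>, but they all lie in
  a space spanned by about \<open>(C * E) ^ k\<close> monomials in the variables. The additional function
  \<open>g0\<close> makes the relation homogeneous; with \<open>g0 = 1\<close> it disappears.
\<close>

lemma poly_funs_dependent:
  fixes g :: "'b \<Rightarrow> ('q \<Rightarrow> complex) \<Rightarrow> complex"
  assumes J: "finite J" and B: "finite B" "card B = Suc (card J)"
    and g0: "poly_fun g0" and g: "\<And>b. b \<in> B \<Longrightarrow> poly_fun (g b)"
  obtains E c where "E \<ge> 1" "\<exists>a\<in>B \<rightarrow>\<^sub>E {..E}. c a \<noteq> 0"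
    "\<And>y. y \<in> coord_space J \<Longrightarrow>
       (\<Sum>a\<in>B \<rightarrow>\<^sub>E {..E}. c a * (g0 y ^ (card B * E - (\<Sum>b\<in>B. a b)) * (\<Prod>b\<in>B. g b y ^ a b))) = 0"
proof -
  have "\<forall>b\<in>B. \<exists>D. deg_le J D (g b)" using g poly_fun_deg_le[OF J] by blast
  then obtain Dg where Dg: "\<And>b. b \<in> B \<Longrightarrow> deg_le J (Dg b) (g b)" by metis
  obtain D0 where D0: "deg_le J D0 g0" using poly_fun_deg_le[OF J g0] by blast
  define D where "D = D0 + (\<Sum>b\<in>B. Dg b)"
  have Dg': "deg_le J D (g b)" if "b \<in> B" for b
    using Dg[OF that] that B(1) by (auto simp: D_def intro!: deg_le_mono[OF Dg] trans_le_add2 member_le_sum)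
  have D0': "deg_le J D g0" using D0 by (rule deg_le_mono) (simp add: D_def)
  define C where "C = card B * D"
  obtain E where E: "E \<ge> 1" "(C * E + 1) ^ card J < (E + 1) ^ card B"
    using exists_box_exceeding unfolding B(2) by blast
  define A where "A = B \<rightarrow>\<^sub>E {..E}"
  define F where "F = (\<lambda>a y. g0 y ^ (card B * E - (\<Sum>b\<in>B. a b)) * (\<Prod>b\<in>B. g b y ^ a b))"
  have A: "finite A" "card A = (E + 1) ^ card B"
    unfolding A_def using B(1) by (auto simp: card_PiE intro: finite_PiE)
  have G: "finite (monoms J (C * E))" "card (monoms J (C * E)) < card A"
  proof -
    have fin: "finite (J \<rightarrow>\<^sub>E {..C * E})" using J by (intro finite_PiE) auto
    then show "finite (monoms J (C * E))" by (simp add: monoms_def)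
    have "card (monoms J (C * E)) \<le> card (J \<rightarrow>\<^sub>E {..C * E})"
      unfolding monoms_def using fin by (rule card_image_le)
    also have "\<dots> = (C * E + 1) ^ card J" using J by (simp add: card_PiE)
    finally show "card (monoms J (C * E)) < card A" using E(2) A(2) by simp
  qed
  have F: "deg_le J (C * E) (F a)" if "a \<in> A" for a
  proof -
    have "a b \<le> E" if "b \<in> B" for b using \<open>a \<in> A\<close> that by (auto simp: A_def PiE_iff)
    then have le: "(\<Sum>b\<in>B. a b) \<le> card B * E" using sum_bounded_above[of B a E] by simp
    have "deg_le J ((card B * E - (\<Sum>b\<in>B. a b)) * D + (\<Sum>b\<in>B. a b * D)) (F a)"
      unfolding F_def using J B(1) Dg' D0' by (intro deg_le_mult deg_le_prod deg_le_power) auto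
    moreover have "(card B * E - (\<Sum>b\<in>B. a b)) * D + (\<Sum>b\<in>B. a b * D) = C * E"
      using le by (simp add: C_def sum_distrib_right[symmetric] add_mult_distrib[symmetric])
    ultimately show ?thesis by simp
  qed
  obtain c where c: "\<exists>a\<in>A. c a \<noteq> 0" "\<And>y. (\<Sum>a\<in>A. c a * F a (restrict0 J y)) = 0"
    using family_dependent[OF A(1) G(1) _ G(2), of "\<lambda>a y. F a (restrict0 J y)"] F
    unfolding deg_le_def by blast
  have "(\<Sum>a\<in>A. c a * F a y) = 0" if "y \<in> coord_space J" for y
  proof -
    have "restrict0 J y = y" using that by (auto simp: restrict0_def coord_space_def)
    then show ?thesis using c(2)[of y] by simp
  qed
  then show thesis using that[OF E(1), of c] c(1) unfolding A_def F_def by blast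
qed

lemma sum_PiE_lessThan_Suc:
  fixes F :: "(nat \<Rightarrow> 'a) \<Rightarrow> complex"
  shows "(\<Sum>a\<in>{..<Suc k} \<rightarrow>\<^sub>E A. F a) = (\<Sum>i\<in>A. \<Sum>a\<in>{..<k} \<rightarrow>\<^sub>E A. F (a(k := i)))"
proof -
  have "inj_on (\<lambda>(i, a). a(k := i)) (A \<times> ({..<k} \<rightarrow>\<^sub>E A))"
    by (rule inj_combinator) simp
  then show ?thesis
    unfolding lessThan_Suc PiE_insert_eq by (subst sum.reindex) (simp_all add: sum.cartesian_product case_prod_beta comp_def)
qed

text \<open>
  Functions that cut out the steps of a chain of irreducible sets are algebraically independent.
  In a relation between \<open>f 0, \<dots>, f k\<close> one cancels, by primality on the largest set, the lowest
  power of \<open>f k\<close> that occurs; then one restricts to the next smaller set, where \<open>f k\<close> vanishes,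
  and is left with a nontrivial relation between \<open>f 0, \<dots>, f (k - 1)\<close>.
\<close>

lemma chain_functions_independent:
  fixes \<A> :: "('z \<Rightarrow> complex) set"
  assumes A: "\<And>c. (\<lambda>z. c) \<in> \<A>" "\<And>f g. f \<in> \<A> \<Longrightarrow> g \<in> \<A> \<Longrightarrow> (\<lambda>z. f z + g z) \<in> \<A>"
      "\<And>f g. f \<in> \<A> \<Longrightarrow> g \<in> \<A> \<Longrightarrow> (\<lambda>z. f z * g z) \<in> \<A>"
    and prime: "\<And>i f g. i \<le> k \<Longrightarrow> f \<in> \<A> \<Longrightarrow> g \<in> \<A> \<Longrightarrow> \<forall>z\<in>W i. f z * g z = 0 \<Longrightarrow>
      (\<forall>z\<in>W i. f z = 0) \<or> (\<forall>z\<in>W i. g z = 0)"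
    and W: "W 0 \<noteq> {}" "\<And>i. i < k \<Longrightarrow> W i \<subseteq> W (Suc i)"
    and f: "\<And>i. i < k \<Longrightarrow> f i \<in> \<A>" "\<And>i z. i < k \<Longrightarrow> z \<in> W i \<Longrightarrow> f i z = 0"
      "\<And>i. i < k \<Longrightarrow> \<exists>z\<in>W (Suc i). f i z \<noteq> 0"
    and rel: "\<And>z. z \<in> W k \<Longrightarrow> (\<Sum>a\<in>{..<k} \<rightarrow>\<^sub>E {..E}. c a * (\<Prod>i<k. f i z ^ a i)) = 0"
    and a: "a \<in> {..<k} \<rightarrow>\<^sub>E {..E}"
  shows "c a = 0"
  using prime W(2) f rel a
proof (induction k arbitrary: c a)
  case 0
  obtain z where z: "z \<in> W 0" using W(1) by blast
  have "a = (\<lambda>x. undefined)" using "0.prems"(7) by simp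
  then show ?case using "0.prems"(6)[OF z] by simp
next
  case (Suc k)
  have pw: "(\<lambda>z. f z ^ n) \<in> \<A>" if "f \<in> \<A>" for f and n :: nat
    by (induction n) (auto intro: A that)
  have sm: "(\<lambda>z. \<Sum>x\<in>X. F x z) \<in> \<A>" if "\<And>x. x \<in> X \<Longrightarrow> F x \<in> \<A>" for X and F :: "'c \<Rightarrow> 'z \<Rightarrow> complex"
    using that by (induction X rule: infinite_finite_induct) (auto intro: A)
  have pr: "(\<lambda>z. \<Prod>x\<in>X. F x z) \<in> \<A>" if "\<And>x. x \<in> X \<Longrightarrow> F x \<in> \<A>" for X and F :: "nat \<Rightarrow> 'z \<Rightarrow> complex"
    using that by (induction X rule: infinite_finite_induct) (auto intro: A)
  let ?Box = "{..<k} \<rightarrow>\<^sub>E {..E}"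
  define Q where "Q = (\<lambda>i z. \<Sum>a\<in>?Box. c (a(k := i)) * (\<Prod>j<k. f j z ^ a j))"
  have QA: "Q i \<in> \<A>" for i
    unfolding Q_def using Suc.prems(3) by (intro sm A pr pw) auto
  have split: "(\<Sum>a\<in>{..<Suc k} \<rightarrow>\<^sub>E {..E}. c a * (\<Prod>i<Suc k. f i z ^ a i)) = (\<Sum>i\<le>E. f k z ^ i * Q i z)" for z
  proof -
    have "(\<Sum>a\<in>{..<Suc k} \<rightarrow>\<^sub>E {..E}. c a * (\<Prod>i<Suc k. f i z ^ a i)) =
      (\<Sum>i\<le>E. \<Sum>a\<in>?Box. c (a(k := i)) * (\<Prod>j<Suc k. f j z ^ (a(k := i)) j))"
      by (rule sum_PiE_lessThan_Suc)
    also have "\<dots> = (\<Sum>i\<le>E. f k z ^ i * Q i z)"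
      unfolding Q_def sum_distrib_left
      by (intro sum.cong refl) (simp add: algebra_simps)
    finally show ?thesis .
  qed
  have zero: "\<forall>a\<in>?Box. c (a(k := i)) = 0" if "i \<le> E" for i
    using that
  proof (induction i rule: less_induct)
    case (less i)
    define R where "R = (\<lambda>z. \<Sum>j\<in>{i..E}. f k z ^ (j - i) * Q j z)"
    have RA: "R \<in> \<A>" unfolding R_def using Suc.prems(3) QA by (intro sm A pw) auto
    have "f k z ^ i * R z = 0" if z: "z \<in> W (Suc k)" for z
    proof -
      have "Q j z = 0" if j: "j < i" for j
      proof -
        have "j \<le> E" using j less.prems by simp
        from less.IH[OF j this] show ?thesis
          unfolding Q_def by (intro sum.neutral ballI) (metis mult_zero_left)
      qed
      then have "(\<Sum>j\<le>E. f k z ^ j * Q j z) = (\<Sum>j\<in>{i..E}. f k z ^ j * Q j z)"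
        by (intro sum.mono_neutral_right) (auto simp: not_le)
      also have "\<dots> = f k z ^ i * R z"
        unfolding R_def sum_distrib_left
        by (intro sum.cong) (auto simp: mult.assoc[symmetric] power_add[symmetric])
      finally show ?thesis using Suc.prems(6)[OF z] split by simp
    qed
    moreover have "\<exists>z\<in>W (Suc k). f k z ^ i \<noteq> 0" using Suc.prems(5)[of k] by auto
    ultimately have R0: "\<forall>z\<in>W (Suc k). R z = 0"
      using Suc.prems(1)[OF order_refl pw[OF Suc.prems(3)[of k]] RA, of i] by auto
    have Q0: "Q i z = 0" if z: "z \<in> W k" for z
    proof -
      have "R z = 0" using R0 z Suc.prems(2)[of k] by auto
      moreover have "R z = (\<Sum>j\<in>{i..E}. if j = i then Q i z else 0)"
        unfolding R_def using Suc.prems(4)[of k z] z by (intro sum.cong) (auto simp: power_0_left)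
      ultimately show ?thesis using less.prems by simp
    qed
    show ?case
    proof
      fix a assume "a \<in> ?Box"
      then show "c (a(k := i)) = 0"
        by (intro Suc.IH[of "\<lambda>a. c (a(k := i))"] Suc.prems(1,2,3,4,5) Q0[unfolded Q_def])
          simp_all
    qed
  qed
  have "a k \<le> E" using Suc.prems(7) by (auto simp: PiE_iff)
  moreover have "a(k := undefined) \<in> ?Box"
    using Suc.prems(7) by (auto simp: PiE_iff extensional_def)
  ultimately have "c ((a(k := undefined))(k := a k)) = 0" using zero by blast
  then show ?case by simp
qed

lemma coord_space_prime:
  assumes "poly_fun f" "poly_fun g" "\<forall>z\<in>coord_space J. f z * g z = 0"
  shows "(\<forall>z\<in>coord_space J. f z = 0) \<or> (\<forall>z\<in>coord_space J. g z = 0)"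
proof (rule ccontr)
  assume "\<not> ?thesis"
  then obtain y1 y2 where y: "y1 \<in> coord_space J" "f y1 \<noteq> 0" "y2 \<in> coord_space J" "g y2 \<noteq> 0" by blast
  then obtain t where t: "f (\<lambda>q. y1 q + t * (y2 q - y1 q)) \<noteq> 0" "g (\<lambda>q. y1 q + t * (y2 q - y1 q)) \<noteq> 0"
    using poly_fun_common_nonzero assms(1,2) by blast
  have "(\<lambda>q. y1 q + t * (y2 q - y1 q)) \<in> coord_space J" using y by (auto simp: coord_space_def)
  then show False using t assms(3) by fastforce
qed

text \<open>The chain of coordinate subspaces shows that monomials are linearly independent.\<close>

lemma monomials_independent:
  fixes k :: nat
  assumes rel: "\<And>z. z \<in> coord_space {..<k} \<Longrightarrow> (\<Sum>a\<in>{..<k} \<rightarrow>\<^sub>E {..E}. c a * (\<Prod>i<k. z i ^ a i)) = 0"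
    and a: "a \<in> {..<k} \<rightarrow>\<^sub>E {..E}"
  shows "c a = 0"
proof (rule chain_functions_independent[where \<A> = "Collect poly_fun" and k = k and E = E
      and c = c and a = a and W = "\<lambda>i. coord_space {..<i}" and f = "\<lambda>i z. z i"])
  fix i f g
  assume "f \<in> Collect poly_fun" "g \<in> Collect poly_fun" "\<forall>z\<in>coord_space {..<i::nat}. f z * g z = 0"
  then show "(\<forall>z\<in>coord_space {..<i}. f z = 0) \<or> (\<forall>z\<in>coord_space {..<i}. g z = 0)"
    using coord_space_prime by blast
next
  fix i :: nat
  show "\<exists>z\<in>coord_space {..<Suc i}. z i \<noteq> 0"
    by (rule bexI[of _ "\<lambda>j. if j = i then 1 else 0"]) (auto simp: coord_space_def)
next
  show "coord_space {..<0::nat} \<noteq> {}" by (auto simp: coord_space_def)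
qed (use rel a in \<open>auto simp: coord_space_def intro: poly_fun.intros\<close>)

section \<open>Projective points, homogeneous polynomials and closed sets\<close>

lemma subspace_coord_space: "cvec.subspace (coord_space I)"
  by (auto simp: cvec.subspace_def coord_space_def cscale_def)

lemma span_singleton_in_proj_space:
  assumes "v \<in> coord_space I" "v \<noteq> 0"
  shows "cvec.span {v} \<in> proj_space I"
proof -
  have "cvec.independent {v}" using assms(2) cvec.dependent_single by blast
  then have "cvec.dim (cvec.span {v}) = 1"
    using cvec.dim_eq_card_independent[of "{v}"] by (simp add: cvec.dim_span)
  moreover have "cvec.span {v} \<subseteq> coord_space I"
    using assms(1) subspace_coord_space by (intro cvec.span_minimal) auto
  ultimately show ?thesis
    by (simp add: proj_space_def linear_subspaces_def)
qed

lemma homogeneous_vanishes_on_span: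
  assumes "homogeneous_poly I d f"
  shows "(\<forall>v\<in>cvec.span {b}. f v = 0) \<longleftrightarrow> f b = 0"
proof
  assume "\<forall>v\<in>cvec.span {b}. f v = 0"
  then show "f b = 0" by (simp add: cvec.span_base)
next
  assume "f b = 0"
  then show "\<forall>v\<in>cvec.span {b}. f v = 0"
    by (auto simp: cvec.span_singleton homogeneous_poly_cscale[OF assms])
qed

lemma homogeneous_poly_sum:
  "(\<And>a. a \<in> A \<Longrightarrow> homogeneous_poly I d (F a)) \<Longrightarrow> homogeneous_poly I d (\<lambda>v. \<Sum>a\<in>A. F a v)"
  by (induction A rule: infinite_finite_induct) (auto intro: homogeneous_poly.intros)

lemma homogeneous_poly_scale:
  "homogeneous_poly I d f \<Longrightarrow> homogeneous_poly I d (\<lambda>v. c * f v)"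
  using homogeneous_poly.mult[OF homogeneous_poly.const[of I c], of d f] by simp

lemma homogeneous_poly_power:
  assumes "homogeneous_poly I d f" shows "homogeneous_poly I (n * d) (\<lambda>v. f v ^ n)"
proof (induction n)
  case 0
  show ?case using homogeneous_poly.const[of I 1] by simp
next
  case (Suc n)
  show ?case using homogeneous_poly.mult[OF assms Suc] by simp
qed

lemma homogeneous_poly_prod:
  "finite B \<Longrightarrow> (\<And>b. b \<in> B \<Longrightarrow> homogeneous_poly I (d b) (F b)) \<Longrightarrow>
    homogeneous_poly I (\<Sum>b\<in>B. d b) (\<lambda>v. \<Prod>b\<in>B. F b v)"
proof (induction B rule: finite_induct)
  case empty
  show ?case using homogeneous_poly.const[of I 1] by simp
next
  case (insert b B)
  then show ?case using homogeneous_poly.mult[of I "d b" "F b" "\<Sum>b\<in>B. d b"] by simp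
qed

lemma homogeneous_poly_linear_form: "homogeneous_poly I 1 (\<lambda>v. \<Sum>S\<in>I. l S * v S)"
  by (intro homogeneous_poly_sum homogeneous_poly_scale homogeneous_poly.coord)

lemma poly_fun_compose:
  assumes "homogeneous_poly I d f" "\<And>i. poly_fun (\<lambda>y. H y i)"
  shows "poly_fun (\<lambda>y. f (H y))"
  using assms(1) by induction (auto intro: poly_fun.intros assms(2))

lemma closedin_zero_locus: "homogeneous_poly I d f \<Longrightarrow> closedin (zariski I) (zero_locus I {f})"
  unfolding closedin_zariski by (intro exI[of _ "{f}"]) auto

lemma irreducible_inD:
  assumes "irreducible_in T Z" "closedin T A" "closedin T B" "\<And>q. q \<in> Z \<Longrightarrow> q \<in> A \<or> q \<in> B"
  shows "Z \<subseteq> A \<or> Z \<subseteq> B"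
proof -
  have "Z \<subseteq> A \<union> B" using assms(4) by blast
  then show ?thesis using assms(1-3) unfolding irreducible_in_def by blast
qed

section \<open>Upper bound for the dimension\<close>

text \<open>
  The points of \<open>X\<close> with nonzero coordinate \<open>i0\<close>, scaled such that this coordinate is 1, are
  values of a polynomial parametrization with variables in \<open>J\<close>.
\<close>

definition affine_chart ::
  "'i set \<Rightarrow> ('i \<Rightarrow> complex) set set \<Rightarrow> 'q set \<Rightarrow> 'i \<Rightarrow> (('q \<Rightarrow> complex) \<Rightarrow> 'i \<Rightarrow> complex) \<Rightarrow> bool" where
  "affine_chart I X J i0 \<psi> \<longleftrightarrow> i0 \<in> I \<and> (\<forall>i. poly_fun (\<lambda>z. \<psi> z i)) \<and> (\<forall>z. \<psi> z i0 = 1) \<and>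
    (\<forall>q\<in>X \<inter> proj_space I. (\<exists>v\<in>q. v i0 \<noteq> 0) \<longrightarrow> (\<exists>z\<in>coord_space J. q = cvec.span {\<psi> z}))"

text \<open>
  A chain of irreducible closed subsets stays strict after intersection with the affine chart
  \<open>v i0 \<noteq> 0\<close> that meets its smallest member. On that chart the points depend polynomially on
  \<open>d\<close> parameters, hence functions that cut out the steps of a chain longer than \<open>d\<close> would be
  algebraically dependent.
\<close>

lemma proj_dim_le_chart:
  fixes X :: "('i \<Rightarrow> complex) set set"
  assumes charts: "\<And>p. p \<in> X \<Longrightarrow> p \<in> proj_space I \<Longrightarrow>
      \<exists>(J :: 'q set) i0 \<psi>. finite J \<and> card J = d \<and> affine_chart I X J i0 \<psi> \<and> (\<exists>v\<in>p. v i0 \<noteq> 0)"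
  shows "proj_dim I X \<le> enat d"
  unfolding proj_dim_def krull_dim_def
proof (rule Sup_least, clarify)
  fix k and Z :: "nat \<Rightarrow> ('i \<Rightarrow> complex) set set"
  let ?T = "subtopology (zariski I) X"
  assume Z: "\<forall>i\<le>k. closedin ?T (Z i) \<and> irreducible_in ?T (Z i)" and strict: "\<forall>i<k. Z i \<subset> Z (Suc i)"
  have ZX: "Z i \<subseteq> X \<inter> proj_space I" if "i \<le> k" for i
    using Z that by (auto simp: irreducible_in_def topspace_subtopology topspace_zariski)
  have "Z 0 \<noteq> {}" using Z by (auto simp: irreducible_in_def)
  then obtain p where p: "p \<in> Z 0" by blast
  then have pX: "p \<in> X" "p \<in> proj_space I" using ZX[of 0] by auto
  obtain J :: "'q set" and i0 and \<psi> :: "('q \<Rightarrow> complex) \<Rightarrow> 'i \<Rightarrow> complex"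
    where J: "finite J" "card J = d" and ac: "affine_chart I X J i0 \<psi>" and p0: "\<exists>v\<in>p. v i0 \<noteq> 0"
    using charts[OF pX] by (elim exE conjE)
  have i0: "i0 \<in> I" and \<psi>: "\<And>i. poly_fun (\<lambda>z. \<psi> z i)" "\<And>z. \<psi> z i0 = 1"
    using ac by (simp_all add: affine_chart_def)
  have chart: "\<exists>z\<in>coord_space J. q = cvec.span {\<psi> z}" if "q \<in> X \<inter> proj_space I" "\<exists>v\<in>q. v i0 \<noteq> 0" for q
    using ac that unfolding affine_chart_def by (elim conjE) (drule bspec, assumption, drule mp)
  have x0: "homogeneous_poly I 1 (\<lambda>v. v i0)" using i0 by (rule homogeneous_poly.coord)
  have mono: "Z i \<subseteq> Z j" if "i \<le> j" "j \<le> k" for i j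
    using that
  proof (induction j rule: dec_induct)
    case (step n)
    then have "Z i \<subseteq> Z n" "Z n \<subset> Z (Suc n)" using strict by auto
    then show ?case by blast
  qed simp
  have pZ: "p \<in> Z i" if "i \<le> k" for i using p mono[of 0 i] that by auto
  define W where "W = (\<lambda>i. {z \<in> coord_space J. cvec.span {\<psi> z} \<in> Z i})"
  have inW: "(\<forall>v\<in>q. v i0 = 0) \<or> (\<exists>z\<in>W i. q = cvec.span {\<psi> z})" if "q \<in> Z i" "i \<le> k" for q i
  proof (cases "\<exists>v\<in>q. v i0 \<noteq> 0")
    case True
    have "q \<in> X \<inter> proj_space I" using ZX[OF that(2)] that(1) by (rule subsetD)
    from chart[OF this True] obtain z where "z \<in> coord_space J" "q = cvec.span {\<psi> z}" by (elim bexE)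
    then show ?thesis using that(1) unfolding W_def by auto
  qed auto
  define \<A> where "\<A> = {(\<lambda>z. F (\<psi> z)) | F d. homogeneous_poly I d F}"
  have AI: "(\<lambda>z. F (\<psi> z)) \<in> \<A>" if "homogeneous_poly I d F" for F d
    using that unfolding \<A>_def by blast
  have cl: "closedin ?T (zero_locus I {F} \<inter> X)" if "homogeneous_poly I d F" for F d
    using closedin_zero_locus[OF that] unfolding closedin_subtopology by blast
  have zl: "q \<in> zero_locus I {F} \<inter> X \<longleftrightarrow> (\<forall>v\<in>q. F v = 0)" if "q \<in> Z i" "i \<le> k" for q F i
    using ZX[OF that(2)] that(1) by (auto simp: zero_locus_def)
  have zW: "cvec.span {\<psi> z} \<in> zero_locus I {F} \<inter> X \<longleftrightarrow> F (\<psi> z) = 0"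
    if "z \<in> W i" "i \<le> k" "homogeneous_poly I d F" for z F i d
    using zl[of "cvec.span {\<psi> z}" i F] homogeneous_vanishes_on_span[OF that(3), of "\<psi> z"] that(1,2)
    by (simp add: W_def)
  have prime: "(\<forall>z\<in>W i. f z = 0) \<or> (\<forall>z\<in>W i. g z = 0)"
    if i: "i \<le> k" and fg: "f \<in> \<A>" "g \<in> \<A>" "\<forall>z\<in>W i. f z * g z = 0" for i f g
  proof -
    obtain F d where F: "homogeneous_poly I d F" "f = (\<lambda>z. F (\<psi> z))" using fg(1) by (auto simp: \<A>_def)
    obtain G e where G: "homogeneous_poly I e G" "g = (\<lambda>z. G (\<psi> z))" using fg(2) by (auto simp: \<A>_def)
    have F': "homogeneous_poly I (d + 1) (\<lambda>v. F v * v i0)" using F(1) x0 by (rule homogeneous_poly.mult)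
    have "q \<in> zero_locus I {\<lambda>v. F v * v i0} \<inter> X \<or> q \<in> zero_locus I {G} \<inter> X" if q: "q \<in> Z i" for q
      using inW[OF q i]
    proof
      assume "\<forall>v\<in>q. v i0 = 0"
      then show ?thesis unfolding zl[OF q i] by auto
    next
      assume "\<exists>z\<in>W i. q = cvec.span {\<psi> z}"
      then obtain z where z: "z \<in> W i" "q = cvec.span {\<psi> z}" by blast
      then have "F (\<psi> z) = 0 \<or> G (\<psi> z) = 0" using fg(3) F(2) G(2) by auto
      then show ?thesis
        unfolding z(2) zW[OF z(1) i F'] zW[OF z(1) i G(1)] by auto
    qed
    then have "Z i \<subseteq> zero_locus I {\<lambda>v. F v * v i0} \<inter> X \<or> Z i \<subseteq> zero_locus I {G} \<inter> X"
      using Z i cl[OF F'] cl[OF G(1)] irreducible_inD[of ?T "Z i"] by blast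
    moreover have "f z = 0" if "z \<in> W i" "Z i \<subseteq> zero_locus I {\<lambda>v. F v * v i0} \<inter> X" for z
    proof -
      have "cvec.span {\<psi> z} \<in> Z i" using that by (simp add: W_def)
      then have "F (\<psi> z) * \<psi> z i0 = 0"
        using that(2) zW[OF that(1) i F'] by blast
      then show ?thesis using F(2) \<psi>(2) by simp
    qed
    moreover have "g z = 0" if "z \<in> W i" "Z i \<subseteq> zero_locus I {G} \<inter> X" for z
    proof -
      have "cvec.span {\<psi> z} \<in> Z i" using that by (simp add: W_def)
      then show ?thesis
        using that(2) zW[OF that(1) i G(1)] G(2) by blast
    qed
    ultimately show ?thesis by blast
  qed
  have step: "\<exists>f\<in>\<A>. (\<forall>z\<in>W i. f z = 0) \<and> (\<exists>z\<in>W (Suc i). f z \<noteq> 0)" if i: "i < k" for i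
  proof -
    obtain C where C: "closedin (zariski I) C" "Z i = C \<inter> X"
      using Z[rule_format, of i] i unfolding closedin_subtopology by auto
    obtain Fs where Fs: "\<forall>f\<in>Fs. \<exists>d. homogeneous_poly I d f" "C = zero_locus I Fs"
      using C(1) unfolding closedin_zariski by blast
    obtain q where q: "q \<in> Z (Suc i)" "q \<notin> Z i" using strict i by blast
    have qX: "q \<in> X" "q \<in> proj_space I" using ZX[of "Suc i"] q(1) i by auto
    then have "q \<notin> C" using q C(2) by auto
    then obtain F where F: "F \<in> Fs" "\<not> (\<forall>v\<in>q. F v = 0)" using Fs(2) qX by (auto simp: zero_locus_def)
    obtain d where d: "homogeneous_poly I d F" using F Fs(1) by blast
    have "F (\<psi> z) = 0" if "z \<in> W i" for z
    proof -
      have "cvec.span {\<psi> z} \<in> C" using that C(2) by (auto simp: W_def)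
      then show ?thesis using Fs(2) F(1) by (auto simp: zero_locus_def cvec.span_base)
    qed
    moreover have "\<exists>z\<in>W (Suc i). F (\<psi> z) \<noteq> 0"
    proof (rule ccontr)
      assume neg: "\<not> ?thesis"
      have i': "Suc i \<le> k" using i by simp
      have "q' \<in> zero_locus I {\<lambda>v. v i0} \<inter> X \<or> q' \<in> zero_locus I {F} \<inter> X" if q': "q' \<in> Z (Suc i)" for q'
        using inW[OF q' i']
      proof
        assume "\<forall>v\<in>q'. v i0 = 0"
        then show ?thesis unfolding zl[OF q' i'] by simp
      next
        assume "\<exists>z\<in>W (Suc i). q' = cvec.span {\<psi> z}"
        then obtain z where z: "z \<in> W (Suc i)" "q' = cvec.span {\<psi> z}" by (elim bexE)
        then have "F (\<psi> z) = 0" using neg by blast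
        then show ?thesis unfolding z(2) zW[OF z(1) i' d] by simp
      qed
      with Z i' cl[OF x0] cl[OF d]
      have "Z (Suc i) \<subseteq> zero_locus I {\<lambda>v. v i0} \<inter> X \<or> Z (Suc i) \<subseteq> zero_locus I {F} \<inter> X"
        by (intro irreducible_inD[of ?T "Z (Suc i)"]) auto
      then show False
      proof
        assume "Z (Suc i) \<subseteq> zero_locus I {\<lambda>v. v i0} \<inter> X"
        then have "p \<in> zero_locus I {\<lambda>v. v i0} \<inter> X" using pZ[OF i'] by (rule subsetD)
        then show False using p0 unfolding zl[OF pZ[OF i'] i'] by simp
      next
        assume "Z (Suc i) \<subseteq> zero_locus I {F} \<inter> X"
        then have "q \<in> zero_locus I {F} \<inter> X" using q(1) by (rule subsetD)
        then show False using F(2) unfolding zl[OF q(1) i'] by simp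
      qed
    qed
    ultimately show ?thesis using AI[OF d] by (intro bexI[of _ "\<lambda>z. F (\<psi> z)"]) auto
  qed
  show "enat k \<le> enat d"
  proof (rule ccontr)
    assume "\<not> ?thesis"
    then have k: "Suc (card J) \<le> k" using J(2) by simp
    have "\<forall>i. \<exists>f. i < k \<longrightarrow> f \<in> \<A> \<and> (\<forall>z\<in>W i. f z = 0) \<and> (\<exists>z\<in>W (Suc i). f z \<noteq> 0)"
      using step by blast
    then obtain f where f: "\<And>i. i < k \<Longrightarrow> f i \<in> \<A> \<and> (\<forall>z\<in>W i. f i z = 0) \<and> (\<exists>z\<in>W (Suc i). f i z \<noteq> 0)"
      by metis
    have pf: "poly_fun (f i)" if "i \<in> {..<Suc (card J)}" for i
    proof -
      have "f i \<in> \<A>" using f[of i] that k by auto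
      then obtain F d where F: "homogeneous_poly I d F" "f i = (\<lambda>z. F (\<psi> z))" by (auto simp: \<A>_def)
      show ?thesis unfolding F(2) by (rule poly_fun_compose[OF F(1) \<psi>(1)])
    qed
    obtain E c where c: "\<exists>a\<in>{..<Suc (card J)} \<rightarrow>\<^sub>E {..E}. c a \<noteq> 0"
      "\<And>y. y \<in> coord_space J \<Longrightarrow> (\<Sum>a\<in>{..<Suc (card J)} \<rightarrow>\<^sub>E {..E}.
         c a * (1 ^ (card {..<Suc (card J)} * E - (\<Sum>b<Suc (card J). a b)) * (\<Prod>b<Suc (card J). f b y ^ a b))) = 0"
      by (rule poly_funs_dependent[OF J(1) finite_lessThan card_lessThan, of "\<lambda>y. 1" f, OF poly_fun.const pf])
        (assumption, rule that, assumption)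
    have "c a = 0" if "a \<in> {..<Suc (card J)} \<rightarrow>\<^sub>E {..E}" for a
    proof (rule chain_functions_independent[where \<A> = \<A> and k = "Suc (card J)" and E = E
          and c = c and a = a and W = W and f = f])
      show "(\<lambda>z. c) \<in> \<A>" for c using AI[OF homogeneous_poly.const] .
      show "(\<lambda>z. f z * g z) \<in> \<A>" if "f \<in> \<A>" "g \<in> \<A>" for f g
        using that homogeneous_poly.mult unfolding \<A>_def by fast
      show "(\<lambda>z. f z + g z) \<in> \<A>" if fg: "f \<in> \<A>" "g \<in> \<A>" for f g
      proof -
        obtain F d where F: "homogeneous_poly I d F" "f = (\<lambda>z. F (\<psi> z))" using fg(1) by (auto simp: \<A>_def)
        obtain G e where G: "homogeneous_poly I e G" "g = (\<lambda>z. G (\<psi> z))" using fg(2) by (auto simp: \<A>_def)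
        \<comment> \<open>the degrees are made equal with powers of the coordinate that is 1 on the chart\<close>
        have "homogeneous_poly I (d + e) (\<lambda>v. F v * v i0 ^ e + v i0 ^ d * G v)"
          using homogeneous_poly.mult[OF F(1) homogeneous_poly_power[OF x0, of e]]
            homogeneous_poly.mult[OF homogeneous_poly_power[OF x0, of d] G(1)]
          by (intro homogeneous_poly.add) simp_all
        from AI[OF this] show ?thesis using F(2) G(2) \<psi>(2) by simp
      qed
      show "W 0 \<noteq> {}" using inW[OF p] p0 by auto
      show "W i \<subseteq> W (Suc i)" if "i < Suc (card J)" for i
        using mono[of i "Suc i"] that k by (auto simp: W_def)
      show "(\<Sum>a\<in>{..<Suc (card J)} \<rightarrow>\<^sub>E {..E}. c a * (\<Prod>i<Suc (card J). f i z ^ a i)) = 0"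
        if "z \<in> W (Suc (card J))" for z
        using c(2)[of z] that by (simp add: W_def)
      show "(\<forall>z\<in>W i. f z = 0) \<or> (\<forall>z\<in>W i. g z = 0)"
        if "i \<le> Suc (card J)" "f \<in> \<A>" "g \<in> \<A>" "\<forall>z\<in>W i. f z * g z = 0" for i f g
        using prime that k by simp
      show "f i \<in> \<A>" "\<exists>z\<in>W (Suc i). f i z \<noteq> 0" if "i < Suc (card J)" for i
        using f[of i] that k by auto
      show "f i z = 0" if "i < Suc (card J)" "z \<in> W i" for i z
        using f[of i] that k by auto
    qed (use that in auto)
    then show False using c(1) by blast
  qed
qed

section \<open>Lower bound for the dimension\<close>

lemma closure_pts_subset:
  assumes "closedin T A" "P \<subseteq> topspace T" "\<And>q. q \<in> P \<Longrightarrow> q \<in> A"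
  shows "T closure_of P \<subseteq> A"
  using assms by (intro closure_of_minimal) auto

definition image_points :: "(('q \<Rightarrow> complex) \<Rightarrow> 'i \<Rightarrow> complex) \<Rightarrow> 'q set \<Rightarrow> ('i \<Rightarrow> complex) set set" where
  "image_points H J = {cvec.span {H y} | y. y \<in> coord_space J \<and> H y \<noteq> 0}"

text \<open>
  If two closed sets each miss a point of the image, then on the line through the two parameter
  values some point of the image is missed by both.
\<close>

lemma irreducible_closure_image_points:
  fixes H :: "('q \<Rightarrow> complex) \<Rightarrow> 'i \<Rightarrow> complex"
  assumes HI: "\<And>y. H y \<in> coord_space I" and Hp: "\<And>i. poly_fun (\<lambda>y. H y i)"
    and H0: "H (\<lambda>q. 0) \<noteq> 0"
  shows "irreducible_in (zariski I) (zariski I closure_of image_points H J)"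
proof -
  let ?P = "image_points H J" and ?T = "zariski I"
  have PT: "?P \<subseteq> topspace ?T"
    using span_singleton_in_proj_space HI by (fastforce simp: image_points_def topspace_zariski)
  have "(\<lambda>q. 0) \<in> coord_space J" by (simp add: coord_space_def)
  then have "?P \<noteq> {}" using H0 by (auto simp: image_points_def)
  then have ne: "?T closure_of ?P \<noteq> {}" using closure_of_subset[OF PT] by blast
  have "?T closure_of ?P \<subseteq> A \<or> ?T closure_of ?P \<subseteq> B"
    if AB: "closedin ?T A" "closedin ?T B" "?T closure_of ?P \<subseteq> A \<union> B" for A B
  proof (rule ccontr)
    assume neg: "\<not> ?thesis"
    have witness: "\<exists>f d y. homogeneous_poly I d f \<and> (\<forall>p\<in>C. \<forall>v\<in>p. f v = 0) \<and>
        y \<in> coord_space J \<and> H y \<noteq> 0 \<and> f (H y) \<noteq> 0"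
      if C: "closedin ?T C" "\<not> ?T closure_of ?P \<subseteq> C" for C
    proof -
      obtain q where q: "q \<in> ?P" "q \<notin> C" using closure_pts_subset[OF C(1) PT] C(2) by blast
      obtain y where y: "q = cvec.span {H y}" "y \<in> coord_space J" "H y \<noteq> 0"
        using q(1) by (auto simp: image_points_def)
      obtain F where F: "\<forall>f\<in>F. \<exists>d. homogeneous_poly I d f" "C = zero_locus I F"
        using C(1) unfolding closedin_zariski by blast
      have "q \<in> proj_space I" using q(1) PT by (auto simp: topspace_zariski)
      then obtain f where f: "f \<in> F" "\<not> (\<forall>v\<in>q. f v = 0)" using q(2) F(2) by (auto simp: zero_locus_def)
      obtain d where d: "homogeneous_poly I d f" using f F(1) by blast
      have "f (H y) \<noteq> 0" using f(2) homogeneous_vanishes_on_span[OF d] y(1) by blast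
      moreover have "\<forall>p\<in>C. \<forall>v\<in>p. f v = 0" using F(2) f(1) by (auto simp: zero_locus_def)
      ultimately show ?thesis using d y(2,3) by blast
    qed
    obtain f d y1 where f: "homogeneous_poly I d f" "\<forall>p\<in>A. \<forall>v\<in>p. f v = 0"
      and y1: "y1 \<in> coord_space J" "H y1 \<noteq> 0" "f (H y1) \<noteq> 0"
      using witness[OF AB(1)] neg by blast
    obtain g e y2 where g: "homogeneous_poly I e g" "\<forall>p\<in>B. \<forall>v\<in>p. g v = 0"
      and y2: "y2 \<in> coord_space J" "H y2 \<noteq> 0" "g (H y2) \<noteq> 0"
      using witness[OF AB(2)] neg by blast
    obtain S where S: "H y1 S \<noteq> 0" using y1(2) by (auto simp: fun_eq_iff)
    have pf: "poly_fun (\<lambda>y. f (H y) * H y S)" "poly_fun (\<lambda>y. g (H y))"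
      using poly_fun_compose[OF f(1) Hp] poly_fun_compose[OF g(1) Hp] Hp by (auto intro: poly_fun.mult)
    obtain t where t: "f (H (\<lambda>q. y1 q + t * (y2 q - y1 q))) * H (\<lambda>q. y1 q + t * (y2 q - y1 q)) S \<noteq> 0"
        "g (H (\<lambda>q. y1 q + t * (y2 q - y1 q))) \<noteq> 0"
    proof (rule poly_fun_common_nonzero[of "\<lambda>y. f (H y) * H y S" y1 "\<lambda>y. g (H y)" y2])
      show "f (H y1) * H y1 S \<noteq> 0" using y1(3) S by simp
    qed (rule pf y2(3) that; assumption?)+
    define y where "y = (\<lambda>q. y1 q + t * (y2 q - y1 q))"
    have "y \<in> coord_space J" using y1(1) y2(1) by (auto simp: coord_space_def y_def)
    moreover have "H y \<noteq> 0" using t(1) by (auto simp: y_def)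
    ultimately have "cvec.span {H y} \<in> ?P" by (auto simp: image_points_def)
    then have "cvec.span {H y} \<in> A \<union> B" using AB(3) closure_of_subset[OF PT] by blast
    moreover have "H y \<in> cvec.span {H y}" by (simp add: cvec.span_base)
    ultimately show False using f(2) g(2) t unfolding y_def[symmetric] by auto
  qed
  then show ?thesis
    unfolding irreducible_in_def using ne closure_of_subset_topspace[of ?T ?P] by blast
qed

text \<open>
  On the image of \<open>k\<close> parameters any \<open>k + 2\<close> linear forms satisfy a homogeneous relation. If they
  are dual to the value and to the first \<open>k + 1\<close> partial derivatives of the parametrization at the
  origin, then the form \<open>F\<close> given by this relation does not vanish on the image of one parameter
  more: the term of lowest order in \<open>t\<close> of \<open>F (H (t z))\<close> is a nonzero polynomial in \<open>z\<close>.
\<close>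

lemma separating_form:
  fixes H :: "('q \<Rightarrow> complex) \<Rightarrow> 'i \<Rightarrow> complex" and e :: "nat \<Rightarrow> 'q"
  assumes e: "inj_on e {..k}"
    and Hp: "\<And>i. poly_fun (\<lambda>y. H y i)"
    and exp: "\<And>z i. z \<in> coord_space (e ` {..k}) \<Longrightarrow> \<exists>p. (\<forall>t. H (\<lambda>q. t * z q) i = poly p t) \<and>
        coeff p 0 = H (\<lambda>q. 0) i \<and> coeff p 1 = (\<Sum>q\<in>e ` {..k}. z q * D q i)"
    and l0: "(\<Sum>i\<in>I. l0 i * H (\<lambda>q. 0) i) = 1"
    and l: "\<And>b. b \<le> k \<Longrightarrow> (\<Sum>i\<in>I. l b i * H (\<lambda>q. 0) i) = 0"
      "\<And>b b'. b \<le> k \<Longrightarrow> b' \<le> k \<Longrightarrow> (\<Sum>i\<in>I. l b i * D (e b') i) = (if b = b' then 1 else 0)"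
  obtains F d y where "homogeneous_poly I d F" "\<And>y. y \<in> coord_space (e ` {..<k}) \<Longrightarrow> F (H y) = 0"
    "y \<in> coord_space (e ` {..k})" "F (H y) \<noteq> 0" "H y \<noteq> 0"
proof -
  let ?B = "{..<Suc k}"
  define L where "L = (\<lambda>l v. \<Sum>i\<in>I. l i * v i :: complex)"
  have LH: "poly_fun (\<lambda>y. L l (H y))" for l
    unfolding L_def by (intro poly_fun_sum poly_fun.mult poly_fun.const Hp)
  have J: "finite (e ` {..<k})" "card ?B = Suc (card (e ` {..<k}))"
    using e by (auto simp: card_image inj_on_def)
  obtain E c where E: "E \<ge> 1" and c: "\<exists>a\<in>?B \<rightarrow>\<^sub>E {..E}. c a \<noteq> 0"
    "\<And>y. y \<in> coord_space (e ` {..<k}) \<Longrightarrow> (\<Sum>a\<in>?B \<rightarrow>\<^sub>E {..E}. c a *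
        (L l0 (H y) ^ (card ?B * E - (\<Sum>b\<in>?B. a b)) * (\<Prod>b\<in>?B. L (l b) (H y) ^ a b))) = 0"
    by (rule poly_funs_dependent[OF J(1) finite_lessThan J(2),
          of "\<lambda>y. L l0 (H y)" "\<lambda>b y. L (l b) (H y)", OF LH LH]) (rule that)
  define N where "N = card ?B * E"
  define F where "F = (\<lambda>v. \<Sum>a\<in>?B \<rightarrow>\<^sub>E {..E}. c a *
        (L l0 v ^ (N - (\<Sum>b\<in>?B. a b)) * (\<Prod>b\<in>?B. L (l b) v ^ a b)))"
  have N: "(\<Sum>b\<in>?B. a b) \<le> N" if "a \<in> ?B \<rightarrow>\<^sub>E {..E}" for a
    using sum_bounded_above[of ?B a E] that by (auto simp: N_def PiE_iff)
  have F: "homogeneous_poly I N F"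
    unfolding F_def
  proof (intro homogeneous_poly_sum homogeneous_poly_scale)
    fix a assume a: "a \<in> ?B \<rightarrow>\<^sub>E {..E}"
    have L: "homogeneous_poly I 1 (L l)" for l unfolding L_def by (rule homogeneous_poly_linear_form)
    have "homogeneous_poly I ((N - (\<Sum>b\<in>?B. a b)) * 1 + (\<Sum>b\<in>?B. a b * 1))
        (\<lambda>v. L l0 v ^ (N - (\<Sum>b\<in>?B. a b)) * (\<Prod>b\<in>?B. L (l b) v ^ a b))"
      by (intro homogeneous_poly.mult homogeneous_poly_power[OF L] homogeneous_poly_prod) auto
    then show "homogeneous_poly I N (\<lambda>v. L l0 v ^ (N - (\<Sum>b\<in>?B. a b)) * (\<Prod>b\<in>?B. L (l b) v ^ a b))"
      using N[OF a] by simp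
  qed
  have "\<exists>y\<in>coord_space (e ` {..k}). F (H y) \<noteq> 0"
  proof (rule ccontr)
    assume "\<not> ?thesis"
    then have vanish: "F (H y) = 0" if "y \<in> coord_space (e ` {..k})" for y using that by blast
    \<comment> \<open>the order in \<open>t\<close> of the term of lowest order\<close>
    define s where "s = (LEAST s. \<exists>a\<in>?B \<rightarrow>\<^sub>E {..E}. c a \<noteq> 0 \<and> (\<Sum>b\<in>?B. a b) = s)"
    have "\<exists>s. \<exists>a\<in>?B \<rightarrow>\<^sub>E {..E}. c a \<noteq> 0 \<and> (\<Sum>b\<in>?B. a b) = s" using c(1) by blast
    then have s: "\<exists>a\<in>?B \<rightarrow>\<^sub>E {..E}. c a \<noteq> 0 \<and> (\<Sum>b\<in>?B. a b) = s"
      unfolding s_def by (rule LeastI_ex)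
    have s_le: "s \<le> (\<Sum>b\<in>?B. a b)" if "a \<in> ?B \<rightarrow>\<^sub>E {..E}" "c a \<noteq> 0" for a
      unfolding s_def using that by (intro Least_le) blast
    define c' where "c' = (\<lambda>a. if (\<Sum>b\<in>?B. a b) = s then c a else 0)"
    have rel: "(\<Sum>a\<in>?B \<rightarrow>\<^sub>E {..E}. c' a * (\<Prod>b\<in>?B. w b ^ a b)) = 0" for w :: "nat \<Rightarrow> complex"
    proof -
      define z where "z = (\<lambda>q. if q \<in> e ` {..k} then w (inv_into {..k} e q) else 0)"
      have z: "z \<in> coord_space (e ` {..k})" by (auto simp: z_def coord_space_def)
      have ze: "z (e b) = w b" if "b \<le> k" for b using that e by (simp add: z_def)
      obtain p where p: "\<And>i t. H (\<lambda>q. t * z q) i = poly (p i) t" "\<And>i. coeff (p i) 0 = H (\<lambda>q. 0) i"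
          "\<And>i. coeff (p i) 1 = (\<Sum>q\<in>e ` {..k}. z q * D q i)"
        using exp[OF z] by metis
      define P where "P = (\<lambda>l. \<Sum>i\<in>I. smult (l i) (p i))"
      have P: "L l (H (\<lambda>q. t * z q)) = poly (P l) t" for l t
        by (simp add: L_def P_def poly_sum p(1))
      have P0: "coeff (P l) 0 = L l (H (\<lambda>q. 0))" for l
        by (simp add: L_def P_def coeff_sum p(2))
      have P1: "coeff (P (l b)) 1 = w b" if "b \<le> k" for b
      proof -
        have "coeff (P (l b)) 1 = (\<Sum>i\<in>I. \<Sum>q\<in>e ` {..k}. z q * (l b i * D q i))"
          unfolding P_def by (simp add: coeff_sum p(3)[unfolded One_nat_def] sum_distrib_left algebra_simps)
        also have "\<dots> = (\<Sum>q\<in>e ` {..k}. z q * (\<Sum>i\<in>I. l b i * D q i))"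
          by (subst sum.swap) (simp add: sum_distrib_left)
        also have "\<dots> = (\<Sum>b'\<le>k. z (e b') * (\<Sum>i\<in>I. l b i * D (e b') i))"
          using e by (simp add: sum.reindex)
        also have "\<dots> = (\<Sum>b'\<le>k. if b' = b then z (e b') else 0)"
          using l(2)[OF that] by (intro sum.cong) auto
        also have "\<dots> = w b" using that ze by simp
        finally show ?thesis .
      qed
      have "\<exists>Q. P (l b) = monom 1 1 * Q \<and> coeff Q 0 = w b" if "b \<le> k" for b
      proof -
        obtain x Q where xQ: "P (l b) = pCons x Q" by (cases "P (l b)")
        moreover have "x = 0" using P0[of "l b"] l(1)[OF that] xQ by (simp add: L_def)
        ultimately show ?thesis
          using P1[OF that] by (intro exI[of _ Q]) (auto simp: monom_Suc monom_0 coeff_pCons)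
      qed
      then obtain Q where Q: "\<And>b. b \<le> k \<Longrightarrow> P (l b) = monom 1 1 * Q b" "\<And>b. b \<le> k \<Longrightarrow> coeff (Q b) 0 = w b"
        by metis
      define R where "R = (\<lambda>a. smult (c a) (P l0 ^ (N - (\<Sum>b\<in>?B. a b)) * (\<Prod>b\<in>?B. Q b ^ a b)))"
      define G where "G = (\<Sum>a\<in>?B \<rightarrow>\<^sub>E {..E}. monom 1 (\<Sum>b\<in>?B. a b) * R a)"
      have "poly G t = 0" for t
      proof -
        have "poly (P (l b)) t = t * poly (Q b) t" if "b \<le> k" for b
          using Q(1)[OF that] by (simp add: poly_monom)
        then have Qb: "(\<Prod>b\<in>?B. poly (P (l b)) t ^ a b) = t ^ (\<Sum>b\<in>?B. a b) * (\<Prod>b\<in>?B. poly (Q b) t ^ a b)" for a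
          by (simp add: power_mult_distrib prod.distrib power_sum del: sum.lessThan_Suc prod.lessThan_Suc)
        have "(\<lambda>q. t * z q) \<in> coord_space (e ` {..k})" using z by (auto simp: coord_space_def)
        then have "0 = F (H (\<lambda>q. t * z q))" using vanish by simp
        also have "\<dots> = (\<Sum>a\<in>?B \<rightarrow>\<^sub>E {..E}. c a * (poly (P l0) t ^ (N - (\<Sum>b\<in>?B. a b)) *
            (\<Prod>b\<in>?B. poly (P (l b)) t ^ a b)))"
          unfolding F_def P ..
        also have "\<dots> = poly G t"
          unfolding G_def R_def Qb by (simp add: poly_sum poly_monom poly_prod algebra_simps)
        finally show ?thesis by simp
      qed
      then have "G = 0" using poly_all_0_iff_0 by blast
      then have "0 = coeff G s" by simp
      also have "\<dots> = (\<Sum>a\<in>?B \<rightarrow>\<^sub>E {..E}. if s < (\<Sum>b\<in>?B. a b) then 0 else coeff (R a) (s - (\<Sum>b\<in>?B. a b)))"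
        unfolding G_def coeff_sum coeff_monom_mult by (intro sum.cong) auto
      also have "\<dots> = (\<Sum>a\<in>?B \<rightarrow>\<^sub>E {..E}. c' a * (\<Prod>b\<in>?B. w b ^ a b))"
      proof (rule sum.cong[OF refl])
        fix a assume a: "a \<in> ?B \<rightarrow>\<^sub>E {..E}"
        have "coeff (P l0) 0 = 1" using P0[of l0] l0 by (simp add: L_def)
        then have R0: "coeff (R a) 0 = c a * (\<Prod>b\<in>?B. w b ^ a b)"
          using Q(2) by (simp add: R_def coeff_mult_0 coeff_0_power coeff_0_prod_list poly_0_coeff_0[symmetric] poly_prod)
        show "(if s < (\<Sum>b\<in>?B. a b) then 0 else coeff (R a) (s - (\<Sum>b\<in>?B. a b))) = c' a * (\<Prod>b\<in>?B. w b ^ a b)"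
        proof (cases "c a = 0")
          case True
          then show ?thesis by (simp add: c'_def R_def)
        next
          case False
          then show ?thesis using s_le[OF a] R0 by (auto simp: c'_def)
        qed
      qed
      finally show ?thesis by simp
    qed
    obtain a where a: "a \<in> ?B \<rightarrow>\<^sub>E {..E}" "c a \<noteq> 0" "(\<Sum>b\<in>?B. a b) = s" using s by blast
    have "c' a = 0" by (rule monomials_independent[OF rel a(1)])
    then show False using a(2,3) by (simp add: c'_def)
  qed
  then obtain y where y: "y \<in> coord_space (e ` {..k})" "F (H y) \<noteq> 0" by blast
  have "N > 0" using E by (simp add: N_def)
  then have "F 0 = 0"
    using homogeneous_poly_cscale[OF F, of 0 0] by (simp add: cscale_def zero_fun_def power_0_left)
  then have Hy: "H y \<noteq> 0" using y(2) by metis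
  have "F (H y) = 0" if "y \<in> coord_space (e ` {..<k})" for y
    using c(2)[OF that] unfolding F_def N_def .
  then show thesis by (rule that[OF F _ y Hy])
qed

text \<open>
  If the value and the partial derivatives of a polynomial parametrization are linearly
  independent at one point, then the closures of the images of the coordinate subspaces through
  that point form a strict chain.
\<close>

lemma proj_dim_ge_parameters:
  fixes H :: "('q \<Rightarrow> complex) \<Rightarrow> 'i \<Rightarrow> complex"
  assumes Q: "finite Q" and Y: "closedin (zariski I) Y"
    and HI: "\<And>y. H y \<in> coord_space I" and Hp: "\<And>i. poly_fun (\<lambda>y. H y i)"
    and inY: "\<And>y. y \<in> coord_space Q \<Longrightarrow> H y \<noteq> 0 \<Longrightarrow> cvec.span {H y} \<in> Y"
    and exp: "\<And>z i. z \<in> coord_space Q \<Longrightarrow> \<exists>p. (\<forall>t. H (\<lambda>q. t * z q) i = poly p t) \<and>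
        coeff p 0 = H (\<lambda>q. 0) i \<and> coeff p 1 = (\<Sum>q\<in>Q. z q * D q i)"
    and l0: "(\<Sum>i\<in>I. l0 i * H (\<lambda>q. 0) i) = 1"
    and l: "\<And>q. q \<in> Q \<Longrightarrow> (\<Sum>i\<in>I. l q i * H (\<lambda>q. 0) i) = 0"
      "\<And>q q'. q \<in> Q \<Longrightarrow> q' \<in> Q \<Longrightarrow> (\<Sum>i\<in>I. l q i * D q' i) = (if q = q' then 1 else 0)"
  shows "enat (card Q) \<le> proj_dim I Y"
proof -
  let ?T = "zariski I"
  obtain e where e: "bij_betw e {..<card Q} Q"
    using ex_bij_betw_nat_finite[OF Q] by (auto simp: atLeast0LessThan)
  define Z where "Z = (\<lambda>k. ?T closure_of image_points H (e ` {..<k}))"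
  have eQ: "e ` {..<k} \<subseteq> Q" if "k \<le> card Q" for k using e that by (auto simp: bij_betw_def)
  have PT: "image_points H J \<subseteq> topspace ?T" for J
    using span_singleton_in_proj_space HI by (fastforce simp: image_points_def topspace_zariski)
  have H0: "H (\<lambda>q. 0) \<noteq> 0" using l0 by auto
  have coord_mono: "coord_space A \<subseteq> coord_space B" if "A \<subseteq> B" for A B :: "'q set"
    using that by (auto simp: coord_space_def)
  have ZY: "Z k \<subseteq> Y" if "k \<le> card Q" for k
    unfolding Z_def
  proof (rule closure_pts_subset[OF Y PT])
    fix q assume "q \<in> image_points H (e ` {..<k})"
    then show "q \<in> Y" using inY coord_mono[OF eQ[OF that]] by (auto simp: image_points_def)
  qed
  have closed: "closedin (subtopology ?T Y) (Z k)" if "k \<le> card Q" for k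
    using closedin_closed_subtopology[OF Y] ZY[OF that] by (simp add: Z_def)
  have irr: "irreducible_in (subtopology ?T Y) (Z k)" if "k \<le> card Q" for k
  proof -
    have *: "irreducible_in ?T (Z k)" unfolding Z_def by (rule irreducible_closure_image_points[OF HI Hp H0])
    have "closedin ?T A" if "closedin (subtopology ?T Y) A" for A
      using that closedin_closed_subtopology[OF Y] by blast
    then show ?thesis
      using * ZY[OF that] unfolding irreducible_in_def by (auto simp: topspace_subtopology)
  qed
  have strict: "Z k \<subset> Z (Suc k)" if k: "k < card Q" for k
  proof -
    have sub: "e ` {..k} \<subseteq> Q" using eQ[of "Suc k"] k by (simp add: lessThan_Suc_atMost)
    have eq: "e b \<in> Q" if "b \<le> k" for b using sub that by auto
    have inj: "inj_on e {..k}" using e k by (auto simp: bij_betw_def inj_on_def)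
    obtain F d y where F: "homogeneous_poly I d F" "\<And>y. y \<in> coord_space (e ` {..<k}) \<Longrightarrow> F (H y) = 0"
      and y: "y \<in> coord_space (e ` {..k})" "F (H y) \<noteq> 0" "H y \<noteq> 0"
    proof (rule separating_form[OF inj Hp _ l0, where l = "\<lambda>b. l (e b)" and D = D])
      fix z :: "'q \<Rightarrow> complex" and i assume z: "z \<in> coord_space (e ` {..k})"
      have "(\<Sum>q\<in>e ` {..k}. z q * D q i) = (\<Sum>q\<in>Q. z q * D q i)"
        using sub z by (intro sum.mono_neutral_left[OF Q]) (auto simp: coord_space_def)
      then show "\<exists>p. (\<forall>t. H (\<lambda>q. t * z q) i = poly p t) \<and> coeff p 0 = H (\<lambda>q. 0) i \<and>
          coeff p 1 = (\<Sum>q\<in>e ` {..k}. z q * D q i)"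
        using exp[of z i] z coord_mono[OF sub] by auto
    next
      fix b assume "b \<le> k"
      then show "(\<Sum>i\<in>I. l (e b) i * H (\<lambda>q. 0) i) = 0" using l(1) eq by blast
    next
      fix b b' assume "b \<le> k" "b' \<le> k"
      then show "(\<Sum>i\<in>I. l (e b) i * D (e b') i) = (if b = b' then 1 else 0)"
        using l(2)[OF eq eq] inj by (auto simp: inj_on_def)
    qed (rule that)
    have "Z k \<subseteq> zero_locus I {F}"
      unfolding Z_def
    proof (rule closure_pts_subset[OF closedin_zero_locus[OF F(1)] PT])
      fix q assume q: "q \<in> image_points H (e ` {..<k})"
      then obtain y where "q = cvec.span {H y}" "y \<in> coord_space (e ` {..<k})" by (auto simp: image_points_def)
      then show "q \<in> zero_locus I {F}"
        using F(2) homogeneous_vanishes_on_span[OF F(1)] subsetD[OF PT q]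
        by (auto simp: zero_locus_def topspace_zariski)
    qed
    moreover have "cvec.span {H y} \<in> Z (Suc k)"
    proof -
      have "cvec.span {H y} \<in> image_points H (e ` {..<Suc k})"
        using y(1,3) unfolding image_points_def lessThan_Suc_atMost by blast
      then show ?thesis unfolding Z_def using closure_of_subset[OF PT] by (rule subsetD[rotated])
    qed
    moreover have "cvec.span {H y} \<notin> zero_locus I {F}"
      using y(2) homogeneous_vanishes_on_span[OF F(1)] by (auto simp: zero_locus_def)
    moreover have "Z k \<subseteq> Z (Suc k)"
    proof -
      have "coord_space (e ` {..<k}) \<subseteq> coord_space (e ` {..<Suc k})" by (rule coord_mono) auto
      then have "image_points H (e ` {..<k}) \<subseteq> image_points H (e ` {..<Suc k})"
        unfolding image_points_def by blast
      then show ?thesis unfolding Z_def by (rule closure_of_mono)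
    qed
    ultimately show ?thesis by blast
  qed
  have "enat (card Q) \<in> {enat k | k. \<exists>Z :: nat \<Rightarrow> ('i \<Rightarrow> complex) set set.
     (\<forall>i\<le>k. closedin (subtopology ?T Y) (Z i) \<and> irreducible_in (subtopology ?T Y) (Z i)) \<and> (\<forall>i<k. Z i \<subset> Z (Suc i))}"
    by (intro CollectI exI[of _ "card Q"] conjI refl exI[of _ Z] allI impI closed irr strict)
  then show ?thesis unfolding proj_dim_def krull_dim_def by (rule Sup_upper)
qed

section \<open>Pluecker coordinates\<close>

lemma pluecker_coords_sum:
  assumes "S \<in> pluecker_index r n"
  shows "pluecker_coords r n u S =
    (\<Sum>\<pi> | \<pi> permutes {0..<r + 1}. of_int (sign \<pi>) * (\<Prod>i = 0..<r + 1. u i (sorted_list_of_set S ! \<pi> i)))"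
proof -
  have "\<pi> i < r + 1" if "\<pi> permutes {0..<r + 1}" "i < r + 1" for \<pi> i
    using permutes_in_image[OF that(1), of i] that(2) by simp
  then show ?thesis
    using assms unfolding pluecker_coords_def
    by (subst det_def'[of _ "r + 1"]) (auto intro!: sum.cong prod.cong)
qed

lemma pluecker_coords_outside: "S \<notin> pluecker_index r n \<Longrightarrow> pluecker_coords r n u S = 0"
  by (simp add: pluecker_coords_def)

lemma pluecker_coords_in_coord_space: "pluecker_coords r n u \<in> coord_space (pluecker_index r n)"
  by (simp add: coord_space_def pluecker_coords_outside)

lemma finite_pluecker_index: "finite (pluecker_index r n)"
  unfolding pluecker_index_def by (rule finite_subset[of _ "Pow {..n}"]) auto

lemma pluecker_index_enum:
  assumes "S \<in> pluecker_index r n"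
  shows "finite S" "length (sorted_list_of_set S) = r + 1" "set (sorted_list_of_set S) = S"
    "distinct (sorted_list_of_set S)" "\<And>j. j < r + 1 \<Longrightarrow> sorted_list_of_set S ! j \<in> S"
    "\<And>j. j < r + 1 \<Longrightarrow> sorted_list_of_set S ! j \<le> n"
proof -
  have S: "S \<subseteq> {..n}" "card S = r + 1" using assms by (auto simp: pluecker_index_def)
  show fin: "finite S" using S(1) finite_subset by blast
  show len: "length (sorted_list_of_set S) = r + 1" using S(2) by simp
  show set: "set (sorted_list_of_set S) = S" using fin by simp
  show "distinct (sorted_list_of_set S)" by simp
  show *: "sorted_list_of_set S ! j \<in> S" if "j < r + 1" for j
    using that len set by (metis nth_mem)
  show "sorted_list_of_set S ! j \<le> n" if "j < r + 1" for j using *[OF that] S(1) by auto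
qed

lemma pluecker_coords_cong:
  assumes "\<And>i m. i \<le> r \<Longrightarrow> m \<le> n \<Longrightarrow> u i m = u' i m"
  shows "pluecker_coords r n u = pluecker_coords r n u'"
proof
  fix S
  show "pluecker_coords r n u S = pluecker_coords r n u' S"
  proof (cases "S \<in> pluecker_index r n")
    case True
    have "mat (r + 1) (r + 1) (\<lambda>(i, j). u i (sorted_list_of_set S ! j)) =
        mat (r + 1) (r + 1) (\<lambda>(i, j). u' i (sorted_list_of_set S ! j))"
      using pluecker_index_enum(6)[OF True] assms by (intro eq_matI) auto
    then show ?thesis by (simp add: pluecker_coords_def)
  qed (simp add: pluecker_coords_outside)
qed

lemma poly_fun_pluecker_coords:
  assumes "\<And>i m. poly_fun (\<lambda>y. U y i m)"
  shows "poly_fun (\<lambda>y. pluecker_coords r n (U y) S)"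
proof (cases "S \<in> pluecker_index r n")
  case True
  then show ?thesis
    unfolding pluecker_coords_sum[OF True]
    by (intro poly_fun_sum poly_fun.mult poly_fun.const poly_fun_prod assms)
qed (simp add: pluecker_coords_outside poly_fun.const)

lemma coeff_prod_linear:
  fixes a b :: "'x \<Rightarrow> complex"
  assumes "finite X"
  shows "coeff (\<Prod>i\<in>X. [:a i, b i:]) 0 = (\<Prod>i\<in>X. a i)"
    and "coeff (\<Prod>i\<in>X. [:a i, b i:]) 1 = (\<Sum>i\<in>X. \<Prod>j\<in>X. if j = i then b j else a j)"
proof -
  show 0: "coeff (\<Prod>i\<in>X. [:a i, b i:]) 0 = (\<Prod>i\<in>X. a i)" for X
    by (induction X rule: infinite_finite_induct) (auto simp: coeff_mult_0)
  show "coeff (\<Prod>i\<in>X. [:a i, b i:]) 1 = (\<Sum>i\<in>X. \<Prod>j\<in>X. if j = i then b j else a j)"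
    using assms
  proof (induction X rule: finite_induct)
    case (insert x X)
    have 1: "(\<Prod>j\<in>insert x X. if j = i then b j else a j) = a x * (\<Prod>j\<in>X. if j = i then b j else a j)"
      if "i \<in> X" for i using insert that by auto
    have 2: "(\<Prod>j\<in>insert x X. if j = x then b j else a j) = b x * (\<Prod>j\<in>X. a j)"
    proof -
      have "(\<Prod>j\<in>X. if j = x then b j else a j) = (\<Prod>j\<in>X. a j)"
        using insert(2) by (intro prod.cong) auto
      then show ?thesis using insert(1,2) by simp
    qed
    have "(\<Sum>i\<in>insert x X. \<Prod>j\<in>insert x X. if j = i then b j else a j) =
        b x * (\<Prod>j\<in>X. a j) + (\<Sum>i\<in>X. a x * (\<Prod>j\<in>X. if j = i then b j else a j))"
      unfolding sum.insert[OF insert(1,2)] 2 by (intro arg_cong2[of _ _ _ _ "(+)"] sum.cong refl 1)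
    also have "\<dots> = coeff (\<Prod>i\<in>insert x X. [:a i, b i:]) 1"
      using insert 0[of X] by (simp add: sum_distrib_left)
    finally show ?case ..
  qed simp
qed

definition coord_vec :: "nat \<Rightarrow> nat \<Rightarrow> complex" where
  "coord_vec m = (\<lambda>k. if k = m then 1 else 0)"

text \<open>The derivative of a determinant along a line: one row at a time is replaced.\<close>

lemma pluecker_coords_line:
  "\<exists>p. (\<forall>t. pluecker_coords r n (\<lambda>i m. A i m + t * B i m) S = poly p t) \<and>
    coeff p 0 = pluecker_coords r n A S \<and>
    coeff p 1 = (\<Sum>i\<le>r. pluecker_coords r n (A(i := B i)) S)"
proof (cases "S \<in> pluecker_index r n")
  case True
  let ?s = "\<lambda>j. sorted_list_of_set S ! j"
  let ?R = "{0..<r + 1}"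
  define p where "p = (\<Sum>\<pi> | \<pi> permutes ?R. smult (of_int (sign \<pi>)) (\<Prod>i\<in>?R. [:A i (?s (\<pi> i)), B i (?s (\<pi> i)):]))"
  have "pluecker_coords r n (\<lambda>i m. A i m + t * B i m) S = poly p t" for t
    unfolding pluecker_coords_sum[OF True] p_def by (simp add: poly_sum poly_prod del: prod.op_ivl_Suc)
  moreover have "coeff p 0 = pluecker_coords r n A S"
    unfolding pluecker_coords_sum[OF True] p_def coeff_sum coeff_smult
    by (subst coeff_prod_linear(1)) auto
  moreover have "coeff p 1 = (\<Sum>i\<le>r. pluecker_coords r n (A(i := B i)) S)"
  proof -
    have "coeff p 1 = (\<Sum>\<pi> | \<pi> permutes ?R. \<Sum>i\<in>?R. of_int (sign \<pi>) *
        (\<Prod>j\<in>?R. if j = i then B j (?s (\<pi> j)) else A j (?s (\<pi> j))))"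
      unfolding p_def coeff_sum coeff_smult
      by (subst coeff_prod_linear(2))
        (auto simp: sum_distrib_left simp del: prod.op_ivl_Suc sum.op_ivl_Suc)
    also have "\<dots> = (\<Sum>i\<in>?R. \<Sum>\<pi> | \<pi> permutes ?R. of_int (sign \<pi>) *
        (\<Prod>j\<in>?R. if j = i then B j (?s (\<pi> j)) else A j (?s (\<pi> j))))"
      by (rule sum.swap)
    also have "\<dots> = (\<Sum>i\<in>?R. pluecker_coords r n (A(i := B i)) S)"
      unfolding pluecker_coords_sum[OF True]
      by (intro sum.cong refl arg_cong2[of _ _ _ _ "(*)"] prod.cong) auto
    also have "?R = {..r}" by auto
    finally show ?thesis .
  qed
  ultimately show ?thesis by blast
next
  case False
  then show ?thesis by (intro exI[of _ 0]) (simp add: pluecker_coords_outside)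
qed

lemma pluecker_coords_row_linear:
  assumes i: "i \<le> r" and D: "D \<subseteq> {..n}" and w: "\<And>m. m \<notin> D \<Longrightarrow> w m = 0"
  shows "pluecker_coords r n (A(i := w)) S = (\<Sum>m\<in>D. w m * pluecker_coords r n (A(i := coord_vec m)) S)"
proof (cases "S \<in> pluecker_index r n")
  case True
  let ?s = "\<lambda>j. sorted_list_of_set S ! j"
  let ?R = "{0..<r + 1}"
  have D': "finite D" using D finite_subset by blast
  have ex: "w k = (\<Sum>m\<in>D. w m * coord_vec m k)" for k
  proof -
    have "(\<Sum>m\<in>D. w m * coord_vec m k) = (\<Sum>m\<in>D. if m = k then w k else 0)"
      by (intro sum.cong) (auto simp: coord_vec_def)
    then show ?thesis using w[of k] D' by simp
  qed
  have pr: "(\<Prod>j\<in>?R. (A(i := x)) j (?s (\<pi> j))) = x (?s (\<pi> i)) * (\<Prod>j\<in>?R - {i}. A j (?s (\<pi> j)))"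
    for x :: "nat \<Rightarrow> complex" and \<pi>
    using i by (subst prod.remove[of _ i]) auto
  have "pluecker_coords r n (A(i := w)) S =
      (\<Sum>\<pi> | \<pi> permutes ?R. \<Sum>m\<in>D. w m * (of_int (sign \<pi>) * (coord_vec m (?s (\<pi> i)) * (\<Prod>j\<in>?R - {i}. A j (?s (\<pi> j))))))"
    unfolding pluecker_coords_sum[OF True] pr
    by (intro sum.cong refl, subst ex) (simp add: sum_distrib_left sum_distrib_right algebra_simps)
  also have "\<dots> = (\<Sum>m\<in>D. w m * pluecker_coords r n (A(i := coord_vec m)) S)"
    unfolding pluecker_coords_sum[OF True] pr by (subst sum.swap) (simp add: sum_distrib_left)
  finally show ?thesis .
qed (simp add: pluecker_coords_outside)

lemma family_independent:
  fixes v :: "'k \<Rightarrow> 'i \<Rightarrow> complex"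
  assumes K: "finite K" and rel: "\<And>a. (\<And>x. (\<Sum>k\<in>K. a k * v k x) = 0) \<Longrightarrow> \<forall>k\<in>K. a k = 0"
  shows "inj_on v K" "cvec.independent (v ` K)"
proof -
  show inj: "inj_on v K"
  proof (rule inj_onI, rule ccontr)
    fix j k assume jk: "j \<in> K" "k \<in> K" "v j = v k" "j \<noteq> k"
    let ?a = "\<lambda>x. (if x = j then 1 else 0) - (if x = k then 1 else (0::complex))"
    have "(\<Sum>l\<in>K. ?a l * v l x) = (\<Sum>l\<in>K. (if l = j then v l x else 0) - (if l = k then v l x else 0))" for x
      by (intro sum.cong) auto
    then have "(\<Sum>l\<in>K. ?a l * v l x) = 0" for x using K jk by (simp add: sum_subtractf)
    then have "\<forall>l\<in>K. ?a l = 0" by (rule rel)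
    then show False using jk by auto
  qed
  show "cvec.independent (v ` K)"
  proof
    assume "cvec.dependent (v ` K)"
    then obtain a where a: "(\<Sum>x\<in>v ` K. cscale (a x) x) = 0" "\<exists>x\<in>v ` K. a x \<noteq> 0"
      using K cvec.dependent_finite[of "v ` K"] by auto
    have "(\<Sum>k\<in>K. cscale (a (v k)) (v k)) = 0" using a(1) by (simp add: sum.reindex[OF inj])
    then have "(\<Sum>k\<in>K. a (v k) * v k x) = 0" for x
      using sum_apply[of "\<lambda>k. cscale (a (v k)) (v k)" K x] by (simp add: cscale_def)
    then have "\<forall>k\<in>K. a (v k) = 0" by (rule rel)
    then show False using a(2) by auto
  qed
qed

lemma span_pluecker_coords_in_grassmannian:
  assumes v: "\<And>i. i \<le> r \<Longrightarrow> v i \<in> coord_space {..n}" and nz: "pluecker_coords r n v \<noteq> 0"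
  shows "cvec.span {pluecker_coords r n v} \<in> grassmannian r n"
proof -
  obtain S where S: "pluecker_coords r n v S \<noteq> 0" using nz by (auto simp: fun_eq_iff)
  then have SI: "S \<in> pluecker_index r n" using pluecker_coords_outside by blast
  define M where "M = mat (r + 1) (r + 1) (\<lambda>(i, j). v i (sorted_list_of_set S ! j))"
  have M: "M \<in> carrier_mat (r + 1) (r + 1)" "Determinant.det M \<noteq> 0"
    using S SI by (simp_all add: M_def pluecker_coords_def)
  have rel: "\<forall>i\<in>{..r}. a i = 0" if a: "\<And>x. (\<Sum>i\<le>r. a i * v i x) = 0" for a
  proof -
    define w where "w = vec (r + 1) a"
    have "transpose_mat M *\<^sub>v w = 0\<^sub>v (r + 1)"
    proof (rule eq_vecI)
      fix j assume "j < dim_vec (0\<^sub>v (r + 1))"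
      then have j: "j < r + 1" by simp
      have "(transpose_mat M *\<^sub>v w) $ j = (\<Sum>i<r + 1. v i (sorted_list_of_set S ! j) * a i)"
        using j by (simp add: M_def w_def scalar_prod_def atLeast0LessThan)
      also have "\<dots> = 0" using a[of "sorted_list_of_set S ! j"] by (simp add: lessThan_Suc_atMost mult.commute)
      finally show "(transpose_mat M *\<^sub>v w) $ j = 0\<^sub>v (r + 1) $ j" using j by simp
    qed (simp add: M_def)
    moreover have "Determinant.det (transpose_mat M) \<noteq> 0" using M det_transpose by metis
    moreover have "w \<in> carrier_vec (r + 1)" "transpose_mat M \<in> carrier_mat (r + 1) (r + 1)"
      using M(1) by (simp_all add: w_def)
    ultimately have "w = 0\<^sub>v (r + 1)" using det_0_iff_vec_prod_zero by blast
    then show ?thesis by (metis (no_types, lifting) atMost_iff index_vec index_zero_vec(1) less_Suc_eq_le Suc_eq_plus1 w_def)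
  qed
  have inj: "inj_on v {..r}" and ind: "cvec.independent (v ` {..r})"
    using family_independent[of "{..r}" v] rel by blast+
  let ?W = "cvec.span (v ` {..r})"
  have "cvec.dim ?W = r + 1"
    using cvec.dim_span_eq_card_independent[OF ind] card_image[OF inj] by simp
  moreover have "?W \<subseteq> coord_space {..n}"
    using v subspace_coord_space by (intro cvec.span_minimal) auto
  ultimately have "?W \<in> linear_subspaces {..n} (r + 1)" by (simp add: linear_subspaces_def)
  moreover have "is_basis r v ?W" using inj ind by (simp add: is_basis_def)
  ultimately show ?thesis unfolding grassmannian_def by blast
qed

text \<open>A change of basis multiplies all Pluecker coordinates by the same determinant.\<close>

lemma pluecker_coords_row_operation:
  assumes A: "A \<in> carrier_mat (r + 1) (r + 1)"
  shows "pluecker_coords r n (\<lambda>i m. \<Sum>k<r + 1. A $$ (i, k) * u k m) = cscale (Determinant.det A) (pluecker_coords r n u)"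
proof
  fix S
  show "pluecker_coords r n (\<lambda>i m. \<Sum>k<r + 1. A $$ (i, k) * u k m) S = cscale (Determinant.det A) (pluecker_coords r n u) S"
  proof (cases "S \<in> pluecker_index r n")
    case True
    let ?M = "mat (r + 1) (r + 1) (\<lambda>(i, j). u i (sorted_list_of_set S ! j))"
    have "mat (r + 1) (r + 1) (\<lambda>(i, j). \<Sum>k<r + 1. A $$ (i, k) * u k (sorted_list_of_set S ! j)) = A * ?M"
      using A by (intro eq_matI) (auto simp: scalar_prod_def atLeast0LessThan)
    then show ?thesis using True det_mult[OF A, of ?M] by (simp add: pluecker_coords_def cscale_def)
  qed (simp add: pluecker_coords_outside cscale_def)
qed

lemma span_cscale:
  assumes "c \<noteq> 0" shows "cvec.span {cscale c v} = cvec.span {v}"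
proof -
  have "v = cscale (inverse c) (cscale c v)" using assms by (simp add: cscale_def fun_eq_iff)
  then have "v \<in> cvec.span {cscale c v}"
    using cvec.span_scale[OF cvec.span_base[of "cscale c v" "{cscale c v}"], of "inverse c"] by simp
  moreover have "cscale c v \<in> cvec.span {v}" by (intro cvec.span_scale cvec.span_base) simp
  ultimately show ?thesis by (simp add: cvec.span_eq)
qed

text \<open>
  A subspace with nonzero coordinate \<open>S\<close> has a unique basis whose square block in the columns
  \<open>S\<close> is the identity matrix; the remaining entries are free.
\<close>

definition chart_rows :: "nat set \<Rightarrow> (nat \<times> nat \<Rightarrow> complex) \<Rightarrow> nat \<Rightarrow> nat \<Rightarrow> complex" where
  "chart_rows S z = (\<lambda>i m. if m \<in> S then if sorted_list_of_set S ! i = m then 1 else 0 else z (i, m))"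

lemma affine_chart_grassmannian:
  assumes S: "S \<in> pluecker_index r n"
  shows "affine_chart (pluecker_index r n) (grassmannian r n) ({..r} \<times> ({..n} - S)) S
    (\<lambda>z. pluecker_coords r n (chart_rows S z))"
  unfolding affine_chart_def
proof (intro conjI allI ballI impI)
  let ?s = "\<lambda>j. sorted_list_of_set S ! j"
  have idx: "?s i = ?s j \<longleftrightarrow> i = j" if "i < r + 1" "j < r + 1" for i j
    using nth_eq_iff_index_eq[OF pluecker_index_enum(4)[OF S]] pluecker_index_enum(2)[OF S] that by simp
  show "S \<in> pluecker_index r n" by (rule S)
  show "poly_fun (\<lambda>z. pluecker_coords r n (chart_rows S z) T)" for T
    unfolding chart_rows_def by (intro poly_fun_pluecker_coords poly_fun_if poly_fun.const poly_fun.var)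
  show "pluecker_coords r n (chart_rows S z) S = 1" for z
  proof -
    have "mat (r + 1) (r + 1) (\<lambda>(i, j). chart_rows S z i (?s j)) = 1\<^sub>m (r + 1)"
      using pluecker_index_enum(5)[OF S] idx by (intro eq_matI) (auto simp: chart_rows_def)
    then show ?thesis using S by (simp add: pluecker_coords_def)
  qed
  fix q assume q: "q \<in> grassmannian r n \<inter> proj_space (pluecker_index r n)" "\<exists>v\<in>q. v S \<noteq> 0"
  obtain u W where u: "q = cvec.span {pluecker_coords r n u}" "is_basis r u W" "W \<in> linear_subspaces {..n} (r + 1)"
    using q(1) by (auto simp: grassmannian_def)
  have uS: "pluecker_coords r n u S \<noteq> 0"
    using q(2) u(1) by (auto simp: cvec.span_singleton cscale_def)
  define M where "M = mat (r + 1) (r + 1) (\<lambda>(i, j). u i (?s j))"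
  have M: "M \<in> carrier_mat (r + 1) (r + 1)" by (simp add: M_def)
  have dM: "Determinant.det M \<noteq> 0" using uS S by (simp add: pluecker_coords_def M_def)
  define B where "B = inverse (Determinant.det M) \<cdot>\<^sub>m adj_mat M"
  have B: "B \<in> carrier_mat (r + 1) (r + 1)" using adj_mat(1)[OF M] by (simp add: B_def)
  have BM: "B * M = 1\<^sub>m (r + 1)"
  proof -
    have "B * M = inverse (Determinant.det M) \<cdot>\<^sub>m (adj_mat M * M)"
      unfolding B_def using adj_mat(1)[OF M] M by (rule mult_smult_assoc_mat)
    also have "\<dots> = 1\<^sub>m (r + 1)" unfolding adj_mat(3)[OF M] using dM by (intro eq_matI) auto
    finally show ?thesis .
  qed
  have dB: "Determinant.det B \<noteq> 0" using det_mult[OF B M] BM by auto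
  define u' where "u' = (\<lambda>i m. \<Sum>k<r + 1. B $$ (i, k) * u k m)"
  have u'S: "u' i (?s j) = (if i = j then 1 else 0)" if "i < r + 1" "j < r + 1" for i j
  proof -
    have "(B * M) $$ (i, j) = u' i (?s j)"
      using that B by (simp add: u'_def M_def scalar_prod_def atLeast0LessThan)
    then show ?thesis using BM that by simp
  qed
  define z where "z = (\<lambda>(i, m). if i \<le> r \<and> m \<le> n \<and> m \<notin> S then u' i m else 0)"
  have "pluecker_coords r n (chart_rows S z) = pluecker_coords r n u'"
  proof (rule pluecker_coords_cong)
    fix i m assume im: "i \<le> r" "m \<le> n"
    show "chart_rows S z i m = u' i m"
    proof (cases "m \<in> S")
      case True
      then obtain j where j: "j < r + 1" "m = ?s j"
        using pluecker_index_enum(2,3)[OF S] by (metis in_set_conv_nth)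
      then show ?thesis using u'S[of i j] idx[of i j] im True by (auto simp: chart_rows_def)
    next
      case False
      then show ?thesis using im by (simp add: chart_rows_def z_def)
    qed
  qed
  also have "\<dots> = cscale (Determinant.det B) (pluecker_coords r n u)"
    unfolding u'_def by (rule pluecker_coords_row_operation[OF B])
  finally have "q = cvec.span {pluecker_coords r n (chart_rows S z)}"
    using u(1) span_cscale[OF dB, of "pluecker_coords r n u"] by simp
  moreover have "z \<in> coord_space ({..r} \<times> ({..n} - S))" by (auto simp: coord_space_def z_def)
  ultimately show "\<exists>z\<in>coord_space ({..r} \<times> ({..n} - S)). q = cvec.span {pluecker_coords r n (chart_rows S z)}"
    by blast
qed

lemma proj_dim_grassmannian_le:
  "proj_dim (pluecker_index r n) (grassmannian r n) \<le> enat ((r + 1) * (n - r))"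
proof (rule proj_dim_le_chart)
  fix p assume p: "p \<in> grassmannian r n" "p \<in> proj_space (pluecker_index r n)"
  obtain u where u: "p = cvec.span {pluecker_coords r n u}" using p(1) by (auto simp: grassmannian_def)
  have "pluecker_coords r n u \<noteq> 0"
  proof
    assume "pluecker_coords r n u = 0"
    then have "p = {0}" using u by simp
    moreover have "cvec.dim {0 :: nat set \<Rightarrow> complex} = 0"
      using cvec.dim_span[of "{} :: (nat set \<Rightarrow> complex) set"]
        cvec.dim_eq_card_independent[of "{} :: (nat set \<Rightarrow> complex) set"]
        cvec.independent_empty by simp
    ultimately show False using p(2) by (simp add: proj_space_def linear_subspaces_def)
  qed
  then obtain S where S: "pluecker_coords r n u S \<noteq> 0" by (auto simp: fun_eq_iff)
  then have SI: "S \<in> pluecker_index r n" using pluecker_coords_outside by blast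
  have "S \<subseteq> {..n}" "finite S" "card S = r + 1"
    using SI pluecker_index_enum(1)[OF SI] by (auto simp: pluecker_index_def)
  then have "card ({..r} \<times> ({..n} - S)) = (r + 1) * (n - r)"
    by (simp add: card_Diff_subset)
  moreover have "\<exists>v\<in>p. v S \<noteq> 0" 
    unfolding u by (intro bexI[of _ "pluecker_coords r n u"]) (simp_all add: S cvec.span_base)
  ultimately show "\<exists>(J :: (nat \<times> nat) set) i0 \<psi>. finite J \<and> card J = (r + 1) * (n - r) \<and>
      affine_chart (pluecker_index r n) (grassmannian r n) J i0 \<psi> \<and> (\<exists>v\<in>p. v i0 \<noteq> 0)"
    using affine_chart_grassmannian[OF SI]
    by (intro exI[of _ "{..r} \<times> ({..n} - S)"] exI[of _ S] exI conjI) auto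
qed

section \<open>A tangent space criterion for non-defectivity\<close>

lemma dual_functionals:
  fixes w :: "'k \<Rightarrow> 'i \<Rightarrow> complex"
  assumes K: "finite K" and I: "finite I" and w: "\<And>k. k \<in> K \<Longrightarrow> w k \<in> coord_space I"
    and rel: "\<And>a. (\<And>x. x \<in> I \<Longrightarrow> (\<Sum>k\<in>K. a k * w k x) = 0) \<Longrightarrow> \<forall>k\<in>K. a k = 0"
  obtains l where "\<And>k k'. k \<in> K \<Longrightarrow> k' \<in> K \<Longrightarrow> (\<Sum>i\<in>I. l k i * w k' i) = (if k = k' then 1 else 0)"
proof -
  have rel': "\<forall>k\<in>K. a k = 0" if "\<And>x. (\<Sum>k\<in>K. a k * w k x) = 0" for a using rel that by blast
  have inj: "inj_on w K" and ind: "cvec.independent (w ` K)"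
    using family_independent[OF K, of w] rel' by blast+
  interpret vp: vector_space_pair
    "cscale :: complex \<Rightarrow> ('i \<Rightarrow> complex) \<Rightarrow> _" "cscale :: complex \<Rightarrow> (unit \<Rightarrow> complex) \<Rightarrow> _" ..
  have "\<exists>l. \<forall>k'\<in>K. (\<Sum>i\<in>I. l i * w k' i) = (if k = k' then 1 else 0)" if k: "k \<in> K" for k
  proof -
    obtain g where g: "Vector_Spaces.linear cscale cscale g"
      "\<And>x. x \<in> w ` K \<Longrightarrow> g x = (if x = w k then (\<lambda>_ :: unit. 1) else (\<lambda>_. 0))"
      using vp.linear_independent_extend[OF ind, of "\<lambda>x. if x = w k then (\<lambda>_. 1) else (\<lambda>_. 0)"] by blast
    interpret g: Vector_Spaces.linear cscale cscale g by (rule g(1))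
    let ?e = "\<lambda>i j. if j = i then 1 else (0::complex)"
    have "(\<Sum>i\<in>I. g (?e i) () * w k' i) = (if k = k' then 1 else 0)" if k': "k' \<in> K" for k'
    proof -
      have "w k' = (\<Sum>i\<in>I. cscale (w k' i) (?e i))"
      proof
        fix j
        have "(\<Sum>i\<in>I. cscale (w k' i) (?e i)) j = (\<Sum>i\<in>I. if i = j then w k' j else 0)"
          unfolding sum_apply by (intro sum.cong) (auto simp: cscale_def)
        then show "w k' j = (\<Sum>i\<in>I. cscale (w k' i) (?e i)) j"
          using w[OF k'] I by (auto simp: coord_space_def)
      qed
      then have "g (w k') = (\<Sum>i\<in>I. cscale (w k' i) (g (?e i)))"
        using g.sum[of "\<lambda>i. cscale (w k' i) (?e i)" I] by (simp add: g.scale)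
      then have "g (w k') () = (\<Sum>i\<in>I. g (?e i) () * w k' i)"
        by (simp add: sum_apply cscale_def mult.commute)
      moreover have "w k' = w k \<longleftrightarrow> k = k'" using inj k k' by (auto simp: inj_on_def)
      ultimately show ?thesis using g(2)[of "w k'"] k' by (auto split: if_splits)
    qed
    then show ?thesis by (intro exI[of _ "\<lambda>i. g (?e i) ()"]) blast
  qed
  then have "\<forall>k. \<exists>l. k \<in> K \<longrightarrow> (\<forall>k'\<in>K. (\<Sum>i\<in>I. l i * w k' i) = (if k = k' then 1 else 0))" by blast
  then obtain l where "\<And>k. k \<in> K \<Longrightarrow> \<forall>k'\<in>K. (\<Sum>i\<in>I. l k i * w k' i) = (if k = k' then 1 else 0)" by metis
  then show thesis using that[of l] by blast
qed

text \<open>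
  The tangent space of the affine cone at the Pluecker vector of \<open>u p 0, \<dots>, u p r\<close> is spanned by
  that vector and by the vectors that arise when one row \<open>u p i\<close> is replaced by a coordinate
  vector with index in a set \<open>D p\<close> of \<open>n - r\<close> elements. If these vectors, for all \<open>s\<close> points
  together, are linearly independent, then the sum of \<open>s\<close> points of the cone, one of
  them with coefficient 1, depends on \<open>s * ((r + 1) * (n - r) + 1) - 1\<close> parameters, and its value and
  its derivatives with respect to them are independent. This is the lower bound in Terracini's
  lemma.
\<close>

lemma not_defective_if_tangents_independent:
  assumes s: "s > 0" and rn: "r \<le> n"
    and u: "\<And>p i. p < s \<Longrightarrow> i \<le> r \<Longrightarrow> u p i \<in> coord_space {..n}"
    and D: "\<And>p. p < s \<Longrightarrow> D p \<subseteq> {..n}" "\<And>p. p < s \<Longrightarrow> card (D p) = n - r"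
    and indep: "\<And>c x. (\<And>S. S \<in> pluecker_index r n \<Longrightarrow>
        (\<Sum>p<s. c p * pluecker_coords r n (u p) S +
          (\<Sum>i\<le>r. \<Sum>m\<in>D p. x p i m * pluecker_coords r n ((u p)(i := coord_vec m)) S)) = 0) \<Longrightarrow>
      \<forall>p<s. c p = 0 \<and> (\<forall>i\<le>r. \<forall>m\<in>D p. x p i m = 0)"
  shows "\<not> defective (pluecker_index r n) (grassmannian r n) s"
proof -
  let ?I = "pluecker_index r n" and ?X = "grassmannian r n"
  define K where "K = Sigma {..<s} (\<lambda>p. insert None (Some ` ({..r} \<times> D p)))"
  define w where "w = (\<lambda>(p, t). case t of None \<Rightarrow> pluecker_coords r n (u p)
    | Some (i, m) \<Rightarrow> pluecker_coords r n ((u p)(i := coord_vec m)))"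
  define Q where "Q = K - {(0, None)}"
  define H where "H = (\<lambda>y :: nat \<times> (nat \<times> nat) option \<Rightarrow> complex. \<lambda>S. \<Sum>p<s. (1 + y (p, None)) *
    pluecker_coords r n (\<lambda>i m. u p i m + y (p, Some (i, m))) S)"
  have finD: "finite (D p)" if "p < s" for p using D(1)[OF that] finite_subset by blast
  have K: "finite K" unfolding K_def using finD by auto
  have sumK: "(\<Sum>k\<in>K. F k) = (\<Sum>p<s. F (p, None) + (\<Sum>i\<le>r. \<Sum>m\<in>D p. F (p, Some (i, m))))"
    for F :: "nat \<times> (nat \<times> nat) option \<Rightarrow> complex"
  proof -
    have "(\<Sum>k\<in>K. F k) = (\<Sum>p<s. \<Sum>t\<in>insert None (Some ` ({..r} \<times> D p)). F (p, t))"
      unfolding K_def using finD by (subst sum.Sigma) auto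
    also have "\<dots> = (\<Sum>p<s. F (p, None) + (\<Sum>i\<le>r. \<Sum>m\<in>D p. F (p, Some (i, m))))"
    proof (rule sum.cong[OF refl])
      fix p assume "p \<in> {..<s}"
      then have "finite (D p)" using finD by auto
      then have "(\<Sum>t\<in>insert None (Some ` ({..r} \<times> D p)). F (p, t)) =
          F (p, None) + (\<Sum>t\<in>Some ` ({..r} \<times> D p). F (p, t))"
        by (subst sum.insert) auto
      also have "(\<Sum>t\<in>Some ` ({..r} \<times> D p). F (p, t)) = (\<Sum>im\<in>{..r} \<times> D p. F (p, Some im))"
        by (subst sum.reindex) auto
      also have "\<dots> = (\<Sum>i\<le>r. \<Sum>m\<in>D p. F (p, Some (i, m)))"
        by (simp add: sum.cartesian_product case_prod_beta)
      finally show "(\<Sum>t\<in>insert None (Some ` ({..r} \<times> D p)). F (p, t)) =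
          F (p, None) + (\<Sum>i\<le>r. \<Sum>m\<in>D p. F (p, Some (i, m)))" .
    qed
    finally show ?thesis .
  qed
  have cardQ: "card Q = s * ((r + 1) * (n - r) + 1) - 1"
  proof -
    have "card K = (\<Sum>p<s. card (insert None (Some ` ({..r} \<times> D p))))"
      unfolding K_def using finD by (intro card_SigmaI) auto
    also have "\<dots> = (\<Sum>p<s. (r + 1) * (n - r) + 1)"
    proof (rule sum.cong[OF refl])
      fix p assume "p \<in> {..<s}"
      then show "card (insert None (Some ` ({..r} \<times> D p))) = (r + 1) * (n - r) + 1"
        using finD[of p] D(2)[of p] by (simp add: card_image card_cartesian_product card_insert_if image_iff)
    qed
    finally have "card K = s * ((r + 1) * (n - r) + 1)" by simp
    moreover have "(0, None) \<in> K" using s by (simp add: K_def)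
    ultimately show ?thesis using K by (simp add: Q_def)
  qed
  have relK: "\<forall>k\<in>K. a k = 0" if "\<And>S. S \<in> ?I \<Longrightarrow> (\<Sum>k\<in>K. a k * w k S) = 0" for a
  proof -
    have "\<forall>p<s. a (p, None) = 0 \<and> (\<forall>i\<le>r. \<forall>m\<in>D p. a (p, Some (i, m)) = 0)"
      using that unfolding sumK by (intro indep) (simp add: w_def)
    then show ?thesis by (auto simp: K_def)
  qed
  obtain l where l: "\<And>k k'. k \<in> K \<Longrightarrow> k' \<in> K \<Longrightarrow> (\<Sum>S\<in>?I. l k S * w k' S) = (if k = k' then 1 else 0)"
  proof (rule dual_functionals[OF K finite_pluecker_index, of w])
    show "w k \<in> coord_space ?I" for k
      unfolding w_def by (simp add: pluecker_coords_in_coord_space split: prod.split option.split)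
    show "\<forall>k\<in>K. a k = 0" if "\<And>S. S \<in> ?I \<Longrightarrow> (\<Sum>k\<in>K. a k * w k S) = 0" for a
      using that by (rule relK)
  qed (rule that)
  have H0: "H (\<lambda>q. 0) S = (\<Sum>p<s. w (p, None) S)" for S by (simp add: H_def w_def)
  have lH0: "(\<Sum>S\<in>?I. l k S * H (\<lambda>q. 0) S) = (if snd k = None then 1 else 0)" if k: "k \<in> K" for k
  proof -
    have "(\<Sum>S\<in>?I. l k S * H (\<lambda>q. 0) S) = (\<Sum>p<s. \<Sum>S\<in>?I. l k S * w (p, None) S)"
      unfolding H0 sum_distrib_left by (rule sum.swap)
    also have "\<dots> = (\<Sum>p<s. if k = (p, None) then 1 else 0)"
      using l[OF k] by (intro sum.cong refl) (simp add: K_def)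
    also have "\<dots> = (\<Sum>p<s. if p = fst k then (if snd k = None then 1 else 0) else 0)"
      by (intro sum.cong refl) (auto simp: prod_eq_iff)
    also have "\<dots> = (if snd k = None then 1 else 0)" using k by (auto simp: K_def)
    finally show ?thesis .
  qed
  have K0: "(0, None) \<in> K" using s by (simp add: K_def)
  define Y where "Y = secant_variety ?I ?X s"
  \<comment> \<open>the value at the origin is the sum of all \<open>s\<close> points, so the functionals dual to the points
    other than the normalized one must be corrected by the functional dual to that one\<close>
  have "enat (card Q) \<le> proj_dim ?I Y"
  proof (rule proj_dim_ge_parameters[where H = H and D = w and ?l0.0 = "l (0, None)"
        and l = "\<lambda>q S. l q S - (if snd q = None then l (0, None) S else 0)"])
    show "finite Q" using K by (simp add: Q_def)
    show "closedin (zariski ?I) Y" by (simp add: Y_def secant_variety_def)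
    show "H y \<in> coord_space ?I" for y by (simp add: H_def coord_space_def pluecker_coords_outside)
    show "poly_fun (\<lambda>y. H y S)" for S
      unfolding H_def
      by (intro poly_fun_sum poly_fun.mult poly_fun.add poly_fun.const poly_fun.var poly_fun_pluecker_coords)
    show "(\<Sum>S\<in>?I. l (0, None) S * H (\<lambda>q. 0) S) = 1" using lH0[OF K0] by simp
    show "(\<Sum>S\<in>?I. (l q S - (if snd q = None then l (0, None) S else 0)) * H (\<lambda>q. 0) S) = 0" if "q \<in> Q" for q
      using lH0[OF K0] lH0[of q] that
      by (cases "snd q = None") (simp_all add: Q_def left_diff_distrib sum_subtractf del: not_None_eq)
    show "(\<Sum>S\<in>?I. (l q S - (if snd q = None then l (0, None) S else 0)) * w q' S) = (if q = q' then 1 else 0)"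
      if "q \<in> Q" "q' \<in> Q" for q q'
    proof -
      have "(\<Sum>S\<in>?I. l (0, None) S * w q' S) = 0" "(\<Sum>S\<in>?I. l q S * w q' S) = (if q = q' then 1 else 0)"
        using l[OF K0, of q'] l[of q q'] that by (auto simp: Q_def)
      then show ?thesis by (cases "snd q = None") (simp_all add: left_diff_distrib sum_subtractf del: not_None_eq)
    qed
  next
    fix z :: "nat \<times> (nat \<times> nat) option \<Rightarrow> complex" and S
    assume z: "z \<in> coord_space Q"
    have "\<forall>p. \<exists>P. (\<forall>t. pluecker_coords r n (\<lambda>i m. u p i m + t * z (p, Some (i, m))) S = poly P t) \<and>
        coeff P 0 = pluecker_coords r n (u p) S \<and>
        coeff P 1 = (\<Sum>i\<le>r. pluecker_coords r n ((u p)(i := \<lambda>m. z (p, Some (i, m)))) S)"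
    proof
      fix p
      show "\<exists>P. (\<forall>t. pluecker_coords r n (\<lambda>i m. u p i m + t * z (p, Some (i, m))) S = poly P t) \<and>
        coeff P 0 = pluecker_coords r n (u p) S \<and>
        coeff P 1 = (\<Sum>i\<le>r. pluecker_coords r n ((u p)(i := \<lambda>m. z (p, Some (i, m)))) S)"
        by (rule pluecker_coords_line)
    qed
    then obtain P where P: "\<And>p t. pluecker_coords r n (\<lambda>i m. u p i m + t * z (p, Some (i, m))) S = poly (P p) t"
      "\<And>p. coeff (P p) 0 = pluecker_coords r n (u p) S"
      "\<And>p. coeff (P p) 1 = (\<Sum>i\<le>r. pluecker_coords r n ((u p)(i := \<lambda>m. z (p, Some (i, m)))) S)"
      by metis
    define p where "p = (\<Sum>j<s. [:1, z (j, None):] * P j)"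
    have "H (\<lambda>q. t * z q) S = poly p t" for t
      by (simp add: H_def p_def poly_sum P(1) algebra_simps)
    moreover have "coeff p 0 = H (\<lambda>q. 0) S"
      by (simp add: H_def p_def coeff_sum P(2) coeff_mult_0)
    moreover have "coeff p 1 = (\<Sum>q\<in>Q. z q * w q S)"
    proof -
      have row: "pluecker_coords r n ((u j)(i := \<lambda>m. z (j, Some (i, m)))) S =
          (\<Sum>m\<in>D j. z (j, Some (i, m)) * pluecker_coords r n ((u j)(i := coord_vec m)) S)"
        if "j < s" "i \<le> r" for i j
        using z D(1)[OF that(1)] that
        by (intro pluecker_coords_row_linear) (auto simp: coord_space_def Q_def K_def)
      have "coeff p 1 = (\<Sum>j<s. z (j, None) * pluecker_coords r n (u j) S +
          (\<Sum>i\<le>r. \<Sum>m\<in>D j. z (j, Some (i, m)) * pluecker_coords r n ((u j)(i := coord_vec m)) S))"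
        unfolding p_def coeff_sum
      proof (rule sum.cong[OF refl])
        fix j assume "j \<in> {..<s}"
        then have "coeff (P j) 1 = (\<Sum>i\<le>r. \<Sum>m\<in>D j. z (j, Some (i, m)) * pluecker_coords r n ((u j)(i := coord_vec m)) S)"
          unfolding P(3) by (intro sum.cong refl row) auto
        then show "coeff ([:1, z (j, None):] * P j) 1 = z (j, None) * pluecker_coords r n (u j) S +
            (\<Sum>i\<le>r. \<Sum>m\<in>D j. z (j, Some (i, m)) * pluecker_coords r n ((u j)(i := coord_vec m)) S)"
          using P(2)[of j] by (simp add: mult_pCons_left)
      qed
      also have "\<dots> = (\<Sum>q\<in>K. z q * w q S)" by (simp add: sumK w_def)
      also have "\<dots> = (\<Sum>q\<in>Q. z q * w q S)"
        using z K by (intro sum.mono_neutral_right) (auto simp: Q_def coord_space_def)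
      finally show ?thesis .
    qed
    ultimately show "\<exists>p. (\<forall>t. H (\<lambda>q. t * z q) S = poly p t) \<and> coeff p 0 = H (\<lambda>q. 0) S \<and>
        coeff p 1 = (\<Sum>q\<in>Q. z q * w q S)" by blast
  next
    fix y assume y: "y \<in> coord_space Q" and nz: "H y \<noteq> 0"
    define U where "U = (\<lambda>p i m. u p i m + y (p, Some (i, m)))"
    have U: "U p i \<in> coord_space {..n}" if "p < s" "i \<le> r" for p i
    proof -
      have "y (p, Some (i, m)) = 0" if "m \<notin> D p" for m
        using y that by (auto simp: coord_space_def Q_def K_def)
      then show ?thesis
        using u[OF that] D(1)[OF that(1)] by (auto simp: U_def coord_space_def subset_iff)
    qed
    \<comment> \<open>a dummy point for summands that vanish\<close>
    have "w (0, None) \<noteq> 0" using l[OF K0 K0] by auto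
    then have "cvec.span {pluecker_coords r n (u 0)} \<in> ?X"
      using u s by (intro span_pluecker_coords_in_grassmannian) (auto simp: w_def)
    then obtain x0 where x0: "x0 \<in> ?X" by blast
    define x where "x = (\<lambda>p. if pluecker_coords r n (U p) = 0 then x0 else cvec.span {pluecker_coords r n (U p)})"
    have x: "x p \<in> ?X" if "p < s" for p
      using x0 span_pluecker_coords_in_grassmannian[of r "U p" n] U[OF that] by (simp add: x_def)
    have mem: "pluecker_coords r n (U p) \<in> cvec.span (\<Union>(x ` {..<s}))" if "p < s" for p
    proof (cases "pluecker_coords r n (U p) = 0")
      case False
      then have "pluecker_coords r n (U p) \<in> x p" by (simp add: x_def cvec.span_base)
      then show ?thesis using that by (intro cvec.span_base) auto
    qed (simp add: cvec.span_zero)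
    have "H y = (\<Sum>p<s. cscale (1 + y (p, None)) (pluecker_coords r n (U p)))"
      by (auto simp: H_def U_def sum_apply cscale_def fun_eq_iff)
    then have "H y \<in> cvec.span (\<Union>(x ` {..<s}))"
      using mem by (auto intro!: cvec.span_sum cvec.span_scale)
    then have "cvec.span {H y} \<subseteq> cvec.span (\<Union>(x ` {..<s}))"
      by (intro cvec.span_minimal) (auto simp: cvec.subspace_span)
    moreover have "cvec.span {H y} \<in> proj_space ?I"
      using nz by (intro span_singleton_in_proj_space) (simp_all add: H_def coord_space_def pluecker_coords_outside)
    ultimately have "cvec.span {H y} \<in> proj_span ?I (x ` {..<s})" by (simp add: proj_span_def)
    then have "cvec.span {H y} \<in> (\<Union>x\<in>{x. \<forall>i<s. x i \<in> ?X}. proj_span ?I (x ` {..<s}))" using x by blast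
    moreover have "(\<Union>x\<in>{x. \<forall>i<s. x i \<in> ?X}. proj_span ?I (x ` {..<s})) \<subseteq> topspace (zariski ?I)"
      by (auto simp: proj_span_def topspace_zariski)
    ultimately show "cvec.span {H y} \<in> Y"
      unfolding Y_def secant_variety_def using closure_of_subset by blast
  qed
  moreover have "enat s * proj_dim ?I ?X + enat s - 1 \<le> enat (card Q)"
  proof -
    obtain d where d: "proj_dim ?I ?X = enat d" "d \<le> (r + 1) * (n - r)"
      using proj_dim_grassmannian_le[of r n] by (metis enat_ile enat_ord_simps(1))
    have "s * d + s - 1 \<le> card Q" unfolding cardQ using d(2) by (simp add: diff_le_mono)
    then show ?thesis unfolding d(1) by (simp add: one_enat_def)
  qed
  ultimately show ?thesis
    unfolding defective_def Y_def by (meson min_le_iff_disj not_less order_trans)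
qed

section \<open>Coordinate points\<close>

lemma sum_single:
  fixes g :: "'a \<Rightarrow> 'b::comm_monoid_add"
  assumes "finite A" "a \<in> A" "\<And>b. b \<in> A \<Longrightarrow> b \<noteq> a \<Longrightarrow> g b = 0"
  shows "sum g A = g a"
proof -
  have "sum g (A - {a}) = 0" using assms(3) by (intro sum.neutral) auto
  then show ?thesis using assms(1,2) by (simp add: sum.remove)
qed

text \<open>
  Rows that are coordinate vectors give a permutation matrix \<open>M\<close>, so that \<open>M\<close> times its transpose
  is 1, or a matrix with a zero column.
\<close>

lemma pluecker_coords_coord_vecs:
  assumes T: "T \<in> pluecker_index r n"
  shows "pluecker_coords r n (\<lambda>i. coord_vec (f i)) T \<noteq> 0 \<longleftrightarrow> f ` {..r} = T"
proof (cases "f ` {..r} = T")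
  case True
  let ?s = "\<lambda>j. sorted_list_of_set T ! j"
  define M where "M = mat (r + 1) (r + 1) (\<lambda>(i, j). coord_vec (f i) (?s j))"
  have M: "M \<in> carrier_mat (r + 1) (r + 1)" by (simp add: M_def)
  have "card (f ` {..r}) = card {..r}" using T True by (simp add: pluecker_index_def)
  then have inj: "inj_on f {..r}" by (intro eq_card_imp_inj_on) auto
  have bij: "bij_betw ?s {..<r + 1} T"
    using bij_betw_nth[OF pluecker_index_enum(4)[OF T] refl] pluecker_index_enum(2,3)[OF T] by simp
  have "M * transpose_mat M = 1\<^sub>m (r + 1)"
  proof (rule eq_matI)
    fix i k assume "i < dim_row (1\<^sub>m (r + 1))" "k < dim_col (1\<^sub>m (r + 1))"
    then have ik: "i \<le> r" "k \<le> r" by auto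
    have "(M * transpose_mat M) $$ (i, k) = (\<Sum>j<r + 1. coord_vec (f i) (?s j) * coord_vec (f k) (?s j))"
      using ik by (simp add: M_def scalar_prod_def atLeast0LessThan)
    also have "\<dots> = (\<Sum>t\<in>T. coord_vec (f i) t * coord_vec (f k) t)"
      by (rule sum.reindex_bij_betw[OF bij])
    also have "\<dots> = coord_vec (f i) (f i) * coord_vec (f k) (f i)"
      using True ik pluecker_index_enum(1)[OF T] by (intro sum_single) (auto simp: coord_vec_def)
    also have "\<dots> = 1\<^sub>m (r + 1) $$ (i, k)" using ik inj by (auto simp: coord_vec_def inj_on_def)
    finally show "(M * transpose_mat M) $$ (i, k) = 1\<^sub>m (r + 1) $$ (i, k)" .
  qed (simp_all add: M_def)
  then have "Determinant.det M * Determinant.det (transpose_mat M) = 1"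
    using det_mult[OF M, of "transpose_mat M"] M by simp
  then have "Determinant.det M \<noteq> 0" by auto
  then show ?thesis using T True by (simp add: pluecker_coords_def M_def)
next
  case False
  have "card (f ` {..r}) \<le> card T" using card_image_le[of "{..r}" f] T by (simp add: pluecker_index_def)
  then have "\<not> T \<subseteq> f ` {..r}"
    using False card_seteq[of "f ` {..r}" T] by auto
  then obtain t where t: "t \<in> T" "t \<notin> f ` {..r}" by blast
  obtain j where j: "j < r + 1" "sorted_list_of_set T ! j = t"
    using t(1) pluecker_index_enum(2,3)[OF T] by (metis in_set_conv_nth)
  have "(\<Prod>i = 0..<r + 1. coord_vec (f i) (sorted_list_of_set T ! \<pi> i)) = 0"
    if \<pi>: "\<pi> permutes {0..<r + 1}" for \<pi>
  proof -
    have "j \<in> \<pi> ` {0..<r + 1}" using permutes_image[OF \<pi>] j(1) by simp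
    then obtain i where i: "i < r + 1" "\<pi> i = j" by auto
    then have "coord_vec (f i) (sorted_list_of_set T ! \<pi> i) = 0"
      using t(2) j(2) by (auto simp: coord_vec_def)
    then show ?thesis using i(1) by (intro prod_zero) auto
  qed
  then have "pluecker_coords r n (\<lambda>i. coord_vec (f i)) T = 0"
    unfolding pluecker_coords_sum[OF T]
    by (intro sum.neutral ballI) (simp only: mem_Collect_eq mult_zero_right)
  then show ?thesis using False by simp
qed

definition coord_rows :: "nat set \<Rightarrow> nat \<Rightarrow> nat \<Rightarrow> complex" where
  "coord_rows S = (\<lambda>i. coord_vec (sorted_list_of_set S ! i))"

lemma coord_rows_support:
  assumes S: "S \<in> pluecker_index r n" and T: "T \<in> pluecker_index r n"
  shows "pluecker_coords r n (coord_rows S) T \<noteq> 0 \<longleftrightarrow> T = S"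
    and "i \<le> r \<Longrightarrow> pluecker_coords r n ((coord_rows S)(i := coord_vec m)) T \<noteq> 0 \<longleftrightarrow>
      T = insert m (S - {sorted_list_of_set S ! i})"
proof -
  let ?s = "\<lambda>j. sorted_list_of_set S ! j"
  have bij: "bij_betw ?s {..r} S"
    using bij_betw_nth[OF pluecker_index_enum(4)[OF S] refl] pluecker_index_enum(2,3)[OF S]
    by (simp add: lessThan_Suc_atMost)
  then have img: "?s ` {..r} = S" and inj: "inj_on ?s {..r}" by (auto simp: bij_betw_def)
  show "pluecker_coords r n (coord_rows S) T \<noteq> 0 \<longleftrightarrow> T = S"
    unfolding coord_rows_def pluecker_coords_coord_vecs[OF T] img by auto
  assume i: "i \<le> r"
  have eq: "(coord_rows S)(i := coord_vec m) = (\<lambda>k. coord_vec ((?s(i := m)) k))"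
    by (auto simp: coord_rows_def)
  have "?s ` ({..r} - {i}) = S - {?s i}"
    using inj_on_image_set_diff[OF inj, of "{..r}" "{i}"] img i by auto
  then have "(?s(i := m)) ` {..r} = insert m (S - {?s i})"
    using i by (auto simp: fun_upd_image)
  then show "pluecker_coords r n ((coord_rows S)(i := coord_vec m)) T \<noteq> 0 \<longleftrightarrow>
      T = insert m (S - {?s i})"
    unfolding eq pluecker_coords_coord_vecs[OF T] by auto
qed

text \<open>
  The tangent space at a coordinate point \<open>S\<close> is spanned by the coordinate vectors of the sets
  that arise from \<open>S\<close> by exchange of at most one element. If any two of the sets \<open>S p\<close> differ
  in at least three elements, then no coordinate vector occurs twice.
\<close>

lemma coordinate_tangents_independent:
  fixes S :: "nat \<Rightarrow> nat set"
  assumes S: "\<And>p. p < s \<Longrightarrow> S p \<in> pluecker_index r n"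
    and far: "\<And>p q. p < s \<Longrightarrow> q < s \<Longrightarrow> p \<noteq> q \<Longrightarrow> card (S p \<inter> S q) + 2 \<le> r"
    and rel: "\<And>T. T \<in> pluecker_index r n \<Longrightarrow>
      (\<Sum>p<s. c p * pluecker_coords r n (coord_rows (S p)) T +
        (\<Sum>i\<le>r. \<Sum>m\<in>{..n} - S p. x p i m * pluecker_coords r n ((coord_rows (S p))(i := coord_vec m)) T)) = 0"
  shows "\<forall>p<s. c p = 0 \<and> (\<forall>i\<le>r. \<forall>m\<in>{..n} - S p. x p i m = 0)"
proof (intro allI impI conjI ballI)
  let ?s = "\<lambda>p i. sorted_list_of_set (S p) ! i"
  let ?P = "pluecker_coords r n"
  have fin: "finite (S p)" "card (S p) = r + 1" "S p \<subseteq> {..n}" if "p < s" for p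
    using S[OF that] pluecker_index_enum(1)[OF S[OF that]] by (auto simp: pluecker_index_def)
  have mem: "?s p i \<in> S p" if "p < s" "i \<le> r" for p i
    using pluecker_index_enum(5)[OF S[OF that(1)]] that(2) by simp
  have inj: "?s p i = ?s p j \<longleftrightarrow> i = j" if "p < s" "i \<le> r" "j \<le> r" for p i j
    using nth_eq_iff_index_eq[OF pluecker_index_enum(4)[OF S[OF that(1)]]]
      pluecker_index_enum(2)[OF S[OF that(1)]] that by simp
  have exch: "card (insert m (S p - {?s p i})) = r + 1" "insert m (S p - {?s p i}) \<in> pluecker_index r n"
    if "p < s" "i \<le> r" "m \<in> {..n} - S p" for p i m
  proof -
    show "card (insert m (S p - {?s p i})) = r + 1"
      using that fin[OF that(1)] mem[OF that(1,2)] by simp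
    then show "insert m (S p - {?s p i}) \<in> pluecker_index r n"
      using that fin[OF that(1)] by (auto simp: pluecker_index_def)
  qed
  \<comment> \<open>a set of size \<open>r + 1\<close> that is within one exchange of two of the sets forces them to be equal\<close>
  have close: "p = q" if "p < s" "q < s" "card T = r + 1" "T \<subseteq> insert m (S p)" "T \<subseteq> insert m' (S q)"
    for p q T m m'
  proof (rule ccontr)
    assume "p \<noteq> q"
    have "finite T" using that(3) by (metis card.infinite Suc_eq_plus1 nat.distinct(1))
    have "T - {m, m'} \<subseteq> S p \<inter> S q" using that(4,5) by blast
    then have "card (T - {m, m'}) \<le> card (S p \<inter> S q)" using fin(1)[OF that(1)] by (intro card_mono) auto
    moreover have "card T - card {m, m'} \<le> card (T - {m, m'})" by (rule diff_card_le_card_Diff) simp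
    moreover have "card {m, m'} \<le> 2" by (simp add: card_insert_if)
    ultimately show False using far[OF that(1,2) \<open>p \<noteq> q\<close>] that(3) by linarith
  qed
  have other: "?P (coord_rows (S q)) T = 0" "i \<le> r \<Longrightarrow> ?P ((coord_rows (S q))(i := coord_vec m')) T = 0"
    if "p < s" "q < s" "q \<noteq> p" "T \<in> pluecker_index r n" "T \<subseteq> insert m (S p)" for p q T m m' i
  proof -
    have cT: "card T = r + 1" using that(4) by (simp add: pluecker_index_def)
    show "?P (coord_rows (S q)) T = 0"
      using coord_rows_support(1)[OF S[OF that(2)] that(4)] close[OF that(1,2) cT that(5), of m] that(3) by blast
    show "?P ((coord_rows (S q))(i := coord_vec m')) T = 0" if "i \<le> r"
      using coord_rows_support(2)[OF S[OF \<open>q < s\<close>] \<open>T \<in> _\<close> that, of m']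
        close[OF \<open>p < s\<close> \<open>q < s\<close> cT \<open>T \<subseteq> _\<close>, of m'] \<open>q \<noteq> p\<close> by blast
  qed
  have rel1: "c p * ?P (coord_rows (S p)) T +
        (\<Sum>i\<le>r. \<Sum>m\<in>{..n} - S p. x p i m * ?P ((coord_rows (S p))(i := coord_vec m)) T) = 0"
    if "p < s" "T \<in> pluecker_index r n" "T \<subseteq> insert m (S p)" for p T m
    using rel[OF that(2)] other[OF that(1) _ _ that(2,3)] that(1)
    by (subst (asm) sum_single[of _ p]) (auto intro!: sum.neutral)
  fix p assume p: "p < s"
  {
    have T: "S p \<in> pluecker_index r n" using S[OF p] .
    have "?P ((coord_rows (S p))(i := coord_vec m)) (S p) = 0" if "i \<le> r" "m \<in> {..n} - S p" for i m
      using coord_rows_support(2)[OF T T that(1), of m] that(2) by blast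
    then have "c p * ?P (coord_rows (S p)) (S p) = 0"
      using rel1[OF p T, of 0] by (simp add: subset_insertI)
    then show "c p = 0" using coord_rows_support(1)[OF T T] by simp
  }
  fix i m assume i: "i \<le> r" and m: "m \<in> {..n} - S p"
  let ?T = "insert m (S p - {?s p i})"
  have T: "?T \<in> pluecker_index r n" using exch(2)[OF p i m] .
  have "?P (coord_rows (S p)) ?T = 0"
    using coord_rows_support(1)[OF S[OF p] T] m by blast
  moreover have z: "?P ((coord_rows (S p))(j := coord_vec m')) ?T = 0"
    if j: "j \<le> r" "m' \<in> {..n} - S p" "j \<noteq> i \<or> m' \<noteq> m" for j m'
  proof (rule ccontr)
    assume "\<not> ?thesis"
    then have eq: "?T = insert m' (S p - {?s p j})" using coord_rows_support(2)[OF S[OF p] T j(1), of m'] by blast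
    then have "m = m'" using m j(2) by blast
    moreover have "?s p j = ?s p i"
    proof (rule ccontr)
      assume "?s p j \<noteq> ?s p i"
      then have "?s p j \<in> insert m' (S p - {?s p j})" using mem[OF p j(1)] unfolding eq[symmetric] by simp
      then show False using mem[OF p j(1)] j(2) by auto
    qed
    ultimately show False using inj[OF p j(1) i] j(3) by blast
  qed
  moreover have "(\<Sum>i'\<le>r. \<Sum>m'\<in>{..n} - S p. x p i' m' * ?P ((coord_rows (S p))(i' := coord_vec m')) ?T) =
      x p i m * ?P ((coord_rows (S p))(i := coord_vec m)) ?T"
    using i m z by (subst sum_single[of _ i]; (subst sum_single[of _ m])?) (auto intro!: sum.neutral)
  ultimately have "x p i m * ?P ((coord_rows (S p))(i := coord_vec m)) ?T = 0"
    using rel1[OF p T, of m] by auto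
  then show "x p i m = 0" using coord_rows_support(2)[OF S[OF p] T i, of m] by simp
qed

lemma coord_vec_in_coord_space: "m \<le> n \<Longrightarrow> coord_vec m \<in> coord_space {..n}"
  by (auto simp: coord_space_def coord_vec_def)

lemma coord_rows_in_coord_space:
  assumes "S \<in> pluecker_index r n" "i \<le> r" shows "coord_rows S i \<in> coord_space {..n}"
  using pluecker_index_enum(6)[OF assms(1), of i] assms(2)
  by (simp add: coord_rows_def coord_vec_in_coord_space)

lemma card_complement_pluecker_index:
  assumes "S \<in> pluecker_index r n" shows "card ({..n} - S) = n - r"
  using assms pluecker_index_enum(1)[OF assms] by (simp add: pluecker_index_def card_Diff_subset)

lemma pluecker_index_le:
  assumes "S \<in> pluecker_index r n" shows "r \<le> n"
  using assms card_mono[of "{..n}" S] by (simp add: pluecker_index_def)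

lemma not_defective_if_code:
  assumes C: "C \<subseteq> pluecker_index r n" "s \<le> card C" "s > 0"
    and far: "\<And>A B. A \<in> C \<Longrightarrow> B \<in> C \<Longrightarrow> A \<noteq> B \<Longrightarrow> card (A \<inter> B) + 2 \<le> r"
  shows "\<not> defective (pluecker_index r n) (grassmannian r n) s"
proof -
  obtain C' where C': "C' \<subseteq> C" "card C' = s" "finite C'"
    using obtain_subset_with_card_n[OF C(2)] by metis
  obtain S where bij: "bij_betw S {..<s} C'"
    using ex_bij_betw_nat_finite[OF C'(3)] C'(2) by (auto simp: atLeast0LessThan)
  have SC: "S p \<in> C" if "p < s" for p using bij that C'(1) by (auto simp: bij_betw_def)
  then have S: "S p \<in> pluecker_index r n" if "p < s" for p using that C(1) by blast
  have far': "card (S p \<inter> S q) + 2 \<le> r" if "p < s" "q < s" "p \<noteq> q" for p q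
  proof -
    have "S p \<noteq> S q" using that bij by (auto simp: bij_betw_def inj_on_def)
    then show ?thesis using far[OF SC[OF that(1)] SC[OF that(2)]] by simp
  qed
  show ?thesis
  proof (rule not_defective_if_tangents_independent[where u = "\<lambda>p. coord_rows (S p)" and D = "\<lambda>p. {..n} - S p"])
    show "r \<le> n" using pluecker_index_le[OF S[OF C(3)]] .
    show "\<forall>p<s. c p = 0 \<and> (\<forall>i\<le>r. \<forall>m\<in>{..n} - S p. x p i m = 0)"
      if "\<And>T. T \<in> pluecker_index r n \<Longrightarrow>
        (\<Sum>p<s. c p * pluecker_coords r n (coord_rows (S p)) T +
          (\<Sum>i\<le>r. \<Sum>m\<in>{..n} - S p. x p i m * pluecker_coords r n ((coord_rows (S p))(i := coord_vec m)) T)) = 0"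
      for c x
      by (rule coordinate_tangents_independent[OF S far' that])
  qed (use C(3) S in \<open>auto intro: coord_rows_in_coord_space card_complement_pluecker_index\<close>)
qed

section \<open>Codes of minimal distance three\<close>

text \<open>
  A word of length \<open>r + 1\<close> over the alphabet \<open>{..<\<alpha>}\<close> is a choice of one element in each
  of \<open>r + 1\<close> consecutive blocks of length \<open>\<alpha>\<close>.
\<close>

definition word_set :: "nat \<Rightarrow> nat \<Rightarrow> (nat \<Rightarrow> nat) \<Rightarrow> nat set" where
  "word_set \<alpha> r w = (\<lambda>i. i * \<alpha> + w i) ` {..r}"

lemma position_letter_unique:
  fixes a b \<alpha> :: nat
  assumes "i * \<alpha> + a = j * \<alpha> + b" "a < \<alpha>" "b < \<alpha>" shows "i = j" "a = b"
proof -
  have "(i * \<alpha> + a) div \<alpha> = i" "(j * \<alpha> + b) div \<alpha> = j" using assms(2,3) by auto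
  then show "i = j" using assms(1) by simp
  then show "a = b" using assms(1) by simp
qed

lemma word_set_bound:
  assumes "\<And>i. i \<le> r \<Longrightarrow> w i < \<alpha>" "t \<in> word_set \<alpha> r w" shows "t < \<alpha> * (r + 1)"
proof -
  obtain i where i: "i \<le> r" "t = i * \<alpha> + w i" using assms(2) by (auto simp: word_set_def)
  have "t < (i + 1) * \<alpha>" using i assms(1)[OF i(1)] by simp
  also have "\<dots> \<le> (r + 1) * \<alpha>" using i(1) by (intro mult_right_mono) auto
  finally show ?thesis by (simp add: mult.commute)
qed

lemma word_set_in_pluecker_index:
  assumes w: "\<And>i. i \<le> r \<Longrightarrow> w i < \<alpha>" and n: "\<alpha> * (r + 1) \<le> n + 1"
  shows "word_set \<alpha> r w \<in> pluecker_index r n"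
proof -
  have "inj_on (\<lambda>i. i * \<alpha> + w i) {..r}" using w position_letter_unique(1) by (intro inj_onI) auto
  then have "card (word_set \<alpha> r w) = r + 1" by (simp add: word_set_def card_image)
  moreover have "word_set \<alpha> r w \<subseteq> {..n}" using word_set_bound[OF w] n by fastforce
  ultimately show ?thesis by (simp add: pluecker_index_def)
qed

lemma card_word_set_Int_le:
  assumes "\<And>i. i \<le> r \<Longrightarrow> w i < \<alpha>" "\<And>i. i \<le> r \<Longrightarrow> w' i < \<alpha>"
  shows "card (word_set \<alpha> r w \<inter> word_set \<alpha> r w') \<le> card {i. i \<le> r \<and> w i = w' i}"
proof -
  have "word_set \<alpha> r w \<inter> word_set \<alpha> r w' \<subseteq> (\<lambda>i. i * \<alpha> + w i) ` {i. i \<le> r \<and> w i = w' i}"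
  proof
    fix t assume "t \<in> word_set \<alpha> r w \<inter> word_set \<alpha> r w'"
    then obtain i j where ij: "i \<le> r" "t = i * \<alpha> + w i" "j \<le> r" "t = j * \<alpha> + w' j" by (auto simp: word_set_def)
    have "i = j" "w i = w' j" using position_letter_unique[of i \<alpha> "w i" j "w' j"] ij assms by auto
    then show "t \<in> (\<lambda>i. i * \<alpha> + w i) ` {i. i \<le> r \<and> w i = w' i}" using ij by auto
  qed
  then have "card (word_set \<alpha> r w \<inter> word_set \<alpha> r w') \<le> card ((\<lambda>i. i * \<alpha> + w i) ` {i. i \<le> r \<and> w i = w' i})"
    by (intro card_mono) auto
  also have "\<dots> \<le> card {i. i \<le> r \<and> w i = w' i}" by (intro card_image_le) auto
  finally show ?thesis .
qed

text \<open>The sets in \<open>E\<close> serve to exceed the number of words that are available by a few.\<close>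

lemma not_defective_if_words:
  assumes n: "\<alpha> * (r + 1) \<le> n + 1"
    and W: "finite W" "\<And>w i. w \<in> W \<Longrightarrow> i \<le> r \<Longrightarrow> w i < \<alpha>"
      "\<And>w w'. w \<in> W \<Longrightarrow> w' \<in> W \<Longrightarrow> w \<noteq> w' \<Longrightarrow> card {i. i \<le> r \<and> w i = w' i} + 2 \<le> r"
    and E: "finite E" "E \<subseteq> pluecker_index r n"
      "\<And>A B. A \<in> E \<Longrightarrow> B \<in> E \<Longrightarrow> A \<noteq> B \<Longrightarrow> card (A \<inter> B) + 2 \<le> r"
      "\<And>A w. A \<in> E \<Longrightarrow> w \<in> W \<Longrightarrow> card (A \<inter> word_set \<alpha> r w) + 2 \<le> r"
    and s: "s \<le> card W + card E" "s > 0"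
  shows "\<not> defective (pluecker_index r n) (grassmannian r n) s"
proof (rule not_defective_if_code[where C = "word_set \<alpha> r ` W \<union> E"])
  have idx: "word_set \<alpha> r w \<in> pluecker_index r n" if "w \<in> W" for w
    using W(2)[OF that] n by (rule word_set_in_pluecker_index)
  then have card_idx: "card (word_set \<alpha> r w) = r + 1" if "w \<in> W" for w
    using that by (auto simp: pluecker_index_def)
  show "word_set \<alpha> r ` W \<union> E \<subseteq> pluecker_index r n" using idx E(2) by auto
  have far: "card (word_set \<alpha> r w \<inter> word_set \<alpha> r w') + 2 \<le> r" if "w \<in> W" "w' \<in> W" "w \<noteq> w'" for w w'
    using card_word_set_Int_le[of r w \<alpha> w'] W(2)[OF that(1)] W(2)[OF that(2)] W(3)[OF that] by fastforce
  have "inj_on (word_set \<alpha> r) W"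
  proof (rule inj_onI, rule ccontr)
    fix w w' assume ww: "w \<in> W" "w' \<in> W" "word_set \<alpha> r w = word_set \<alpha> r w'" "w \<noteq> w'"
    then show False using far[OF ww(1,2,4)] card_idx[OF ww(1)] by simp
  qed
  moreover have "word_set \<alpha> r ` W \<inter> E = {}"
  proof -
    have "word_set \<alpha> r w \<notin> E" if "w \<in> W" for w
    proof
      assume "word_set \<alpha> r w \<in> E"
      from E(4)[OF this that] show False using card_idx[OF that] by simp
    qed
    then show ?thesis by blast
  qed
  ultimately have "card (word_set \<alpha> r ` W \<union> E) = card W + card E"
    using W(1) E(1) by (simp add: card_Un_disjoint card_image)
  then show "s \<le> card (word_set \<alpha> r ` W \<union> E)" using s(1) by simp
  show "card (A \<inter> B) + 2 \<le> r" if "A \<in> word_set \<alpha> r ` W \<union> E" "B \<in> word_set \<alpha> r ` W \<union> E" "A \<noteq> B" for A B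
    using that far E(3,4) by (auto simp: Int_commute)
qed (rule s(2))

lemma exists_large_fibre:
  assumes A: "finite A" and B: "finite B" "f ` A \<subseteq> B" and card: "card B * N \<le> card A" and "card A > 0"
  obtains y where "y \<in> B" "N \<le> card {x \<in> A. f x = y}"
proof (rule ccontr)
  assume neg: "\<not> thesis"
  have "A = (\<Union>y\<in>B. {x \<in> A. f x = y})" using B(2) by auto
  then have "card A \<le> (\<Sum>y\<in>B. card {x \<in> A. f x = y})" using card_UN_le[OF B(1)] by metis
  also have "\<dots> < (\<Sum>y\<in>B. N)"
  proof (rule sum_strict_mono[OF B(1)])
    show "B \<noteq> {}" using assms(5) B(2) by auto
    fix y assume "y \<in> B"
    show "card {x \<in> A. f x = y} < N"
    proof (rule ccontr)
      assume "\<not> ?thesis"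
      then have "N \<le> card {x \<in> A. f x = y}" by simp
      with neg show False using that[OF \<open>y \<in> B\<close>] by simp
    qed
  qed
  finally show False using card by simp
qed

lemma mod_add_cancel_small:
  fixes a b R \<alpha> :: nat
  assumes "(a + R) mod \<alpha> = (b + R) mod \<alpha>" "a < \<alpha>" "b < \<alpha>" shows "a = b"
proof -
  have *: "a = b" if le: "b \<le> a" and eq: "(a + R) mod \<alpha> = (b + R) mod \<alpha>" and a: "a < \<alpha>" for a b
  proof -
    have "\<alpha> dvd (a + R) - (b + R)" using mod_eq_dvd_iff_nat[of "b + R" "a + R" \<alpha>] le eq by simp
    then have "\<alpha> dvd a - b" by simp
    then show ?thesis using le a by (metis diff_is_0_eq dvd_imp_le le_antisym less_imp_diff_less not_gr_zero not_le)
  qed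
  show ?thesis
  proof (cases "b \<le> a")
    case True
    then show ?thesis using assms(1,2) by (rule *)
  next
    case False
    then have "a \<le> b" by simp
    then show ?thesis using assms(1)[symmetric] assms(3) by (rule *[symmetric])
  qed
qed

text \<open>
  A Hamming code over \<open>{..<\<alpha>}\<close>: position \<open>i\<close> enters the parity check \<open>q\<close> iff the binary digit
  \<open>q\<close> of \<open>i + 1\<close> is 1. If two words with the same \<open>p\<close> parity checks differed in at most two
  positions, then some check would involve exactly one of these positions and detect it. By the
  pigeonhole principle one of the \<open>\<alpha> ^ p\<close> classes has at least \<open>\<alpha> ^ (r + 1 - p)\<close> words.
\<close>

lemma hamming_words:
  assumes \<alpha>: "\<alpha> > 0" and p: "r + 1 < 2 ^ p" "p \<le> r + 1"
  obtains W where "finite W" "\<alpha> ^ (r + 1 - p) \<le> card W"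
    "\<And>w i. w \<in> W \<Longrightarrow> i \<le> r \<Longrightarrow> w i < \<alpha>"
    "\<And>w w'. w \<in> W \<Longrightarrow> w' \<in> W \<Longrightarrow> w \<noteq> w' \<Longrightarrow> card {i. i \<le> r \<and> w i = w' i} + 2 \<le> r"
proof -
  define A where "A = {..r} \<rightarrow>\<^sub>E {..<\<alpha>}"
  define B where "B = {..<p} \<rightarrow>\<^sub>E {..<\<alpha>}"
  define P where "P = (\<lambda>q. {i. i \<le> r \<and> q \<in> set_decode (i + 1)})"
  define \<sigma> where "\<sigma> = (\<lambda>w :: nat \<Rightarrow> nat. \<lambda>q\<in>{..<p}. (\<Sum>i\<in>P q. w i) mod \<alpha>)"
  have finA: "finite A" and finB: "finite B" unfolding A_def B_def by (auto intro: finite_PiE)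
  have cA: "card A = \<alpha> ^ (r + 1)" and cB: "card B = \<alpha> ^ p" by (simp_all add: A_def B_def card_PiE)
  have sub: "\<sigma> ` A \<subseteq> B" 
    unfolding \<sigma>_def B_def using \<alpha> by (intro image_subsetI PiE_I) auto
  have le: "card B * \<alpha> ^ (r + 1 - p) \<le> card A"
    unfolding cA cB using p(2) by (simp add: power_add[symmetric])
  have pos: "card A > 0" using cA \<alpha> by simp
  obtain y where "y \<in> B" and y: "\<alpha> ^ (r + 1 - p) \<le> card {w \<in> A. \<sigma> w = y}"
    by (rule exists_large_fibre[OF finA finB sub le pos])
  let ?W = "{w \<in> A. \<sigma> w = y}"
  have "card {i. i \<le> r \<and> w i = w' i} + 2 \<le> r" if ww: "w \<in> ?W" "w' \<in> ?W" "w \<noteq> w'" for w w'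
  proof (rule ccontr)
    assume "\<not> ?thesis"
    then have agree: "r < card {i. i \<le> r \<and> w i = w' i} + 2" by simp
    define X where "X = {i. i \<le> r \<and> w i \<noteq> w' i}"
    have finX: "finite X" by (simp add: X_def)
    have "{..r} = {i. i \<le> r \<and> w i = w' i} \<union> X" by (auto simp: X_def)
    then have "card {..r} = card {i. i \<le> r \<and> w i = w' i} + card X"
      using card_Un_disjoint[of "{i. i \<le> r \<and> w i = w' i}" X] finX by (auto simp: X_def)
    then have cX: "card X \<le> 2" using agree by simp
    have "X \<noteq> {}"
    proof
      assume "X = {}"
      then have "w i = w' i" if "i \<in> {..r}" for i using that by (auto simp: X_def)
      then have "w = w'" using ww(1,2) unfolding A_def by (intro PiE_ext[of w "{..r}" _ w']) auto
      then show False using ww(3) by simp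
    qed
    have decode_inj: "set_decode (i + 1) \<noteq> set_decode (j + 1)" if "i \<noteq> j" for i j :: nat
      using that by (metis add_right_cancel set_decode_inverse)
    \<comment> \<open>a check that involves exactly one of the positions in which the words differ\<close>
    have "\<exists>d q. d \<in> X \<and> q \<in> set_decode (d + 1) \<and> (\<forall>d'\<in>X. d' \<noteq> d \<longrightarrow> q \<notin> set_decode (d' + 1))"
    proof (cases "card X = 1")
      case True
      then obtain d where d: "X = {d}" using card_1_singletonE by blast
      have "set_decode (d + 1) \<noteq> {}"
        using set_decode_inverse[of "d + 1"] set_encode_empty by (metis add_is_0 one_neq_zero)
      then show ?thesis using d by blast
    next
      case False
      have "card X = 2" using cX False \<open>X \<noteq> {}\<close> finX by (metis One_nat_def Suc_1 card_0_eq le_Suc_eq le_zero_eq)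
      then obtain d e where de: "X = {d, e}" "d \<noteq> e" using card_2_iff by metis
      then show ?thesis using decode_inj[OF de(2)] by auto
    qed
    then obtain d q where d: "d \<in> X" "q \<in> set_decode (d + 1)"
      and only: "\<And>d'. d' \<in> X \<Longrightarrow> d' \<noteq> d \<Longrightarrow> q \<notin> set_decode (d' + 1)" by blast
    have dr: "d \<le> r" using d(1) by (simp add: X_def)
    have "q < p"
    proof (rule ccontr)
      assume "\<not> q < p"
      then have "(2::nat) ^ p \<le> 2 ^ q" by simp
      then have "d + 1 < 2 ^ q" using dr p(1) by linarith
      then have "(d + 1) div 2 ^ q = 0" by (rule div_less)
      then show False using d(2) by (simp add: set_decode_def)
    qed
    have finP: "finite (P q)" "d \<in> P q" using d dr by (simp_all add: P_def)
    have "(\<Sum>i\<in>P q - {d}. w i) = (\<Sum>i\<in>P q - {d}. w' i)"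
      using only by (intro sum.cong) (auto simp: P_def X_def)
    moreover have "(\<Sum>i\<in>P q. w i) mod \<alpha> = (\<Sum>i\<in>P q. w' i) mod \<alpha>"
    proof -
      have "\<sigma> w q = \<sigma> w' q" using ww(1,2) by simp
      then show ?thesis using \<open>q < p\<close> by (simp add: \<sigma>_def)
    qed
    ultimately have "(w d + (\<Sum>i\<in>P q - {d}. w i)) mod \<alpha> = (w' d + (\<Sum>i\<in>P q - {d}. w i)) mod \<alpha>"
      using finP by (simp add: sum.remove)
    moreover have "w d < \<alpha>" "w' d < \<alpha>" using ww(1,2) dr by (auto simp: A_def)
    ultimately have "w d = w' d" by (rule mod_add_cancel_small)
    then show False using d(1) by (simp add: X_def)
  qed
  then show thesis using that[of ?W] finA y by (auto simp: A_def)
qed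

section \<open>Estimates for the function in the bound\<close>

lemma geometric_sum_nat: "(m - 1) * (\<Sum>j<\<mu>. m ^ j) + 1 = m ^ \<mu>" if "m \<ge> 1" for m \<mu> :: nat
proof (induction \<mu>)
  case (Suc \<mu>)
  have "(m - 1) * (\<Sum>j<Suc \<mu>. m ^ j) + 1 = m ^ \<mu> + (m - 1) * m ^ \<mu>"
    using Suc by (simp add: algebra_simps)
  also have "\<dots> = m ^ Suc \<mu>" using that by (cases m) auto
  finally show ?case .
qed simp

text \<open>
  The exponents in the definition are distinct and less than \<open>\<mu>\<close>, so the value is at most a
  geometric sum.
\<close>

lemma h_fun_upper:
  assumes "k + 1 < 2 ^ Suc \<mu>" "m \<ge> 1"
  shows "(m - 1) * h_fun m k + 1 \<le> m ^ \<mu>"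
proof -
  have "h_fun m k \<le> (\<Sum>j<\<mu>. m ^ j)"
  proof (cases "k = 0")
    case False
    have sub: "set_decode (k + 1) - {0} \<subseteq> Suc ` {..<\<mu>}"
    proof
      fix i assume i: "i \<in> set_decode (k + 1) - {0}"
      have "i \<le> \<mu>"
      proof (rule ccontr)
        assume "\<not> i \<le> \<mu>"
        then have "(2::nat) ^ Suc \<mu> \<le> 2 ^ i" by (intro power_increasing) auto
        then have "(k + 1) div 2 ^ i = 0" using assms(1) by simp
        then show False using i by (simp add: set_decode_def)
      qed
      then show "i \<in> Suc ` {..<\<mu>}" using i by (cases i) auto
    qed
    have "h_fun m k = (\<Sum>i\<in>set_decode (k + 1) - {0}. m ^ (i - 1))" using False by (simp add: h_fun_def)
    also have "\<dots> \<le> (\<Sum>i\<in>Suc ` {..<\<mu>}. m ^ (i - 1))" using sub by (intro sum_mono2) auto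
    also have "\<dots> = (\<Sum>j<\<mu>. m ^ j)" by (subst sum.reindex) auto
    finally show ?thesis .
  qed (simp add: h_fun_def)
  then have "(m - 1) * h_fun m k \<le> (m - 1) * (\<Sum>j<\<mu>. m ^ j)" by (rule mult_le_mono2)
  then have "(m - 1) * h_fun m k + 1 \<le> (m - 1) * (\<Sum>j<\<mu>. m ^ j) + 1" by (rule add_right_mono)
  then show ?thesis unfolding geometric_sum_nat[OF assms(2)] .
qed

lemma h_fun_less:
  assumes "k + 1 < 2 ^ Suc \<mu>" "m \<ge> 2"
  shows "h_fun m k + 1 \<le> m ^ \<mu>"
proof -
  have "1 * h_fun m k \<le> (m - 1) * h_fun m k" using assms(2) by (intro mult_right_mono) auto
  then show ?thesis using h_fun_upper[OF assms(1), of m] assms(2) by linarith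
qed

lemma h_fun_small:
  "h_fun m 0 = 0" "h_fun m 1 = 1" "h_fun m 2 = 1" "h_fun m 3 = m" "h_fun m 4 = m"
  "h_fun m 5 = m + 1" "h_fun m 6 = m + 1"
  using h_fun_eq[of 1 "{1}" 0 m] h_fun_eq[of 2 "{1}" 1 m] h_fun_eq[of 3 "{2}" 0 m]
    h_fun_eq[of 4 "{2}" 1 m] h_fun_eq[of 5 "{1, 2}" 0 m] h_fun_eq[of 6 "{1, 2}" 1 m]
  by (simp_all add: h_fun_def)

lemma alpha_bounds:
  fixes r n \<alpha> :: nat
  assumes "\<alpha> = (n + 1) div (r + 1)"
  shows "\<alpha> * (r + 1) \<le> n + 1" "n + 1 \<le> \<alpha> * (r + 1) + r"
    "2 * r + 1 \<le> n \<Longrightarrow> 2 \<le> \<alpha>" "n < r\<^sup>2 + 3 * r + 1 \<Longrightarrow> \<alpha> \<le> r + 1"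
proof -
  have dm: "n + 1 = \<alpha> * (r + 1) + (n + 1) mod (r + 1)"
    unfolding assms by (rule div_mult_mod_eq[symmetric])
  show "\<alpha> * (r + 1) \<le> n + 1" using dm by linarith
  have "(n + 1) mod (r + 1) < r + 1" by simp
  then show "n + 1 \<le> \<alpha> * (r + 1) + r" using dm by linarith
  show "2 \<le> \<alpha>" if "2 * r + 1 \<le> n"
    unfolding assms using that by (subst less_eq_div_iff_mult_less_eq) auto
  show "\<alpha> \<le> r + 1" if "n < r\<^sup>2 + 3 * r + 1"
  proof -
    have "n + 1 < (r + 2) * (r + 1)" using that by (simp add: power2_eq_square algebra_simps)
    then have "\<alpha> < r + 2" unfolding assms by (simp add: less_mult_imp_div_less)
    then show ?thesis by simp
  qed
qed

section \<open>The case of large \<open>r\<close>\<close>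

text \<open>
  With \<open>p\<close> parity checks the exponent that remains for the number of words is \<open>r + 1 - p\<close>. The
  number of points is at most the power of \<open>\<alpha>\<close> with exponent \<open>\<mu> + 1\<close>, or with exponent
  \<open>\<mu> + 2\<close> in the case that is restricted to even \<open>r\<close>. An even \<open>r\<close> admits the larger
  exponent, because \<open>r + 1\<close> is then no power of 2, so that one parity check less suffices.
\<close>

lemma parity_check_number:
  assumes "5 \<le> (r::nat)"
  obtains \<mu> p where "r < 2 ^ Suc \<mu>" "r + 1 < 2 ^ p" "p + \<mu> \<le> r" "even r \<Longrightarrow> p + \<mu> + 1 \<le> r"
proof -
  obtain \<mu> where \<mu>: "2 ^ \<mu> \<le> r" "r < 2 ^ (\<mu> + 1)" using ex_power_ivl1[of 2 r] assms by auto
  have "2 * \<mu> + 2 \<le> r \<or> r = 5 \<and> \<mu> = 2"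
  proof (cases "\<mu> \<le> 2")
    case True
    then have "\<mu> = 0 \<or> \<mu> = 1 \<or> \<mu> = 2" by auto
    then show ?thesis using \<mu> assms by auto
  next
    case False
    then have "3 \<le> \<mu>" by simp
    then have "2 * \<mu> + 2 \<le> (2::nat) ^ \<mu>"
      by (induction \<mu> rule: dec_induct) auto
    then show ?thesis using \<mu>(1) by linarith
  qed
  then show thesis
  proof
    assume big: "2 * \<mu> + 2 \<le> r"
    show thesis
    proof (cases "r + 1 < 2 ^ Suc \<mu>")
      case True
      show thesis by (rule that[of \<mu> "Suc \<mu>"]) (use \<mu>(2) True big in auto)
    next
      case False
      then have eq: "r + 1 = 2 ^ Suc \<mu>" using \<mu>(2) by simp
      then have "odd r" by (metis even_Suc even_mult_iff even_numeral Suc_eq_plus1 power_Suc)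
      then show thesis by (intro that[of \<mu> "Suc (Suc \<mu>)"]) (use \<mu>(2) eq big in auto)
    qed
  next
    assume "r = 5 \<and> \<mu> = 2"
    then show thesis by (intro that[of 2 3]) auto
  qed
qed

lemma not_defective_r_ge_5:
  fixes r n h \<alpha> :: nat
  assumes r: "5 \<le> r" and n: "2 * r + 1 \<le> n" and \<alpha>: "\<alpha> = (n + 1) div (r + 1)"
    and h: "h \<le> \<alpha> * h_fun \<alpha> (r - 1) \<or>
      (n < r\<^sup>2 + 3 * r + 1 \<and> even r \<and> h \<le> (\<alpha> - 1) * h_fun \<alpha> (r - 1) + h_fun \<alpha> (n - 2 - \<alpha> * r)) \<or>
      h \<le> (\<alpha> - 1) * h_fun \<alpha> (r - 2) + h_fun \<alpha> (min (n - 3 - \<alpha> * (r - 1)) (r - 2))"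
  shows "\<not> defective (pluecker_index r n) (grassmannian r n) (h + 1)"
proof -
  obtain \<mu> p where \<mu>: "r < 2 ^ Suc \<mu>" and p: "r + 1 < 2 ^ p" "p + \<mu> \<le> r" "even r \<Longrightarrow> p + \<mu> + 1 \<le> r"
    using parity_check_number[OF r] by metis
  note ab = alpha_bounds[OF \<alpha>]
  have a2: "2 \<le> \<alpha>" using ab(3)[OF n] .
  then have "0 < \<alpha>" by simp
  have "p \<le> r + 1" using p(2) by simp
  obtain W where W: "finite W" "\<alpha> ^ (r + 1 - p) \<le> card W"
    "\<And>w i. w \<in> W \<Longrightarrow> i \<le> r \<Longrightarrow> w i < \<alpha>"
    "\<And>w w'. w \<in> W \<Longrightarrow> w' \<in> W \<Longrightarrow> w \<noteq> w' \<Longrightarrow> card {i. i \<le> r \<and> w i = w' i} + 2 \<le> r"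
    by (rule hamming_words[OF \<open>0 < \<alpha>\<close> p(1) \<open>p \<le> r + 1\<close>]) (rule that)
  have U: "(\<alpha> - 1) * h_fun \<alpha> k + 1 \<le> \<alpha> ^ \<mu>" "h_fun \<alpha> k + 1 \<le> \<alpha> ^ \<mu>" if "k \<le> r - 1" for k
    using h_fun_upper[of k \<mu> \<alpha>] h_fun_less[of k \<mu> \<alpha>] that \<mu> a2 r by auto
  have twice: "2 * \<alpha> ^ k \<le> \<alpha> ^ Suc k" for k using a2 by (simp add: mult_right_mono)
  have pow: "\<alpha> ^ k \<le> \<alpha> ^ (r + 1 - p)" if "k + p \<le> r + 1" for k
    using a2 that by (intro power_increasing) auto
  have "h + 1 \<le> \<alpha> ^ (r + 1 - p)"
    using h
  proof (elim disjE)
    assume "h \<le> \<alpha> * h_fun \<alpha> (r - 1)"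
    also have "\<alpha> * h_fun \<alpha> (r - 1) = (\<alpha> - 1) * h_fun \<alpha> (r - 1) + h_fun \<alpha> (r - 1)" using a2 by (cases \<alpha>) auto
    finally have "h + 1 \<le> \<alpha> ^ Suc \<mu>" using U[of "r - 1"] twice[of \<mu>] by linarith
    also have "\<dots> \<le> \<alpha> ^ (r + 1 - p)" using p(2) by (intro pow) simp
    finally show ?thesis .
  next
    assume "h \<le> (\<alpha> - 1) * h_fun \<alpha> (r - 2) + h_fun \<alpha> (min (n - 3 - \<alpha> * (r - 1)) (r - 2))"
    then have "h + 1 \<le> \<alpha> ^ Suc \<mu>"
      using U(1)[of "r - 2"] U(2)[of "min (n - 3 - \<alpha> * (r - 1)) (r - 2)"] twice[of \<mu>] by linarith
    also have "\<dots> \<le> \<alpha> ^ (r + 1 - p)" using p(2) by (intro pow) simp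
    finally show ?thesis .
  next
    assume *: "n < r\<^sup>2 + 3 * r + 1 \<and> even r \<and> h \<le> (\<alpha> - 1) * h_fun \<alpha> (r - 1) + h_fun \<alpha> (n - 2 - \<alpha> * r)"
    have "n - 2 - \<alpha> * r \<le> 2 * r - 2"
      using ab(2) ab(4) * r by (simp add: algebra_simps)
    then have "n - 2 - \<alpha> * r + 1 < 2 ^ Suc (Suc \<mu>)" using \<mu> r by simp
    then have "h_fun \<alpha> (n - 2 - \<alpha> * r) + 1 \<le> \<alpha> ^ Suc \<mu>" using a2 by (rule h_fun_less)
    then have "h + 1 \<le> \<alpha> ^ Suc (Suc \<mu>)"
      using * U(1)[of "r - 1"] twice[of \<mu>] twice[of "Suc \<mu>"] by linarith
    also have "\<dots> \<le> \<alpha> ^ (r + 1 - p)" using p(3) * by (intro pow) simp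
    finally show ?thesis .
  qed
  then show ?thesis
    using ab(1) W by (intro not_defective_if_words[where W = W and E = "{}" and \<alpha> = \<alpha>]) auto
qed

section \<open>The cases \<open>r = 4\<close> and \<open>r = 3\<close>\<close>

lemma card_agree_4:
  "card {i. i \<le> 4 \<and> P i} = of_bool (P 0) + of_bool (P 1) + of_bool (P 2) + of_bool (P 3) + of_bool (P 4)"
    for P :: "nat \<Rightarrow> bool"
proof -
  have "card {i. i \<le> 4 \<and> P i} = (\<Sum>i\<le>4. of_bool (P i))"
    using sum_of_bool_eq[of "{..4::nat}" P] by (simp add: Collect_conj_eq atMost_def)
  also have "{..4::nat} = {0, 1, 2, 3, 4}" by auto
  finally show ?thesis by (simp add: add.assoc)
qed

lemma card_agree_3:
  "card {i. i \<le> 3 \<and> P i} = of_bool (P 0) + of_bool (P 1) + of_bool (P 2) + of_bool (P 3)"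
    for P :: "nat \<Rightarrow> bool"
proof -
  have "card {i. i \<le> 3 \<and> P i} = (\<Sum>i\<le>3. of_bool (P i))"
    using sum_of_bool_eq[of "{..3::nat}" P] by (simp add: Collect_conj_eq atMost_def)
  also have "{..3::nat} = {0, 1, 2, 3}" by auto
  finally show ?thesis by (simp add: add.assoc)
qed

text \<open>
  Here the bound exceeds the number \<open>\<alpha>\<^sup>2\<close> of words \<open>(x, x, y, y, x + y)\<close> by at most two. The
  word \<open>(0, 1, 0, 1, 3)\<close> supplies one more if \<open>\<alpha> \<ge> 4\<close>, and a set that contains three
  elements outside the blocks another one if there are so many.
\<close>

lemma not_defective_4_words:
  assumes \<alpha>: "2 \<le> \<alpha>" and n: "5 * \<alpha> \<le> n + 1"
    and s: "0 < s" "s \<le> \<alpha>\<^sup>2 + of_bool (4 \<le> \<alpha>) + of_bool (5 * \<alpha> + 2 \<le> n)"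
  shows "\<not> defective (pluecker_index 4 n) (grassmannian 4 n) s"
proof -
  define w where "w = (\<lambda>(x, y) (i :: nat). if i < 2 then x else if i < 4 then y else (x + y) mod \<alpha> :: nat)"
  define t where "t = (\<lambda>i::nat. if i = 4 then 3 else i mod 2)"
  define W0 where "W0 = w ` ({..<\<alpha>} \<times> {..<\<alpha>})"
  define W where "W = W0 \<union> (if 4 \<le> \<alpha> then {t} else {})"
  define E where "E = (if 5 * \<alpha> + 2 \<le> n then {{0, 1, 5 * \<alpha>, 5 * \<alpha> + 1, 5 * \<alpha> + 2}} else {})"
  have finW: "finite W" by (simp add: W_def W0_def)
  have far0: "card {i. i \<le> 4 \<and> w p i = w q i} + 2 \<le> 4"
    if pq: "p \<in> {..<\<alpha>} \<times> {..<\<alpha>}" "q \<in> {..<\<alpha>} \<times> {..<\<alpha>}" "p \<noteq> q" for p q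
  proof -
    obtain x y x' y' where xy: "p = (x, y)" "q = (x', y')" "x < \<alpha>" "y < \<alpha>" "x' < \<alpha>" "y' < \<alpha>" using pq by auto
    have "(x + y) mod \<alpha> \<noteq> (x + y') mod \<alpha>" if "y \<noteq> y'"
      using mod_add_cancel_small[of y x \<alpha> y'] xy that by (auto simp: add.commute)
    moreover have "(x + y) mod \<alpha> \<noteq> (x' + y) mod \<alpha>" if "x \<noteq> x'"
      using mod_add_cancel_small[of x y \<alpha> x'] xy that by auto
    ultimately show ?thesis using pq(3) unfolding card_agree_4 by (auto simp: w_def xy(1,2) of_bool_def)
  qed
  have fart: "card {i. i \<le> 4 \<and> w p i = t i} + 2 \<le> 4" if a4: "4 \<le> \<alpha>" for p
  proof -
    obtain x y where p: "p = (x, y)" by force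
    \<comment> \<open>agreement in three positions would require \<open>x\<close> and \<open>y\<close> to be 0 or 1, and then their sum is not 3\<close>
    have "x \<le> 1 \<Longrightarrow> y \<le> 1 \<Longrightarrow> (x + y) mod \<alpha> \<noteq> 3" using a4 by simp
    then show ?thesis unfolding card_agree_4 by (auto simp: w_def t_def p of_bool_def)
  qed
  have inj: "inj_on w ({..<\<alpha>} \<times> {..<\<alpha>})"
  proof (rule inj_onI, rule ccontr)
    fix p q assume *: "p \<in> {..<\<alpha>} \<times> {..<\<alpha>}" "q \<in> {..<\<alpha>} \<times> {..<\<alpha>}" "w p = w q" "p \<noteq> q"
    show False using far0[OF *(1,2,4)] unfolding *(3) card_agree_4 by simp
  qed
  have tW0: "t \<notin> W0" if "4 \<le> \<alpha>"
  proof
    assume "t \<in> W0"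
    then obtain p where "t = w p" by (auto simp: W0_def)
    then show False using fart[OF that, of p] unfolding card_agree_4 by simp
  qed
  have cW: "card W = \<alpha>\<^sup>2 + of_bool (4 \<le> \<alpha>)"
    using tW0 card_image[OF inj] by (auto simp: W_def W0_def power2_eq_square)
  have letters: "v i < \<alpha>" if v: "v \<in> W" "i \<le> 4" for v i
  proof (cases "v \<in> W0")
    case True
    then show ?thesis using \<alpha> by (auto simp: W0_def w_def)
  next
    case False
    then have a4: "4 \<le> \<alpha>" and vt: "v = t" using v(1) by (auto simp: W_def split: if_splits)
    have "i mod 2 < 2" by simp
    then have "i mod 2 < \<alpha>" using a4 by linarith
    then show ?thesis using a4 by (simp add: t_def vt)
  qed
  show ?thesis
  proof (rule not_defective_if_words[where W = W and E = E and \<alpha> = \<alpha>])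
    show "\<alpha> * (4 + 1) \<le> n + 1" using n by simp
    show "finite W" by (rule finW)
    show "v i < \<alpha>" if "v \<in> W" "i \<le> 4" for v i using letters that .
    show "card {i. i \<le> 4 \<and> v i = v' i} + 2 \<le> 4" if v: "v \<in> W" "v' \<in> W" "v \<noteq> v'" for v v'
    proof -
      have sym: "{i. i \<le> 4 \<and> t i = w p i} = {i. i \<le> 4 \<and> w p i = t i}" for p by auto
      show ?thesis using v far0 fart sym by (auto simp: W_def W0_def split: if_splits)
    qed
    show "finite E" by (simp add: E_def)
    show "E \<subseteq> pluecker_index 4 n" using \<alpha> by (auto simp: E_def pluecker_index_def)
    show "card (A \<inter> B) + 2 \<le> 4" if "A \<in> E" "B \<in> E" "A \<noteq> B" for A B
      using that by (auto simp: E_def split: if_splits)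
    show "card (A \<inter> word_set \<alpha> 4 v) + 2 \<le> 4" if A: "A \<in> E" "v \<in> W" for A v
    proof -
      have "A \<inter> word_set \<alpha> 4 v \<subseteq> {0, 1}"
        using A word_set_bound[of 4 v \<alpha>, OF letters[OF A(2)]] by (fastforce simp: E_def split: if_splits)
      then have "card (A \<inter> word_set \<alpha> 4 v) \<le> card {0::nat, 1}" by (intro card_mono) auto
      then show ?thesis by simp
    qed
    show "s \<le> card W + card E" using s(2) unfolding cW by (auto simp: E_def split: if_splits)
    show "s > 0" by (rule s(1))
  qed
qed

text \<open>
  For \<open>n < 29\<close> the argument \<open>n - 2 - 4 * \<alpha>\<close> is at most 6, and the two additional sets compensate exactly the
  growth of \<open>h_fun\<close>: if it is at least 3 then one of them is available, if it is at least 5 then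
  both are.
\<close>

lemma not_defective_r_4:
  fixes n h \<alpha> :: nat
  assumes n: "9 \<le> n" and \<alpha>: "\<alpha> = (n + 1) div 5"
    and h: "29 \<le> n \<and> h \<le> \<alpha> * h_fun \<alpha> 3 \<or>
      n < 29 \<and> h \<le> (\<alpha> - 1) * h_fun \<alpha> 3 + h_fun \<alpha> (n - 2 - \<alpha> * 4)"
  shows "\<not> defective (pluecker_index 4 n) (grassmannian 4 n) (h + 1)"
proof -
  have ab: "5 * \<alpha> \<le> n + 1" "n + 1 \<le> 5 * \<alpha> + 4" using \<alpha> by auto
  then have a2: "2 \<le> \<alpha>" using n by linarith
  show ?thesis
  proof (rule not_defective_4_words[OF a2 ab(1)])
    show "h + 1 \<le> \<alpha>\<^sup>2 + of_bool (4 \<le> \<alpha>) + of_bool (5 * \<alpha> + 2 \<le> n)"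
      using h
    proof (elim disjE)
      assume "29 \<le> n \<and> h \<le> \<alpha> * h_fun \<alpha> 3"
      moreover from this have "4 \<le> \<alpha>" using ab(2) by linarith
      ultimately show ?thesis by (simp add: h_fun_small power2_eq_square)
    next
      assume *: "n < 29 \<and> h \<le> (\<alpha> - 1) * h_fun \<alpha> 3 + h_fun \<alpha> (n - 2 - \<alpha> * 4)"
      define k where "k = n - 2 - \<alpha> * 4"
      have "\<alpha> \<le> 5" using * ab(1) by linarith
      then have "k \<le> 6" using ab(2) by (simp add: k_def)
      then have "k = 0 \<or> k = 1 \<or> k = 2 \<or> k = 3 \<or> k = 4 \<or> k = 5 \<or> k = 6" by auto
      then have "h_fun \<alpha> k + 1 \<le> \<alpha> + of_bool (4 \<le> \<alpha>) + of_bool (5 * \<alpha> + 2 \<le> n)"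
        using a2 \<open>\<alpha> \<le> 5\<close> ab k_def by (auto simp: h_fun_small[unfolded One_nat_def] of_bool_def)
      moreover have "(\<alpha> - 1) * \<alpha> + \<alpha> = \<alpha>\<^sup>2" using a2 by (cases \<alpha>) (auto simp: power2_eq_square)
      ultimately show ?thesis using * unfolding k_def[symmetric] h_fun_small by linarith
    qed
  qed simp
qed

text \<open>
  The words \<open>(x, x, x, 0)\<close> and the word \<open>(0, 1, 2, 1)\<close> suffice for \<open>\<alpha> \<ge> 3\<close>; for \<open>\<alpha> = 2\<close> the
  additional set uses the first element outside the blocks.
\<close>

lemma not_defective_r_3:
  fixes n h \<alpha> :: nat
  assumes n: "7 \<le> n" and \<alpha>: "\<alpha> = (n + 1) div 4" and h: "h \<le> \<alpha>" "n = 7 \<Longrightarrow> h \<le> 1"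
  shows "\<not> defective (pluecker_index 3 n) (grassmannian 3 n) (h + 1)"
proof -
  have ab: "4 * \<alpha> \<le> n + 1" "n + 1 \<le> 4 * \<alpha> + 3" using \<alpha> by auto
  then have a2: "2 \<le> \<alpha>" using n by linarith
  define w where "w = (\<lambda>x (i :: nat). if i < 3 then x else 0 :: nat)"
  define t where "t = (\<lambda>i::nat. if i = 3 then 1 else i)"
  define W where "W = w ` {..<\<alpha>} \<union> (if 3 \<le> \<alpha> then {t} else {})"
  define E where "E = (if \<alpha> = 2 \<and> 8 \<le> n then {{0, 3, 7, 8}} else {} :: nat set set)"
  have finW: "finite W" by (simp add: W_def)
  have far0: "card {i. i \<le> 3 \<and> w x i = w y i} + 2 \<le> 3" if "w x \<noteq> w y" for x y
  proof -
    have "x \<noteq> y" using that by auto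
    then show ?thesis unfolding card_agree_3 by (simp add: w_def)
  qed
  have fart: "card {i. i \<le> 3 \<and> w x i = t i} + 2 \<le> 3" for x
    unfolding card_agree_3 by (auto simp: w_def t_def of_bool_def)
  have inj: "inj_on w {..<\<alpha>}"
    by (rule inj_onI) (metis w_def zero_less_numeral)
  have "t \<noteq> w x" for x using fart[of x] unfolding card_agree_3 by auto
  then have "t \<notin> w ` {..<\<alpha>}" by auto
  then have cW: "card W = \<alpha> + of_bool (3 \<le> \<alpha>)"
    using card_image[OF inj] by (auto simp: W_def)
  have letters: "v i < \<alpha>" if v: "v \<in> W" "i \<le> 3" for v i
    using v a2 by (auto simp: W_def w_def t_def split: if_splits)
  show ?thesis
  proof (rule not_defective_if_words[where W = W and E = E and \<alpha> = \<alpha>])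
    show "\<alpha> * (3 + 1) \<le> n + 1" using ab(1) by simp
    show "finite W" by (rule finW)
    show "v i < \<alpha>" if "v \<in> W" "i \<le> 3" for v i using letters that .
    show "card {i. i \<le> 3 \<and> v i = v' i} + 2 \<le> 3" if v: "v \<in> W" "v' \<in> W" "v \<noteq> v'" for v v'
    proof -
      have sym: "{i. i \<le> 3 \<and> t i = w x i} = {i. i \<le> 3 \<and> w x i = t i}" for x by auto
      show ?thesis using v far0 fart sym by (auto simp: W_def split: if_splits)
    qed
    show "finite E" by (simp add: E_def)
    show "E \<subseteq> pluecker_index 3 n" by (auto simp: E_def pluecker_index_def)
    show "card (A \<inter> B) + 2 \<le> 3" if "A \<in> E" "B \<in> E" "A \<noteq> B" for A B
      using that by (auto simp: E_def split: if_splits)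
    show "card (A \<inter> word_set \<alpha> 3 v) + 2 \<le> 3" if A: "A \<in> E" "v \<in> W" for A v
    proof -
      have "\<alpha> = 2" and A': "A = {0, 3, 7, 8}" using A(1) by (auto simp: E_def split: if_splits)
      then obtain x where x: "v = w x" "x = 0 \<or> x = 1" using A(2) by (auto simp: W_def less_2_cases_iff)
      have "{..3::nat} = {0, 1, 2, 3}" by auto
      then have "word_set \<alpha> 3 v = {x, 2 + x, 4 + x, 6}"
        unfolding word_set_def \<open>\<alpha> = 2\<close> x(1) by (simp add: w_def)
      then have "A \<inter> word_set \<alpha> 3 v \<subseteq> {3 * x}" using x(2) unfolding A' by (elim disjE) auto
      then have "card (A \<inter> word_set \<alpha> 3 v) \<le> card {3 * x}" by (intro card_mono) auto
      then show ?thesis by simp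
    qed
    show "h + 1 \<le> card W + card E"
      using h n ab a2 unfolding cW by (auto simp: E_def of_bool_def)
  qed simp
qed

section \<open>The case \<open>r = 2\<close>\<close>

definition det3 :: "(nat \<Rightarrow> complex) \<Rightarrow> (nat \<Rightarrow> complex) \<Rightarrow> (nat \<Rightarrow> complex) \<Rightarrow> nat \<Rightarrow> nat \<Rightarrow> nat \<Rightarrow> complex" where
  "det3 f g k a b c = f a * (g b * k c - g c * k b) - f b * (g a * k c - g c * k a) + f c * (g a * k b - g b * k a)"

lemma det_mat_2: "Determinant.det (mat 2 2 F) = F (0, 0) * F (1, 1) - F (0, 1) * F (1, 0)"
  for F :: "nat \<times> nat \<Rightarrow> complex"
proof -
  have "Determinant.det (mat_delete (mat 2 2 F) 0 j) = F (1, 1 - j)" if "j < 2" for j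
  proof -
    have "mat_delete (mat 2 2 F) 0 j = mat 1 1 (\<lambda>_. F (1, 1 - j))"
      using that by (intro eq_matI) (auto simp: mat_delete_def less_2_cases_iff)
    then show ?thesis by (simp add: det_single)
  qed
  then show ?thesis
    using laplace_expansion_row[of "mat 2 2 F" 2 0]
    by (simp add: cofactor_def numeral_2_eq_2)
qed

lemma det_mat_3: "Determinant.det (mat 3 3 F) =
    F (0, 0) * (F (1, 1) * F (2, 2) - F (1, 2) * F (2, 1))
    - F (0, 1) * (F (1, 0) * F (2, 2) - F (1, 2) * F (2, 0))
    + F (0, 2) * (F (1, 0) * F (2, 1) - F (1, 1) * F (2, 0))"
  for F :: "nat \<times> nat \<Rightarrow> complex"
proof -
  have "mat_delete (mat 3 3 F) 0 j = mat 2 2 (\<lambda>(a, b). F (Suc a, if b < j then b else Suc b))" if "j < 3" for j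
    using that by (intro eq_matI) (auto simp: mat_delete_def)
  then have "cofactor (mat 3 3 F) 0 j =
      (-1) ^ j * Determinant.det (mat 2 2 (\<lambda>(a, b). F (Suc a, if b < j then b else Suc b)))" if "j < 3" for j
    using that by (simp add: cofactor_def)
  from this[unfolded det_mat_2] show ?thesis
    using laplace_expansion_row[of "mat 3 3 F" 3 0]
    by (simp add: numeral_3_eq_3 numeral_2_eq_2) (simp add: algebra_simps)
qed

lemma pluecker_coords_3:
  assumes "a < b" "b < c" "c \<le> n"
  shows "pluecker_coords 2 n u {a, b, c} = det3 (u 0) (u 1) (u 2) a b c"
proof -
  have "sorted_list_of_set {a, b, c} = [a, b, c]"
    using assms by (intro sorted_distinct_set_unique) auto
  moreover have "{a, b, c} \<in> pluecker_index 2 n"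
    using assms by (simp add: pluecker_index_def)
  ultimately show ?thesis
    using det_mat_3[of "\<lambda>(i, j). u i ([a, b, c] ! j)"]
    by (simp add: pluecker_coords_def det3_def numeral_3_eq_3[symmetric])
qed

lemma det3_swap: "det3 f g k b a c = - det3 f g k a b c" "det3 f g k a c b = - det3 f g k a b c"
  by (simp_all add: det3_def algebra_simps)

definition residue_rows :: "nat \<Rightarrow> nat \<Rightarrow> nat \<Rightarrow> complex" where
  "residue_rows n i m = (if m \<le> n \<and> m mod 3 = i then 1 else 0)"

text \<open>
  Columns that may occur together in a coordinate that vanishes on the tangent spaces at all
  coordinate points \<open>{3 p, 3 p + 1, 3 p + 2}\<close> with \<open>p < \<alpha>\<close>; the columns from \<open>3 * \<alpha>\<close> on
  belong to none of these triples.
\<close>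

definition sep :: "nat \<Rightarrow> nat \<Rightarrow> nat \<Rightarrow> bool" where
  "sep \<alpha> a b \<longleftrightarrow> a \<noteq> b \<and> (a div 3 \<noteq> b div 3 \<or> 3 * \<alpha> \<le> a)"

lemma sep_sym: "sep \<alpha> a b \<Longrightarrow> sep \<alpha> b a"
proof -
  assume *: "sep \<alpha> a b"
  have "3 * \<alpha> \<le> b" if "a div 3 = b div 3" "3 * \<alpha> \<le> a"
  proof -
    have "\<alpha> \<le> a div 3" using that(2) by linarith
    then show ?thesis unfolding that(1) by linarith
  qed
  then show ?thesis using * by (auto simp: sep_def)
qed

lemma permutation_of_residues:
  fixes i j k :: nat
  assumes "i < 3" "j < 3" "k < 3" "i \<noteq> j" "i \<noteq> k" "j \<noteq> k"
  obtains "i = 0" "j = 1" "k = 2" | "i = 0" "j = 2" "k = 1" | "i = 1" "j = 0" "k = 2"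
    | "i = 1" "j = 2" "k = 0" | "i = 2" "j = 0" "k = 1" | "i = 2" "j = 1" "k = 0"
proof -
  have "i = 0 \<or> i = 1 \<or> i = 2" "j = 0 \<or> j = 1 \<or> j = 2" "k = 0 \<or> k = 1 \<or> k = 2"
    using assms(1-3) by auto
  then show thesis using assms(4-6) that by (elim disjE) simp_all
qed

text \<open>
  A tangent vector at the point with rows \<open>residue_rows\<close> is given by the directions \<open>X i\<close> in which
  the rows move and by the multiple \<open>C\<close> of the point itself; the triple \<open>{0, 1, 2}\<close> serves as the
  block that remains fixed. If two of the columns lie in the same residue class, the determinants
  reduce to the difference of two values of the row that belongs to neither residue class involved,
  so off its own residue class each row is constant on classes, hence zero. For columns in three
  different classes one obtains \<open>C\<close> plus the values of the three rows at their own columns. If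
  there are enough triples, exchange of one column shows that these values vanish as well; with
  two or three triples one uses the remaining columns, which may be combined with all others.
\<close>

lemma residue_tangent_trivial:
  fixes X :: "nat \<Rightarrow> nat \<Rightarrow> complex"
  assumes n: "7 \<le> n" "n \<noteq> 8" and \<alpha>: "\<alpha> = (n + 1) div 3"
    and X0: "\<And>i m. m < 3 \<Longrightarrow> X i m = 0"
    and rel: "\<And>a b c. a \<le> n \<Longrightarrow> b \<le> n \<Longrightarrow> c \<le> n \<Longrightarrow> sep \<alpha> a b \<Longrightarrow> sep \<alpha> a c \<Longrightarrow> sep \<alpha> b c \<Longrightarrow>
      C * det3 (residue_rows n 0) (residue_rows n 1) (residue_rows n 2) a b c
      + det3 (X 0) (residue_rows n 1) (residue_rows n 2) a b c
      + det3 (residue_rows n 0) (X 1) (residue_rows n 2) a b c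
      + det3 (residue_rows n 0) (residue_rows n 1) (X 2) a b c = 0"
  shows "C = 0" and "\<And>i m. i < 3 \<Longrightarrow> m \<le> n \<Longrightarrow> X i m = 0"
proof -
  have res: "residue_rows n i m = (if m mod 3 = i then 1 else 0)" if "m \<le> n" for i m
    using that by (simp add: residue_rows_def)
  have m3: "m mod 3 = 0 \<or> m mod 3 = 1 \<or> m mod 3 = 2" for m :: nat by auto
  have two: "m mod 3 = i \<and> m' mod 3 = i \<and> e mod 3 = k \<Longrightarrow> i \<noteq> k \<Longrightarrow> l < 3 \<Longrightarrow> l \<noteq> i \<Longrightarrow> l \<noteq> k \<Longrightarrow> X l m = X l m'"
    if "m \<le> n" "m' \<le> n" "e \<le> n" "sep \<alpha> m m'" "sep \<alpha> m e" "sep \<alpha> m' e" for m m' e i k l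
  proof -
    assume *: "m mod 3 = i \<and> m' mod 3 = i \<and> e mod 3 = k" "i \<noteq> k" "l < 3" "l \<noteq> i" "l \<noteq> k"
    have "i < 3" "k < 3" using * by auto
    note E = rel[OF that, unfolded det3_def res[OF that(1)] res[OF that(2)] res[OF that(3)]]
    show ?thesis
    proof (rule permutation_of_residues[OF \<open>i < 3\<close> \<open>k < 3\<close> \<open>l < 3\<close> \<open>i \<noteq> k\<close>])
      show "i \<noteq> l" "k \<noteq> l" using *(4,5) by auto
    qed (use E *(1) in simp_all)
  qed
  have three: "C + X (a mod 3) a + X (b mod 3) b + X (e mod 3) e = 0"
    if "a \<le> n" "b \<le> n" "e \<le> n" "sep \<alpha> a b" "sep \<alpha> a e" "sep \<alpha> b e"
      "a mod 3 \<noteq> b mod 3" "a mod 3 \<noteq> e mod 3" "b mod 3 \<noteq> e mod 3" for a b e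
  proof -
    note E = rel[OF that(1-6), unfolded det3_def res[OF that(1)] res[OF that(2)] res[OF that(3)]]
    show ?thesis
    proof (rule permutation_of_residues[OF _ _ _ that(7-9)])
      show "a mod 3 < 3" "b mod 3 < 3" "e mod 3 < 3" by auto
    qed (use E in \<open>simp_all add: algebra_simps neg_eq_iff_add_eq_0\<close>)
  qed
  have ab: "3 * \<alpha> \<le> n + 1" "n \<le> 3 * \<alpha> + 1" using \<alpha> by auto
  have a2: "2 \<le> \<alpha>" using ab n by linarith
  have sepI: "sep \<alpha> a b" if "a div 3 \<noteq> b div 3" for a b using that by (auto simp: sep_def)
  have mod3: "(3 * b + k) mod 3 = k" "(3 * b + k) div 3 = b" if "k < 3" for b k :: nat using that by auto
  have off0: "X l m = 0" if m: "m \<le> n" "3 \<le> m" and l: "l < 3" "l \<noteq> m mod 3"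
      and k: "k < 3" "k \<noteq> l" "k \<noteq> m mod 3" and b: "b \<noteq> 0" "b \<noteq> m div 3" "3 * b + k \<le> n" for m l k b
  proof -
    have d: "m mod 3 div 3 = 0" "m div 3 \<noteq> 0" using m(2) by auto
    have "X l m = X l (m mod 3)"
    proof (rule two[of m "m mod 3" "3 * b + k" "m mod 3" k])
      show "m mod 3 \<le> n" using m(1) mod_less_eq_dividend order_trans by blast
      show "sep \<alpha> m (m mod 3)" "sep \<alpha> m (3 * b + k)" "sep \<alpha> (m mod 3) (3 * b + k)"
        using d b mod3[OF k(1)] by (auto intro!: sepI)
    qed (use m l k b mod3[OF k(1)] in auto)
    also have "\<dots> = 0" by (rule X0) simp
    finally show ?thesis .
  qed
  have off: "X l m = 0" if m: "m \<le> n" and l: "l < 3" "l \<noteq> m mod 3" for m l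
  proof (cases "m < 3")
    case False
    then have m': "3 \<le> m" by simp
    have "l = 0 \<or> l = 1 \<or> l = 2" using l(1) by auto
    then have "\<exists>k\<in>{0, 1, 2}. k \<noteq> l \<and> k \<noteq> m mod 3" using m3[of m] by (elim disjE) auto
    then obtain k where "k \<in> {0, 1, 2}" and k': "k \<noteq> l" "k \<noteq> m mod 3" by (elim bexE conjE)
    then have k: "k < 3" "k \<noteq> l" "k \<noteq> m mod 3" by auto
    show ?thesis
    proof (cases "3 \<le> \<alpha>")
      case True
      define b where "b = (if m div 3 = 1 then 2 else 1::nat)"
      have "b \<noteq> 0" "b \<noteq> m div 3" "3 * b + k \<le> n" using True ab k(1) by (auto simp: b_def)
      then show ?thesis by (rule off0[OF m m' l k])
    next
      case False
      then have n7: "n = 7" and a: "\<alpha> = 2" using ab a2 n by auto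
      show ?thesis
      proof (cases "m div 3 = 1 \<and> k = 2")
        case False
        define b where "b = (if m div 3 = 1 then 2 else 1::nat)"
        have "b \<noteq> 0" "b \<noteq> m div 3" "3 * b + k \<le> n" using False n7 k(1) by (auto simp: b_def)
        then show ?thesis by (rule off0[OF m m' l k])
      next
        case True
        \<comment> \<open>the third column must then lie in the first triple, so the comparison is with \<open>m + 3\<close> first\<close>
        have mm: "m + 3 \<le> n" "(m + 3) mod 3 = m mod 3" "(m + 3) div 3 = 2"
        proof -
          have "m mod 3 \<le> 1" using True k(3) m3[of m] by auto
          moreover have "m = 3 * (m div 3) + m mod 3" by simp
          ultimately show "m + 3 \<le> n" using True n7 by linarith
        qed (use True in auto)
        have "X l m = X l (m + 3)"
        proof (rule two[of m "m + 3" 2 "m mod 3" 2])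
          show "sep \<alpha> m (m + 3)" "sep \<alpha> m 2" "sep \<alpha> (m + 3) 2" using True mm by (auto intro!: sepI)
        qed (use True m mm n7 l k in auto)
        also have "\<dots> = 0"
        proof (rule off0[of "m + 3" l k 1])
          show "l \<noteq> (m + 3) mod 3" "k \<noteq> (m + 3) mod 3" using mm l k by auto
        qed (use True mm l k n7 in auto)
        finally show ?thesis .
      qed
    qed
  qed (rule X0)
  define d where "d = (\<lambda>m. X (m mod 3) m)"
  have d0: "d 0 = 0" "d 1 = 0" "d 2 = 0" by (auto simp: d_def intro: X0)
  have tri: "C + d a + d b + d e = 0"
    if "a \<le> n" "b \<le> n" "e \<le> n" "a div 3 \<noteq> b div 3" "a div 3 \<noteq> e div 3" "b div 3 \<noteq> e div 3"
      "a mod 3 \<noteq> b mod 3" "a mod 3 \<noteq> e mod 3" "b mod 3 \<noteq> e mod 3" for a b e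
    using three[of a b e] sepI that unfolding d_def by blast
  have diag: "C = 0 \<and> (\<forall>m\<le>n. d m = 0)"
  proof -
    consider "4 \<le> \<alpha>" | "\<alpha> = 3" "n = 9 \<or> n = 10" | "\<alpha> = 2" "n = 7" using ab a2 n by linarith
    then show ?thesis
    proof cases
      case 1
      then have n11: "11 \<le> n" using ab by linarith
      have dm: "d m = 0" if m: "m \<le> n" for m
      proof (cases "m < 3")
        case True
        then have "m = 0 \<or> m = 1 \<or> m = 2" by auto
        then show ?thesis using d0 by auto
      next
        case False
        then have "m div 3 \<noteq> 0" by auto
        obtain b b' :: nat where b: "b \<noteq> 0" "b' \<noteq> 0" "b \<noteq> b'" "b \<noteq> m div 3" "b' \<noteq> m div 3" "b \<le> 3" "b' \<le> 3"
        proof (cases "m div 3 = 1")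
          case True
          then show thesis by (intro that[of 2 3]) auto
        next
          case False
          then show thesis by (cases "m div 3 = 2") (rule that[of 1 3] that[of 1 2]; auto)+
        qed
        obtain j k :: nat where jk: "j < 3" "k < 3" "j \<noteq> k" "j \<noteq> m mod 3" "k \<noteq> m mod 3"
          using m3[of m] by (elim disjE) (rule that[of 1 2] that[of 0 2] that[of 0 1]; simp)+
        have le: "3 * b + j \<le> n" "3 * b' + k \<le> n" using b jk n11 by auto
        have "m mod 3 \<le> n" using m mod_less_eq_dividend order_trans by blast
        then have e1: "C + d (m mod 3) + d (3 * b + j) + d (3 * b' + k) = 0"
          using le b jk mod3[OF jk(1)] mod3[OF jk(2)] by (intro tri) auto
        have e2: "C + d m + d (3 * b + j) + d (3 * b' + k) = 0"
          using le m b jk mod3[OF jk(1)] mod3[OF jk(2)] by (intro tri) auto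
        have "d (m mod 3) = 0" using m3[of m] d0 by auto
        then show ?thesis using trans[OF e1 e2[symmetric]] by simp
      qed
      moreover have "C + d 0 + d 4 + d 8 = 0" using n11 by (intro tri) auto
      ultimately show ?thesis using n11 by auto
    next
      case 2
      have n9: "9 \<le> n" using 2 by auto
      have t: "C + d 0 + d 4 + d 8 = 0" "C + d 9 + d 4 + d 8 = 0" "C + d 3 + d 1 + d 8 = 0"
        "C + d 9 + d 1 + d 8 = 0" "C + d 6 + d 1 + d 5 = 0" "C + d 9 + d 1 + d 5 = 0"
        "C + d 9 + d 4 + d 2 = 0" "C + d 9 + d 7 + d 2 = 0"
        using n9 by (intro tri; simp)+
      have d9: "d 9 = 0" using trans[OF t(1) t(2)[symmetric]] d0 by simp
      have "d 3 = 0" using trans[OF t(3) t(4)[symmetric]] d9 by simp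
      moreover have "d 6 = 0" using trans[OF t(5) t(6)[symmetric]] d9 by simp
      moreover have C4: "C + d 4 = 0" using t(7) d9 d0 by simp
      moreover have d8: "d 8 = 0" using t(1) C4 d0 by simp
      moreover have C: "C = 0" using t(4) d8 d9 d0 by simp
      ultimately have e: "C = 0" "d 3 = 0" "d 4 = 0" "d 5 = 0" "d 6 = 0" "d 7 = 0" "d 8 = 0" "d 9 = 0"
        using t(6,8) d9 d0 by simp_all
      have "d 10 = 0" if "10 \<le> n"
      proof -
        have "sep \<alpha> 9 10" "sep \<alpha> 9 2" "sep \<alpha> 10 2" using 2(1) by (auto simp: sep_def)
        then have "C + d 9 + d 10 + d 2 = 0" using three[of 9 10 2] that by (simp add: d_def)
        then show ?thesis using e d0 by simp
      qed
      moreover have "m \<in> {0, 1, 2, 3, 4, 5, 6, 7, 8, 9, 10}" if "m \<le> n" for m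
      proof -
        have "m \<le> 10" using that 2 by auto
        then have "m \<in> {..<11}" by simp
        then show ?thesis by (simp only: lessThan_nat_numeral pred_numeral_simps arith_simps lessThan_0) auto
      qed
      ultimately show ?thesis using e d0 by blast
    next
      case 3
      have "sep \<alpha> 6 7" "sep \<alpha> 6 2" "sep \<alpha> 7 2" "sep \<alpha> 6 5" "sep \<alpha> 7 5" using 3(1) by (auto simp: sep_def)
      then have t: "C + d 6 + d 7 + d 2 = 0" "C + d 6 + d 7 + d 5 = 0"
        using three[of 6 7 2] three[of 6 7 5] 3(2) by (simp_all add: d_def)
      have t': "C + d 6 + d 1 + d 5 = 0" "C + d 6 + d 4 + d 2 = 0" "C + d 0 + d 7 + d 5 = 0" "C + d 3 + d 7 + d 2 = 0"
        using 3(2) by (intro tri; simp)+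
      have d5: "d 5 = 0" using trans[OF t(1) t(2)[symmetric]] d0 by simp
      have C6: "C + d 6 = 0" using t'(1) d5 d0 by simp
      have d4: "d 4 = 0" using t'(2) C6 d0 by simp
      have d7: "d 7 = 0" using t(1) C6 d0 by simp
      have C: "C = 0" using t'(3) d7 d5 d0 by simp
      have "d 6 = 0" "d 3 = 0" using C C6 t'(4) d7 d0 by simp_all
      then have e: "C = 0" "d 3 = 0" "d 4 = 0" "d 5 = 0" "d 6 = 0" "d 7 = 0"
        using C d4 d5 d7 by simp_all
      moreover have "m \<in> {0, 1, 2, 3, 4, 5, 6, 7}" if "m \<le> n" for m using that 3 by (auto simp: numeral_eq_Suc le_Suc_eq)
      ultimately show ?thesis using d0 by blast
    qed
  qed
  show "C = 0" using diag by simp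
  show "X i m = 0" if "i < 3" "m \<le> n" for i m
    using off[OF that(2,1)] diag that(2) by (cases "i = m mod 3") (auto simp: d_def)
qed

lemma card_Int_if_tangent_coordinate:
  assumes S: "S \<in> pluecker_index r n" and T: "T \<in> pluecker_index r n"
    and nz: "pluecker_coords r n (coord_rows S) T \<noteq> 0 \<or>
      (\<exists>i\<le>r. \<exists>m. pluecker_coords r n ((coord_rows S)(i := coord_vec m)) T \<noteq> 0)"
  shows "r \<le> card (T \<inter> S)"
proof -
  have S': "finite S" "card S = r + 1" using S pluecker_index_enum(1)[OF S] by (auto simp: pluecker_index_def)
  have "\<exists>t. S - {t} \<subseteq> T"
    using nz coord_rows_support[OF S T] by blast
  then obtain t where "S - {t} \<subseteq> T \<inter> S" by blast
  then have "card (S - {t}) \<le> card (T \<inter> S)" using S'(1) by (intro card_mono) auto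
  moreover have "r \<le> card (S - {t})" using diff_card_le_card_Diff[of "{t}" S] S' by simp
  ultimately show ?thesis by simp
qed

text \<open>
  In the coordinates of sets with pairwise separated elements the tangent vectors at the coordinate
  points vanish, so the tangent vector at the additional point is zero; what is left is the
  independence of the tangent spaces at coordinate points.
\<close>

lemma not_defective_2_extra_point:
  fixes n \<alpha> :: nat
  assumes n: "7 \<le> n" "n \<noteq> 8" and \<alpha>: "\<alpha> = (n + 1) div 3"
  shows "\<not> defective (pluecker_index 2 n) (grassmannian 2 n) (\<alpha> + 1)"
proof -
  define S where "S = (\<lambda>p. {3 * p, 3 * p + 1, 3 * p + 2 :: nat})"
  let ?P = "pluecker_coords 2 n" and ?I = "pluecker_index 2 n"
  have ab: "3 * \<alpha> \<le> n + 1" using \<alpha> by auto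
  have S: "S p \<in> ?I" if "p < \<alpha>" for p
    using that ab by (auto simp: S_def pluecker_index_def)
  have S_div: "x div 3 = p" if "x \<in> S p" for x p using that by (auto simp: S_def)
  have far: "card (S p \<inter> S q) + 2 \<le> 2" if "p < \<alpha>" "q < \<alpha>" "p \<noteq> q" for p q
  proof -
    have "S p \<inter> S q = {}" using S_div that(3) by (metis disjoint_iff)
    then show ?thesis by simp
  qed
  define u where "u = (\<lambda>p. if p < \<alpha> then coord_rows (S p) else residue_rows n)"
  define D where "D = (\<lambda>p. {..n} - S (if p < \<alpha> then p else 0))"
  have S0: "S 0 \<in> ?I" using n(1) by (auto simp: S_def pluecker_index_def)
  show ?thesis
  proof (rule not_defective_if_tangents_independent[where u = u and D = D])
    show "\<alpha> + 1 > 0" "2 \<le> n" using n by auto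
    show "u p i \<in> coord_space {..n}" if "p < \<alpha> + 1" "i \<le> 2" for p i
      using coord_rows_in_coord_space[OF S that(2)] by (auto simp: u_def residue_rows_def coord_space_def)
    show "D p \<subseteq> {..n}" for p by (auto simp: D_def)
    show "card (D p) = n - 2" for p
      using card_complement_pluecker_index[OF S] card_complement_pluecker_index[OF S0] by (simp add: D_def)
  next
    fix c and x :: "nat \<Rightarrow> nat \<Rightarrow> nat \<Rightarrow> complex"
    assume rel: "\<And>T. T \<in> ?I \<Longrightarrow> (\<Sum>p<\<alpha> + 1. c p * ?P (u p) T +
      (\<Sum>i\<le>2. \<Sum>m\<in>D p. x p i m * ?P ((u p)(i := coord_vec m)) T)) = 0"
    define X where "X = (\<lambda>i m. if m \<in> D \<alpha> then x \<alpha> i m else 0)"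
    let ?R = "residue_rows n"
    define G where "G = (\<lambda>T. c \<alpha> * ?P ?R T + (\<Sum>i\<le>2. \<Sum>m\<in>D \<alpha>. x \<alpha> i m * ?P (?R(i := coord_vec m)) T))"
    have rel': "(\<Sum>p<\<alpha>. c p * ?P (coord_rows (S p)) T +
        (\<Sum>i\<le>2. \<Sum>m\<in>{..n} - S p. x p i m * ?P ((coord_rows (S p))(i := coord_vec m)) T)) + G T = 0"
      if "T \<in> ?I" for T
      using rel[OF that] by (simp add: u_def D_def G_def)
    have G_row: "G T = c \<alpha> * ?P ?R T + ?P (?R(0 := X 0)) T + ?P (?R(1 := X 1)) T + ?P (?R(2 := X 2)) T" for T
    proof -
      have "(\<Sum>m\<in>D \<alpha>. x \<alpha> i m * ?P (?R(i := coord_vec m)) T) = ?P (?R(i := X i)) T" if "i \<le> 2" for i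
      proof -
        have "?P (?R(i := X i)) T = (\<Sum>m\<in>D \<alpha>. X i m * ?P (?R(i := coord_vec m)) T)"
          using that by (intro pluecker_coords_row_linear) (auto simp: D_def X_def)
        then show ?thesis by (simp add: X_def)
      qed
      then have "G T = c \<alpha> * ?P ?R T + (\<Sum>i\<le>2. ?P (?R(i := X i)) T)" by (simp add: G_def)
      moreover have "(\<Sum>i\<le>2. F i) = F 0 + F 1 + F 2" for F :: "nat \<Rightarrow> complex"
        by (simp add: numeral_2_eq_2)
      ultimately show ?thesis by (simp only: add.assoc)
    qed
    have G0: "G T = 0" if T: "T \<in> ?I" "\<And>a b. a \<in> T \<Longrightarrow> b \<in> T \<Longrightarrow> a \<noteq> b \<Longrightarrow> sep \<alpha> a b" for T
    proof -
      have small: "\<not> 2 \<le> card (T \<inter> S p)" if p: "p < \<alpha>" for p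
      proof -
        have "a = b" if "a \<in> T \<inter> S p" "b \<in> T \<inter> S p" for a b
        proof (rule ccontr)
          assume "a \<noteq> b"
          then have "sep \<alpha> a b" using T(2) that by blast
          moreover have "a div 3 = p" "b div 3 = p" using that S_div by auto
          ultimately have "3 * \<alpha> \<le> a" by (simp add: sep_def)
          then show False using \<open>a div 3 = p\<close> p by linarith
        qed
        then have "card (T \<inter> S p) \<le> Suc 0"
          using pluecker_index_enum(1)[OF T(1)] by (subst card_le_Suc0_iff_eq) auto
        then show ?thesis by simp
      qed
      have "?P (coord_rows (S p)) T = 0" "i \<le> 2 \<Longrightarrow> ?P ((coord_rows (S p))(i := coord_vec m)) T = 0"
        if "p < \<alpha>" for p i m
        using card_Int_if_tangent_coordinate[OF S[OF that] T(1)] small[OF that] by blast+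
      then show ?thesis using rel'[OF T(1)] by simp
    qed
    have trivial: "c \<alpha> = 0" "\<And>i m. i < 3 \<Longrightarrow> m \<le> n \<Longrightarrow> X i m = 0"
    proof -
      have X0: "X i m = 0" if "m < 3" for i m
      proof -
        have "m = 0 \<or> m = 1 \<or> m = 2" using that by auto
        then show ?thesis by (auto simp: X_def D_def S_def)
      qed
      define g where "g = (\<lambda>a b e. c \<alpha> * det3 (?R 0) (?R 1) (?R 2) a b e + det3 (X 0) (?R 1) (?R 2) a b e +
        det3 (?R 0) (X 1) (?R 2) a b e + det3 (?R 0) (?R 1) (X 2) a b e)"
      have sw: "g b a e = - g a b e" "g a e b = - g a b e" for a b e
        unfolding g_def det3_swap(1)[of _ _ _ b a e] det3_swap(2)[of _ _ _ a e b] by simp_all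
      have sorted: "g a b e = 0" if "a < b" "b < e" "e \<le> n" "sep \<alpha> a b" "sep \<alpha> a e" "sep \<alpha> b e" for a b e
      proof -
        have "G {a, b, e} = 0"
          using that sep_sym by (intro G0) (auto simp: pluecker_index_def)
        then show ?thesis
          unfolding G_row using that by (simp add: pluecker_coords_3 g_def)
      qed
      have all: "g a b e = 0" if le: "a \<le> n" "b \<le> n" "e \<le> n" and s: "sep \<alpha> a b" "sep \<alpha> a e" "sep \<alpha> b e" for a b e
      proof -
        note s' = s s[THEN sep_sym]
        have "a \<noteq> b" "a \<noteq> e" "b \<noteq> e" using s by (auto simp: sep_def)
        then consider "a < b" "b < e" | "a < e" "e < b" | "b < a" "a < e" | "b < e" "e < a" | "e < a" "a < b" | "e < b" "b < a"
          by linarith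
        then show ?thesis
        proof cases
          case 1 then show ?thesis using sorted le s' by simp
        next
          case 2 then show ?thesis using sorted[of a e b] le s' sw(2)[of a e b] by simp
        next
          case 3 then show ?thesis using sorted[of b a e] le s' sw(1)[of a b e] by simp
        next
          case 4 then show ?thesis using sorted[of b e a] le s' sw(2)[of b e a] sw(1)[of a b e] by simp
        next
          case 5 then show ?thesis using sorted[of e a b] le s' sw(1)[of e a b] sw(2)[of a b e] by simp
        next
          case 6
          then show ?thesis using sorted[of e b a] le s' sw(1)[of e b a] sw(2)[of b e a] sw(1)[of a b e] by simp
        qed
      qed
      show "c \<alpha> = 0" using residue_tangent_trivial(1)[OF n \<alpha> X0 all[unfolded g_def]] .
      show "X i m = 0" if "i < 3" "m \<le> n" for i m
        using residue_tangent_trivial(2)[OF n \<alpha> X0 all[unfolded g_def] that] .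
    qed
    have xa: "x \<alpha> i m = 0" if "i \<le> 2" "m \<in> D \<alpha>" for i m
      using trivial(2)[of i m] that by (auto simp: X_def D_def)
    then have "G T = 0" for T using trivial(1) by (simp add: G_def)
    then have "\<forall>p<\<alpha>. c p = 0 \<and> (\<forall>i\<le>2. \<forall>m\<in>{..n} - S p. x p i m = 0)"
      using rel' by (intro coordinate_tangents_independent[OF S far]) auto
    then show "\<forall>p<\<alpha> + 1. c p = 0 \<and> (\<forall>i\<le>2. \<forall>m\<in>D p. x p i m = 0)"
      using trivial(1) xa by (auto simp: less_Suc_eq D_def)
  qed
qed

text \<open>For \<open>h < \<alpha>\<close> the disjoint triples, the constant words, are enough.\<close>

lemma not_defective_r_2:
  fixes n h \<alpha> :: nat
  assumes n: "5 \<le> n" and \<alpha>: "\<alpha> = (n + 1) div 3" and h: "h \<le> \<alpha>" "n \<in> {5, 6, 8} \<Longrightarrow> h < \<alpha>"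
  shows "\<not> defective (pluecker_index 2 n) (grassmannian 2 n) (h + 1)"
proof (cases "h = \<alpha>")
  case True
  then have "n \<noteq> 5" "n \<noteq> 6" "n \<noteq> 8" using h(2) by auto
  then have "7 \<le> n" "n \<noteq> 8" using n by auto
  then show ?thesis using not_defective_2_extra_point[OF _ _ \<alpha>] True by simp
next
  case False
  define W where "W = (\<lambda>x (i :: nat). x :: nat) ` {..<\<alpha>}"
  have "inj_on (\<lambda>x (i :: nat). x :: nat) {..<\<alpha>}" by (auto simp: inj_on_def fun_eq_iff)
  then have "card W = \<alpha>" by (simp add: W_def card_image)
  then show ?thesis
    using \<alpha> h False
    by (intro not_defective_if_words[where W = W and E = "{}" and \<alpha> = \<alpha>]) (auto simp: W_def)
qed

section \<open>Non-defectivity of Grassmannians\<close>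

theorem theorem3p5p1:
  fixes r n h \<alpha> :: nat
  assumes "2 \<le> r" and "2 * r + 1 \<le> n"
    and "\<alpha> = (n + 1) div (r + 1)"
    and "(r\<^sup>2 + 3 * r + 1 \<le> n \<and> h \<le> \<alpha> * h_fun \<alpha> (r - 1)) \<or>
         (n < r\<^sup>2 + 3 * r + 1 \<and> even r \<and>
            h \<le> (\<alpha> - 1) * h_fun \<alpha> (r - 1) + h_fun \<alpha> (n - 2 - \<alpha> * r)) \<or>
         (n < r\<^sup>2 + 3 * r + 1 \<and> odd r \<and>
            h \<le> (\<alpha> - 1) * h_fun \<alpha> (r - 2) + h_fun \<alpha> (min (n - 3 - \<alpha> * (r - 1)) (r - 2)))"
  shows "\<not> defective (pluecker_index r n) (grassmannian r n) (h + 1)"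
proof -
  have a2: "2 \<le> \<alpha>" using alpha_bounds(3)[OF assms(3,2)] .
  consider "r = 2" | "r = 3" | "r = 4" | "5 \<le> r" using assms(1) by linarith
  then show ?thesis
  proof cases
    case 1
    have \<alpha>: "\<alpha> = (n + 1) div 3" using assms(3) 1 by simp
    have n: "5 \<le> n" using assms(2) 1 by simp
    have "h \<le> \<alpha> \<and> (n \<in> {5, 6, 8} \<longrightarrow> h < \<alpha>)"
    proof (cases "11 \<le> n")
      case True
      then show ?thesis using assms(4) 1 by (auto simp: h_fun_small[unfolded One_nat_def])
    next
      case False
      then have h: "h \<le> (\<alpha> - 1) + h_fun \<alpha> (n - 2 - \<alpha> * 2)"
        using assms(4) 1 by (auto simp: h_fun_small[unfolded One_nat_def])
      have "n = 5 \<or> n = 6 \<or> n = 7 \<or> n = 8 \<or> n = 9 \<or> n = 10" using n False by auto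
      then show ?thesis using h \<alpha> by (elim disjE) (simp_all add: h_fun_small[unfolded One_nat_def])
    qed
    then have "h \<le> \<alpha>" "n \<in> {5, 6, 8} \<Longrightarrow> h < \<alpha>" by blast+
    then show ?thesis unfolding 1 by (rule not_defective_r_2[OF n \<alpha>])
  next
    case 2
    have \<alpha>: "\<alpha> = (n + 1) div 4" using assms(3) 2 by simp
    have n: "7 \<le> n" using assms(2) 2 by simp
    have "h \<le> \<alpha> \<and> (n = 7 \<longrightarrow> h \<le> 1)"
    proof (cases "19 \<le> n")
      case True
      then show ?thesis using assms(4) 2 by (auto simp: h_fun_small)
    next
      case False
      then have h: "h \<le> (\<alpha> - 1) + h_fun \<alpha> (min (n - 3 - \<alpha> * 2) 1)"
        using assms(4) 2 by (auto simp: h_fun_small[unfolded One_nat_def])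
      have "min (n - 3 - \<alpha> * 2) 1 = 0 \<or> min (n - 3 - \<alpha> * 2) 1 = 1" by auto
      then have le1: "h_fun \<alpha> (min (n - 3 - \<alpha> * 2) 1) \<le> 1"
        by (elim disjE) (simp_all only: h_fun_small)
      have "h \<le> 1" if "n = 7"
      proof -
        have "\<alpha> = 2" using that \<alpha> by simp
        then show ?thesis using h that by (simp add: h_fun_small)
      qed
      moreover have "h \<le> \<alpha>" using h le1 a2 by linarith
      ultimately show ?thesis by simp
    qed
    then have "h \<le> \<alpha>" "n = 7 \<Longrightarrow> h \<le> 1" by blast+
    then show ?thesis unfolding 2 by (rule not_defective_r_3[OF n \<alpha>])
  next
    case 3
    show ?thesis
      unfolding 3 by (rule not_defective_r_4[of n \<alpha>]) (use assms 3 in auto)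
  next
    case 4
    show ?thesis
      by (rule not_defective_r_ge_5[OF 4 assms(2,3)]) (use assms(4) in blast)
  qed
qed

end
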